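(* The bialgebras $\mathfrak M\mathrm{MR}$ and $\mathfrak m\mathrm{MR}$ are continuous duals of each other with dual bases $\{w\mid w\in S^{\mathfrak m}_\infty\}$ and $\{v\mid v\in S^{\mathfrak M}_\infty\}$, where $S^{\mathfrak m}_\infty$ is identified with $S^{\mathfrak M}_\infty$ via $w\leftrightarrow w^{-1}$. The antipode $S_{\mathfrak M\mathrm{MR}}$ of $\mathfrak M\mathrm{MR}$ induces an antipode $S_{\mathfrak m\mathrm{MR}}$ of $\mathfrak m\mathrm{MR}$, making $\mathfrak M\mathrm{MR}$ and $\mathfrak m\mathrm{MR}$ continuous duals as Hopf algebras.
   Context: Continuous duality: let $V$ be the space of arbitrary (possibly infinite) $\mathbb Z$-linear combinations of elements $v_s$, $s\in S$. A linear functional on $V$ is continuous if it respects infinite linear combinations; the continuous functionals form the continuous dual $V_c^*$, free with basis $f_s$, $f_s(v_{s'})=\delta_{ss'}$, and $V$ is the usual dual of $V_c^*$. One says $V$ and $V_c^*$ are continuous duals with dual bases $\{v_s\},\{f_s\}$. For bialgebras (Hopf algebras) with distinguished bases this means in addition that product and coproduct (and unit and counit, and antipode) are transposes of each other. The bialgebra $\mathfrak m\mathrm{MR}$: an $\mathfrak m$-permutation of $[n]$ is a word in $1,\dots,n$ using every letter of $[n]$, with no two consecutive letters equal; $S^{\mathfrak m}_n$ is the set of these, $S^{\mathfrak m}_0=\{\emptyset\}$, $S^{\mathfrak m}_\infty=\bigcup_n S^{\mathfrak m}_n$. $\mathfrak m\mathrm{MR}=\prod_{w\in S^{\mathfrak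 m}_\infty}\mathbb Z w$ (arbitrary linear combinations; maps extended continuously, tensor products completed). A word $w_1\cdots w_r$ is a multiword of $u=u_1\cdots u_k$ if $w_j=u_{t(j)}$ for a surjective non-decreasing $t:[r]\to[k]$. For $w\in S^{\mathfrak m}_n$, $u=u_1\cdots u_l\in S^{\mathfrak m}_m$, the product $w*u$ is the sum of all words with no two consecutive letters equal whose restriction to the letters $[n]$ is a multiword of $w$ and whose restriction to $[n+1,n+m]$ is a multiword of $(u_1+n)\cdots(u_l+n)$. The coproduct is $\Delta(w_1\cdots w_k)=\sum_{i=0}^k\mathrm{st}(w_1\cdots w_i)\otimes\mathrm{st}(w_{i+1}\cdots w_k)+\sum_{i=1}^k\mathrm{st}(w_1\cdots w_i)\otimes\mathrm{st}(w_i\cdots w_k)$, where $\mathrm{st}$ of a word is the unique $\mathfrak m$-permutation of the same length with the same relative order of letters. Unit $n\mapsto n\emptyset$, counit the coefficient of $\emptyset$. The Hopf algebra $\mathfrak M\mathrm{MR}$: a set composition of a finite set $S$ of positive integers is a word $w_1\cdots w_k$ of nonempty disjoint sets with union $S$. An $\mathfrak M$-permutation of $[n]$ is a set composition of $[n]$ with no $w_i$ containing two consecutive integers; $S^{\mathfrak M}_n$ is the set of these, $S^{\mathfrak M}_0=\{\emptyset\}$, $S^{\mathfrak M}_\infty=\bigcup_nS^{\mathfrak M}_n$. $\mathfrak M\mathrm{MR}=\bigoplus_{w\in S^{\mathfrak M}_\infty}\mathbb Z w$ (finite linear combinations). For a set composition $w$, $\mathrm{st}(w)\in S^{\mathfrak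 M}_\infty$ is obtained by repeatedly (R1) deleting $i+1$ if $i,i+1$ lie in the same $w_j$, (R2) reducing all letters larger than $i$ by $1$ if the positive integer $i$ is not present. $w|_T$ is obtained by intersecting each $w_i$ with $T$ and removing empty sets. For $w\in S^{\mathfrak M}_m,u\in S^{\mathfrak M}_n$, $w\bullet u=\sum v$ over all $v\in S^{\mathfrak M}_{m+n}$ with $v|_{[m]}=w$, $\mathrm{st}(v|_{[m+1,m+n]})=u$, and all $v\in S^{\mathfrak M}_{m+n-1}$ with $v|_{[m]}=w$, $\mathrm{st}(v|_{[m,m+n-1]})=u$. $\vartriangle w=\sum_{[u,v]=w}\mathrm{st}(u)\otimes\mathrm{st}(v)$ over all ways to write $w$ as a concatenation of two (possibly empty) set compositions. Unit $1\mapsto\emptyset$, counit the coefficient of $\emptyset$. This bialgebra has an antipode $S_{\mathfrak M\mathrm{MR}}$. Inverse: for $w=w_1\cdots w_k\in S^{\mathfrak M}_n$, $w^{-1}$ is the $\mathfrak m$-permutation of $[k]$ of length $n$ in which the letter $i$ occurs exactly in the positions belonging to $w_i$. This is a bijection $S^{\mathfrak M}_\infty\to S^{\mathfrak m}_\infty$, whose inverse is also denoted $w\mapsto w^{-1}$. *)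

theory Defs
  imports Main
begin

section \<open>Modules of linear combinations of a distinguished basis\<close>

text \<open>
  Linear combinations of the elements of a set \<open>B\<close> are coefficient functions vanishing outside \<open>B\<close>.
  The (completed) tensor square of such a module is the module of finite (arbitrary) combinations
  of the elements of \<open>B \<times> B\<close>.
\<close>

definition fin_combs :: "'a set \<Rightarrow> ('a \<Rightarrow> int) set" where
  "fin_combs B = {f. finite {a. f a \<noteq> 0} \<and> {a. f a \<noteq> 0} \<subseteq> B}"

definition all_combs :: "'a set \<Rightarrow> ('a \<Rightarrow> int) set" where
  "all_combs B = {f. {a. f a \<noteq> 0} \<subseteq> B}"

definition basis_elem :: "'a \<Rightarrow> 'a \<Rightarrow> int" where
  "basis_elem a = (\<lambda>b. of_bool (b = a))"

definition linear_functional :: "('a \<Rightarrow> int) set \<Rightarrow> (('a \<Rightarrow> int) \<Rightarrow> int) \<Rightarrow> bool" where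
  "linear_functional M \<phi> \<longleftrightarrow>
     (\<forall>x\<in>M. \<forall>y\<in>M. \<forall>c d. \<phi> (\<lambda>a. c * x a + d * y a) = c * \<phi> x + d * \<phi> y)"

definition linear_map ::
  "('a \<Rightarrow> int) set \<Rightarrow> ('b \<Rightarrow> int) set \<Rightarrow> (('a \<Rightarrow> int) \<Rightarrow> ('b \<Rightarrow> int)) \<Rightarrow> bool" where
  "linear_map M N T \<longleftrightarrow> T ` M \<subseteq> N \<and> (\<forall>b. linear_functional M (\<lambda>x. T x b))"

text \<open>
  A functional respects infinite linear combinations if its value on every \<open>\<Sum>\<^sub>a f a \<cdot> a\<close> is the sum
  of the \<open>f a \<cdot> \<phi> a\<close>; as no convergence is involved, this sum must have finitely many nonzero terms.
\<close>

definition continuous_functional :: "'a set \<Rightarrow> (('a \<Rightarrow> int) \<Rightarrow> int) \<Rightarrow> bool" where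
  "continuous_functional A \<phi> \<longleftrightarrow>
     linear_functional (all_combs A) \<phi> \<and>
     (\<forall>f\<in>all_combs A.
        finite {a \<in> A. f a * \<phi> (basis_elem a) \<noteq> 0} \<and>
        \<phi> f = (\<Sum>a | a \<in> A \<and> f a * \<phi> (basis_elem a) \<noteq> 0. f a * \<phi> (basis_elem a)))"

definition continuous_map ::
  "'a set \<Rightarrow> 'b set \<Rightarrow> (('a \<Rightarrow> int) \<Rightarrow> ('b \<Rightarrow> int)) \<Rightarrow> bool" where
  "continuous_map A B T \<longleftrightarrow>
     T ` all_combs A \<subseteq> all_combs B \<and> (\<forall>b. continuous_functional A (\<lambda>f. T f b))"

text \<open>
  \<open>lin_extend \<phi>\<close> is the (continuous) linear extension of the map \<open>a \<mapsto> \<phi> a\<close> on basis elements.  The sum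
  is a genuine one whenever \<open>f\<close> has finite support or, for each \<open>b\<close>, only finitely many \<open>\<phi> a\<close>
  involve \<open>b\<close>.
\<close>

definition lin_extend :: "('a \<Rightarrow> 'b \<Rightarrow> int) \<Rightarrow> ('a \<Rightarrow> int) \<Rightarrow> ('b \<Rightarrow> int)" where
  "lin_extend \<phi> f = (\<lambda>b. \<Sum>a | f a * \<phi> a b \<noteq> 0. f a * \<phi> a b)"

definition tensor :: "('a \<Rightarrow> int) \<Rightarrow> ('b \<Rightarrow> int) \<Rightarrow> ('a \<times> 'b \<Rightarrow> int)" where
  "tensor x y = (\<lambda>(a, b). x a * y b)"

text \<open>\<open>map_left T\<close> is \<open>T \<otimes> id\<close> and \<open>map_right T\<close> is \<open>id \<otimes> T\<close>: apply \<open>T\<close> to the slices.\<close>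

definition map_left ::
  "(('a \<Rightarrow> int) \<Rightarrow> ('c \<Rightarrow> int)) \<Rightarrow> ('a \<times> 'b \<Rightarrow> int) \<Rightarrow> ('c \<times> 'b \<Rightarrow> int)" where
  "map_left T F = (\<lambda>(c, b). T (\<lambda>a. F (a, b)) c)"

definition map_right ::
  "(('b \<Rightarrow> int) \<Rightarrow> ('c \<Rightarrow> int)) \<Rightarrow> ('a \<times> 'b \<Rightarrow> int) \<Rightarrow> ('a \<times> 'c \<Rightarrow> int)" where
  "map_right T F = (\<lambda>(a, c). T (\<lambda>b. F (a, b)) c)"

definition middle_swap ::
  "(('a \<times> 'b) \<times> ('c \<times> 'd) \<Rightarrow> int) \<Rightarrow> (('a \<times> 'c) \<times> ('b \<times> 'd) \<Rightarrow> int)" where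
  "middle_swap F = (\<lambda>((a, c), (b, d)). F ((a, b), (c, d)))"


section \<open>Bialgebras and antipodes\<close>

record 'a bialg =
  basis :: "'a set"
  mult :: "('a \<times> 'a \<Rightarrow> int) \<Rightarrow> ('a \<Rightarrow> int)"
  unit_map :: "int \<Rightarrow> ('a \<Rightarrow> int)"
  comult :: "('a \<Rightarrow> int) \<Rightarrow> ('a \<times> 'a \<Rightarrow> int)"
  counit :: "('a \<Rightarrow> int) \<Rightarrow> int"

definition bialgebra_laws :: "('a \<Rightarrow> int) set \<Rightarrow> 'a bialg \<Rightarrow> bool" where
  "bialgebra_laws M H \<longleftrightarrow>
     (\<forall>n. unit_map H n \<in> M \<and> unit_map H n = (\<lambda>a. n * unit_map H 1 a)) \<and>
     (\<forall>x\<in>M. \<forall>y\<in>M. \<forall>z\<in>M.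
        mult H (tensor (mult H (tensor x y)) z) = mult H (tensor x (mult H (tensor y z)))) \<and>
     (\<forall>x\<in>M. mult H (tensor (unit_map H 1) x) = x \<and> mult H (tensor x (unit_map H 1)) = x) \<and>
     (\<forall>x\<in>M. \<forall>a b c.
        map_left (comult H) (comult H x) ((a, b), c) =
        map_right (comult H) (comult H x) (a, (b, c))) \<and>
     (\<forall>x\<in>M. (\<lambda>b. counit H (\<lambda>a. comult H x (a, b))) = x \<and>
            (\<lambda>a. counit H (\<lambda>b. comult H x (a, b))) = x) \<and>
     (\<forall>x\<in>M. \<forall>y\<in>M.
        comult H (mult H (tensor x y)) =
        map_left (mult H) (map_right (mult H) (middle_swap (tensor (comult H x) (comult H y))))) \<and>
     comult H (unit_map H 1) = tensor (unit_map H 1) (unit_map H 1) \<and>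
     (\<forall>x\<in>M. \<forall>y\<in>M. counit H (mult H (tensor x y)) = counit H x * counit H y) \<and>
     counit H (unit_map H 1) = 1"

definition free_bialgebra :: "'a bialg \<Rightarrow> bool" where
  "free_bialgebra H \<longleftrightarrow>
     linear_map (fin_combs (basis H \<times> basis H)) (fin_combs (basis H)) (mult H) \<and>
     linear_map (fin_combs (basis H)) (fin_combs (basis H \<times> basis H)) (comult H) \<and>
     linear_functional (fin_combs (basis H)) (counit H) \<and>
     bialgebra_laws (fin_combs (basis H)) H"

definition complete_bialgebra :: "'a bialg \<Rightarrow> bool" where
  "complete_bialgebra H \<longleftrightarrow>
     continuous_map (basis H \<times> basis H) (basis H) (mult H) \<and>
     continuous_map (basis H) (basis H \<times> basis H) (comult H) \<and>
     continuous_functional (basis H) (counit H) \<and>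
     bialgebra_laws (all_combs (basis H)) H"

definition antipode_laws ::
  "('a \<Rightarrow> int) set \<Rightarrow> 'a bialg \<Rightarrow> (('a \<Rightarrow> int) \<Rightarrow> ('a \<Rightarrow> int)) \<Rightarrow> bool" where
  "antipode_laws M H S \<longleftrightarrow>
     (\<forall>x\<in>M. mult H (map_left S (comult H x)) = unit_map H (counit H x) \<and>
            mult H (map_right S (comult H x)) = unit_map H (counit H x))"

definition free_antipode :: "'a bialg \<Rightarrow> (('a \<Rightarrow> int) \<Rightarrow> ('a \<Rightarrow> int)) \<Rightarrow> bool" where
  "free_antipode H S \<longleftrightarrow>
     linear_map (fin_combs (basis H)) (fin_combs (basis H)) S \<and>
     antipode_laws (fin_combs (basis H)) H S"

definition complete_antipode :: "'a bialg \<Rightarrow> (('a \<Rightarrow> int) \<Rightarrow> ('a \<Rightarrow> int)) \<Rightarrow> bool" where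
  "complete_antipode H S \<longleftrightarrow>
     continuous_map (basis H) (basis H) S \<and>
     antipode_laws (all_combs (basis H)) H S"


section \<open>Continuous duality\<close>

text \<open>
  A bijection \<open>\<iota>\<close> from the basis \<open>B\<close> of a free module to the basis \<open>A\<close> of a completed one identifies
  the two bases and thereby pairs the modules.
\<close>

definition pairing :: "('b \<Rightarrow> 'a) \<Rightarrow> ('a \<Rightarrow> int) \<Rightarrow> ('b \<Rightarrow> int) \<Rightarrow> int" where
  "pairing \<iota> f g = (\<Sum>b | g b \<noteq> 0. f (\<iota> b) * g b)"

definition continuous_duals :: "('b \<Rightarrow> 'a) \<Rightarrow> 'a set \<Rightarrow> 'b set \<Rightarrow> bool" where
  "continuous_duals \<iota> A B \<longleftrightarrow>
     bij_betw \<iota> B A \<and>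
     (\<forall>a\<in>A. \<forall>b\<in>B. pairing \<iota> (basis_elem a) (basis_elem b) = of_bool (a = \<iota> b)) \<and>
     (\<forall>g\<in>fin_combs B. continuous_functional A (\<lambda>f. pairing \<iota> f g)) \<and>
     (\<forall>\<phi>. continuous_functional A \<phi> \<longrightarrow>
        (\<exists>!g. g \<in> fin_combs B \<and> (\<forall>f\<in>all_combs A. \<phi> f = pairing \<iota> f g))) \<and>
     (\<forall>f\<in>all_combs A. linear_functional (fin_combs B) (\<lambda>g. pairing \<iota> f g)) \<and>
     (\<forall>\<psi>. linear_functional (fin_combs B) \<psi> \<longrightarrow>
        (\<exists>!f. f \<in> all_combs A \<and> (\<forall>g\<in>fin_combs B. \<psi> g = pairing \<iota> f g)))"

definition continuous_dual_bialgebras :: "('b \<Rightarrow> 'a) \<Rightarrow> 'a bialg \<Rightarrow> 'b bialg \<Rightarrow> bool" where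
  "continuous_dual_bialgebras \<iota> H K \<longleftrightarrow>
     complete_bialgebra H \<and> free_bialgebra K \<and>
     continuous_duals \<iota> (basis H) (basis K) \<and>
     (\<forall>F\<in>all_combs (basis H \<times> basis H). \<forall>g\<in>fin_combs (basis K).
        pairing \<iota> (mult H F) g = pairing (map_prod \<iota> \<iota>) F (comult K g)) \<and>
     (\<forall>f\<in>all_combs (basis H). \<forall>G\<in>fin_combs (basis K \<times> basis K).
        pairing (map_prod \<iota> \<iota>) (comult H f) G = pairing \<iota> f (mult K G)) \<and>
     (\<forall>n. \<forall>g\<in>fin_combs (basis K). pairing \<iota> (unit_map H n) g = n * counit K g) \<and>
     (\<forall>n. \<forall>f\<in>all_combs (basis H). counit H f * n = pairing \<iota> f (unit_map K n))"

definition continuous_dual_Hopf_algebras ::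
  "('b \<Rightarrow> 'a) \<Rightarrow> 'a bialg \<Rightarrow> (('a \<Rightarrow> int) \<Rightarrow> ('a \<Rightarrow> int)) \<Rightarrow>
   'b bialg \<Rightarrow> (('b \<Rightarrow> int) \<Rightarrow> ('b \<Rightarrow> int)) \<Rightarrow> bool" where
  "continuous_dual_Hopf_algebras \<iota> H S K T \<longleftrightarrow>
     continuous_dual_bialgebras \<iota> H K \<and> complete_antipode H S \<and> free_antipode K T \<and>
     (\<forall>f\<in>all_combs (basis H). \<forall>g\<in>fin_combs (basis K). pairing \<iota> (S f) g = pairing \<iota> f (T g))"


section \<open>The bialgebra mMR\<close>

definition mperms :: "nat \<Rightarrow> nat list set" where
  "mperms n = {w. set w = {1..n} \<and> distinct_adj w}"

definition mperms_all :: "nat list set" where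
  "mperms_all = (\<Union>n. mperms n)"

definition multiword_of :: "nat list \<Rightarrow> nat list \<Rightarrow> bool" where
  "multiword_of w u \<longleftrightarrow>
     (\<exists>t. mono_on {..<length w} t \<and> t ` {..<length w} = {..<length u} \<and>
          (\<forall>j<length w. w ! j = u ! t j))"

definition mstd :: "nat list \<Rightarrow> nat list" where
  "mstd w = (THE u. u \<in> mperms_all \<and> length u = length w \<and>
     (\<forall>i<length w. \<forall>j<length w. u ! i < u ! j \<longleftrightarrow> w ! i < w ! j))"

text \<open>For \<open>w \<in> mperms n\<close> we have \<open>n = card (set w)\<close>.\<close>

definition mMR_prod_words :: "nat list \<Rightarrow> nat list \<Rightarrow> nat list set" where
  "mMR_prod_words w u =
     (let n = card (set w); m = card (set u) in
      {x. set x \<subseteq> {1..n + m} \<and> distinct_adj x \<and>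
          multiword_of (filter (\<lambda>a. a \<in> {1..n}) x) w \<and>
          multiword_of (filter (\<lambda>a. a \<in> {n + 1..n + m}) x) (map (\<lambda>a. a + n) u)})"

definition mMR_prod :: "nat list \<times> nat list \<Rightarrow> nat list \<Rightarrow> int" where
  "mMR_prod = (\<lambda>(w, u) x. of_bool (x \<in> mMR_prod_words w u))"

definition mMR_coprod :: "nat list \<Rightarrow> nat list \<times> nat list \<Rightarrow> int" where
  "mMR_coprod w = (\<lambda>p.
     (\<Sum>i = 0..length w. basis_elem (mstd (take i w), mstd (drop i w)) p) +
     (\<Sum>i = 1..length w. basis_elem (mstd (take i w), mstd (drop (i - 1) w)) p))"

definition mMR :: "nat list bialg" where
  "mMR = \<lparr>basis = mperms_all, mult = lin_extend mMR_prod, unit_map = (\<lambda>n a. n * basis_elem [] a),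
          comult = lin_extend mMR_coprod, counit = (\<lambda>f. f [])\<rparr>"


section \<open>The Hopf algebra MMR\<close>

definition set_composition :: "nat set \<Rightarrow> nat set list \<Rightarrow> bool" where
  "set_composition X w \<longleftrightarrow>
     finite X \<and> 0 \<notin> X \<and> {} \<notin> set w \<and> \<Union> (set w) = X \<and>
     (\<forall>i<length w. \<forall>j<length w. i \<noteq> j \<longrightarrow> w ! i \<inter> w ! j = {})"

definition Mperms :: "nat \<Rightarrow> nat set list set" where
  "Mperms n = {w. set_composition {1..n} w \<and> (\<forall>A\<in>set w. \<forall>i. \<not> (i \<in> A \<and> i + 1 \<in> A))}"

definition Mperms_all :: "nat set list set" where
  "Mperms_all = (\<Union>n. Mperms n)"

inductive Mstd_step :: "nat set list \<Rightarrow> nat set list \<Rightarrow> bool" where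
  R1: "j < length w \<Longrightarrow> i \<in> w ! j \<Longrightarrow> i + 1 \<in> w ! j \<Longrightarrow>
       Mstd_step w (w[j := w ! j - {i + 1}])"
| R2: "i \<ge> 1 \<Longrightarrow> i \<notin> \<Union> (set w) \<Longrightarrow>
       Mstd_step w (map ((`) (\<lambda>a. if a > i then a - 1 else a)) w)"

definition Mstd :: "nat set list \<Rightarrow> nat set list" where
  "Mstd w = (THE v. Mstd_step\<^sup>*\<^sup>* w v \<and> v \<in> Mperms_all)"

definition restrict_comp :: "nat set list \<Rightarrow> nat set \<Rightarrow> nat set list" where
  "restrict_comp w X = filter (\<lambda>A. A \<noteq> {}) (map (\<lambda>A. A \<inter> X) w)"

text \<open>
  For \<open>w \<in> Mperms m\<close> we have \<open>m = card (\<Union> (set w))\<close>.  The two sets below are disjoint, so a product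
  of basis elements is multiplicity free.  The condition \<open>p + 1 = m + n\<close> makes the second set empty
  for \<open>m = n = 0\<close>, where truncated subtraction would be wrong.
\<close>

definition MMR_prod_comps :: "nat set list \<Rightarrow> nat set list \<Rightarrow> nat set list set" where
  "MMR_prod_comps w u =
     (let m = card (\<Union> (set w)); n = card (\<Union> (set u)) in
      {v \<in> Mperms (m + n).
         restrict_comp v {1..m} = w \<and> Mstd (restrict_comp v {m + 1..m + n}) = u} \<union>
      {v. \<exists>p. p + 1 = m + n \<and> v \<in> Mperms p \<and>
         restrict_comp v {1..m} = w \<and> Mstd (restrict_comp v {m..p}) = u})"

definition MMR_prod :: "nat set list \<times> nat set list \<Rightarrow> nat set list \<Rightarrow> int" where
  "MMR_prod = (\<lambda>(w, u) v. of_bool (v \<in> MMR_prod_comps w u))"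

definition MMR_coprod :: "nat set list \<Rightarrow> nat set list \<times> nat set list \<Rightarrow> int" where
  "MMR_coprod w = (\<lambda>p. \<Sum>i = 0..length w. basis_elem (Mstd (take i w), Mstd (drop i w)) p)"

definition MMR :: "nat set list bialg" where
  "MMR = \<lparr>basis = Mperms_all, mult = lin_extend MMR_prod, unit_map = (\<lambda>n a. n * basis_elem [] a),
          comult = lin_extend MMR_coprod, counit = (\<lambda>f. f [])\<rparr>"


section \<open>The bijection between the bases\<close>

text \<open>Letters and positions are counted from 1, list indices from 0.\<close>

definition comp_inverse :: "nat set list \<Rightarrow> nat list" where
  "comp_inverse w = (THE u. u \<in> mperms (length w) \<and> length u = card (\<Union> (set w)) \<and>
     (\<forall>i\<in>{1..length w}. {j \<in> {1..length u}. u ! (j - 1) = i} = w ! (i - 1)))"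

end

theory Submission
  imports Defs "HOL-Library.Groups_Big_Fun"
begin

text \<open>
  Everything is reduced to structure constants.  The bialgebra axioms for structure constants
  \<open>m\<close>, \<open>d\<close> of product and coproduct are symmetric in \<open>m\<close> and \<open>d\<close>, so they need to be checked once, and
  both bialgebras and their duality follow as soon as the structure constants of MMR are the
  transposes of those of mMR.

  On words, \<open>red\<close> deletes repeated adjacent letters.  The words with \<open>red w = w\<close> form a monoid under
  \<open>(a, b) \<mapsto> red (a @ b)\<close>, the coproduct of \<open>w\<close> is the sum of \<open>st a \<otimes> st b\<close> over all factorizations
  \<open>red (a @ b) = w\<close>, and \<open>x\<close> occurs in \<open>w * u\<close> iff \<open>red\<close> of the restrictions of \<open>x\<close> to small and large
  letters are \<open>w\<close> and the shifted \<open>u\<close>.  Since \<open>red\<close> after restriction is a homomorphism of these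
  monoids, product and coproduct are compatible.

  The coproduct of MMR is graded by the number of blocks, so a geometric series for the convolution
  inverse of the identity is locally finite; this is the antipode, and its transpose is one of mMR.
\<close>

section \<open>Sparse matrices\<close>

text \<open>Already the product of the words 1 and 1 involves 12, 21, 121, 212 and so on without
  end, so mMR has to be completed, and sums over basis elements make sense only under a finiteness
  condition: for a given word, finitely many pairs have it in their product. Matrices with finite
  columns express this; their transposes, with finite rows, belong to MMR. Each calculation is made
  once for both kinds.

  Compatibility is delicate because standardization forgets which letters of a factor are small. The
  count therefore runs over unstandardized words a, b with red (a @ b) = x. They keep the letters of
  x, so the threshold between small and large letters still makes sense in them, and splitting both
  at this threshold gives cuts of the two words that were multiplied.

  The antipode is built on the side of MMR because a word of mMR can be cut at the same letter again
  and again, so its iterated reduced coproducts never vanish. The number of letters is additive for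
  the product of mMR; transposed, a cut of a composition distributes its blocks, and this process
  ends.\<close>

lemma Sum_any_pair:
  assumes "finite {p. G p \<noteq> (0 :: 'c :: comm_monoid_add)}"
  shows "(\<Sum>a. \<Sum>b. G (a, b)) = Sum_any G"
proof -
  let ?S = "{p. G p \<noteq> 0}"
  \<comment> \<open>The nonzero rows and columns span a rectangle that may be larger than the
    support, but it stays inside the product of the two finite projections.\<close>
  have "{a. \<exists>b. G (a, b) \<noteq> 0} \<times> {b. \<exists>a. G (a, b) \<noteq> 0} \<subseteq> fst ` ?S \<times> snd ` ?S"
    by force
  from Sum_any.cartesian_product[OF _ this] assms show ?thesis
    by simp
qed

lemma Sum_any_swap:
  assumes "finite {p. case_prod G p \<noteq> (0 :: 'c :: comm_monoid_add)}"
  shows "(\<Sum>a. \<Sum>b. G a b) = (\<Sum>b. \<Sum>a. G a b)"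
proof -
  let ?S = "{p. case_prod G p \<noteq> 0}"
  have "{a. \<exists>b. G a b \<noteq> 0} \<times> {b. \<exists>a. G a b \<noteq> 0} \<subseteq> fst ` ?S \<times> snd ` ?S"
    by (auto simp: image_iff)
  from Sum_any.swap[OF _ this] assms show ?thesis
    by simp
qed

text \<open>No finiteness is assumed: \<open>h\<close> matches the two supports bijectively, and if
  they are infinite both sums have the default value 0.\<close>

lemma Sum_any_inj:
  assumes "inj_on h {a. g a \<noteq> 0}" and "\<And>a. g a \<noteq> 0 \<Longrightarrow> f (h a) = g a"
    and "\<And>b. f b \<noteq> 0 \<Longrightarrow> \<exists>a. g a \<noteq> 0 \<and> h a = b"
  shows "Sum_any f = Sum_any g"
proof -
  have "{b. f b \<noteq> 0} = h ` {a. g a \<noteq> 0}"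
    using assms(2,3) by auto
  then show ?thesis
    using assms by (simp add: Sum_any.expand_set sum.reindex)
qed

lemma lin_extend_Sum_any: "lin_extend \<phi> f b = (\<Sum>a. f a * \<phi> a b)"
  by (simp add: lin_extend_def Sum_any.expand_set)

text \<open>
  With \<open>r = True\<close> rows are finite, as for maps of free modules; with \<open>r = False\<close> columns are finite, as
  for continuous maps of completed modules.  Transposition exchanges the two cases.
\<close>

definition mat :: "bool \<Rightarrow> ('a \<Rightarrow> 'b \<Rightarrow> int) \<Rightarrow> bool" where
  "mat r \<phi> \<longleftrightarrow> (if r then \<forall>a. finite {b. \<phi> a b \<noteq> 0} else \<forall>b. finite {a. \<phi> a b \<noteq> 0})"

definition combs :: "bool \<Rightarrow> 'a set \<Rightarrow> ('a \<Rightarrow> int) set" where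
  "combs r A = (if r then fin_combs A else all_combs A)"

text \<open>Rows are images of basis elements, so composition is in diagram order and row
  \<open>a\<close> of a product is the image of row \<open>a\<close> of the left factor.\<close>

definition mcomp :: "('a \<Rightarrow> 'b \<Rightarrow> int) \<Rightarrow> ('b \<Rightarrow> 'c \<Rightarrow> int) \<Rightarrow> 'a \<Rightarrow> 'c \<Rightarrow> int"
    (infixr \<open>\<Zsemi>\<close> 65) where
  "(\<phi> \<Zsemi> \<psi>) a = lin_extend \<psi> (\<phi> a)"

definition mtensor ::
  "('a \<Rightarrow> 'b \<Rightarrow> int) \<Rightarrow> ('c \<Rightarrow> 'd \<Rightarrow> int) \<Rightarrow> 'a \<times> 'c \<Rightarrow> 'b \<times> 'd \<Rightarrow> int" (infixr \<open>\<otimes>\<close> 70) where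
  "(\<phi> \<otimes> \<psi>) = (\<lambda>(a, c) (b, d). \<phi> a b * \<psi> c d)"

lemma mtensor_apply [simp]: "(\<phi> \<otimes> \<psi>) (a, c) (b, d) = \<phi> a b * \<psi> c d"
  by (simp add: mtensor_def)

lemma mcomp_apply: "(\<phi> \<Zsemi> \<psi>) a c = (\<Sum>b. \<phi> a b * \<psi> b c)"
  by (simp add: mcomp_def lin_extend_Sum_any)

lemma mcomp_nonzeroE:
  assumes "(\<phi> \<Zsemi> \<psi>) a c \<noteq> 0"
  obtains b where "\<phi> a b \<noteq> 0" "\<psi> b c \<noteq> 0"
  using assms unfolding mcomp_apply
  by (auto elim!: Sum_any.not_neutral_obtains_not_neutral)

lemma matD:
  "mat True \<phi> \<Longrightarrow> finite {b. \<phi> a b \<noteq> 0}" "mat False \<phi> \<Longrightarrow> finite {a. \<phi> a b \<noteq> 0}"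
  by (auto simp: mat_def)

text \<open>For \<open>r = True\<close> the row of the left factor is finite, for
  \<open>r = False\<close> the column of the right factor. Either way an entry of a product is a
  genuine sum.\<close>

lemma finite_mid:
  assumes "mat r \<phi>" "mat r \<psi>"
  shows "finite {b. \<phi> a b \<noteq> 0 \<and> \<psi> b c \<noteq> 0}"
proof (cases r)
  case True
  with assms show ?thesis by (auto intro: finite_subset[OF _ matD(1)[of \<phi> a]])
next
  case False
  with assms show ?thesis by (auto intro: finite_subset[OF _ matD(2)[of \<psi> c]])
qed

text \<open>The pairs are enumerated from \<open>a\<close> onwards if rows are finite, and from
  \<open>d\<close> backwards if columns are.\<close>

lemma finite_mid2:
  assumes "mat r \<phi>" "mat r \<psi>" "mat r \<chi>"
  shows "finite {(b, c). \<phi> a b * \<psi> b c * \<chi> c d \<noteq> 0}"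
proof (cases r)
  case True
  have "finite (SIGMA b:{b. \<phi> a b \<noteq> 0}. {c. \<psi> b c \<noteq> 0})"
    using assms True by (auto intro!: finite_SigmaI matD(1))
  then show ?thesis by (rule rev_finite_subset) auto
next
  case False
  have "finite ((\<lambda>(c, b). (b, c)) ` (SIGMA c:{c. \<chi> c d \<noteq> 0}. {b. \<psi> b c \<noteq> 0}))"
    using assms False by (auto intro!: finite_SigmaI matD(2))
  then show ?thesis by (rule rev_finite_subset) force
qed

lemma mat_mcomp: 
  assumes "mat r \<phi>" "mat r \<psi>"
  shows "mat r (\<phi> \<Zsemi> \<psi>)"
proof (cases r)
  case True
  have "finite {c. (\<phi> \<Zsemi> \<psi>) a c \<noteq> 0}" for a
  proof (rule finite_subset)
    show "{c. (\<phi> \<Zsemi> \<psi>) a c \<noteq> 0} \<subseteq> (\<Union>b\<in>{b. \<phi> a b \<noteq> 0}. {c. \<psi> b c \<noteq> 0})"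
      by (auto elim!: mcomp_nonzeroE)
    show "finite (\<Union>b\<in>{b. \<phi> a b \<noteq> 0}. {c. \<psi> b c \<noteq> 0})"
      using assms True by (auto intro: matD)
  qed
  with True show ?thesis by (simp add: mat_def)
next
  case False
  have "finite {a. (\<phi> \<Zsemi> \<psi>) a c \<noteq> 0}" for c
  proof (rule finite_subset)
    show "{a. (\<phi> \<Zsemi> \<psi>) a c \<noteq> 0} \<subseteq> (\<Union>b\<in>{b. \<psi> b c \<noteq> 0}. {a. \<phi> a b \<noteq> 0})"
      by (auto elim!: mcomp_nonzeroE)
    show "finite (\<Union>b\<in>{b. \<psi> b c \<noteq> 0}. {a. \<phi> a b \<noteq> 0})"
      using assms False by (auto intro: matD)
  qed
  with False show ?thesis by (simp add: mat_def)
qed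

lemma mcomp_Sum_any:
  assumes "mat r \<phi>" "mat r \<psi>" "mat r \<chi>"
  shows "(\<phi> \<Zsemi> \<psi> \<Zsemi> \<chi>) a d = (\<Sum>(b, c). \<phi> a b * \<psi> b c * \<chi> c d)"
proof -
  have "(\<phi> \<Zsemi> \<psi> \<Zsemi> \<chi>) a d = (\<Sum>b. \<phi> a b * (\<Sum>c. \<psi> b c * \<chi> c d))"
    by (simp add: mcomp_apply)
  also have "\<dots> = (\<Sum>b. \<Sum>c. \<phi> a b * \<psi> b c * \<chi> c d)"
    by (simp add: Sum_any_right_distrib finite_mid[OF assms(2,3)] mult.assoc)
  also have "\<dots> = (\<Sum>(b, c). \<phi> a b * \<psi> b c * \<chi> c d)"
    using Sum_any_pair[of "\<lambda>(b, c). \<phi> a b * \<psi> b c * \<chi> c d"] finite_mid2[OF assms]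
    by (simp add: case_prod_unfold)
  finally show ?thesis .
qed

text \<open>Infinite matrices need not associate, since iterated sums over the two inner indices can
  depend on their order. Here the joint support is finite by \<open>finite_mid2\<close>.\<close>

lemma mcomp_assoc:
  assumes "mat r \<phi>" "mat r \<psi>" "mat r \<chi>"
  shows "(\<phi> \<Zsemi> \<psi>) \<Zsemi> \<chi> = \<phi> \<Zsemi> \<psi> \<Zsemi> \<chi>"
proof (intro ext)
  fix a d
  have "((\<phi> \<Zsemi> \<psi>) \<Zsemi> \<chi>) a d = (\<Sum>c. (\<Sum>b. \<phi> a b * \<psi> b c) * \<chi> c d)"
    by (simp add: mcomp_apply)
  also have "\<dots> = (\<Sum>c. \<Sum>b. \<phi> a b * \<psi> b c * \<chi> c d)"
    by (simp add: Sum_any_left_distrib finite_mid[OF assms(1,2)] mult.assoc)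
  also have "\<dots> = (\<Sum>b. \<Sum>c. \<phi> a b * \<psi> b c * \<chi> c d)"
    using finite_mid2[OF assms]
    by (intro Sum_any_swap[symmetric]) (simp add: case_prod_unfold)
  also have "\<dots> = (\<phi> \<Zsemi> \<psi> \<Zsemi> \<chi>) a d"
    unfolding mcomp_Sum_any[OF assms]
    using Sum_any_pair[of "\<lambda>(b, c). \<phi> a b * \<psi> b c * \<chi> c d"] finite_mid2[OF assms]
    by (simp add: case_prod_unfold)
  finally show "((\<phi> \<Zsemi> \<psi>) \<Zsemi> \<chi>) a d = (\<phi> \<Zsemi> \<psi> \<Zsemi> \<chi>) a d" .
qed

lemma mat_mtensor:
  assumes "mat r \<phi>" "mat r \<psi>"
  shows "mat r (\<phi> \<otimes> \<psi>)"
proof (cases r)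
  case True
  have "finite {p. (\<phi> \<otimes> \<psi>) (a, c) p \<noteq> 0}" for a c
    using assms True
    by (intro finite_subset[OF _ finite_cartesian_product[OF matD(1)[of \<phi> a] matD(1)[of \<psi> c]]])
      auto
  with True show ?thesis by (simp add: mat_def)
next
  case False
  have "finite {p. (\<phi> \<otimes> \<psi>) p (b, d) \<noteq> 0}" for b d
    using assms False
    by (intro finite_subset[OF _ finite_cartesian_product[OF matD(2)[of \<phi> b] matD(2)[of \<psi> d]]])
      auto
  with False show ?thesis by (simp add: mat_def)
qed

lemma mat_basis_elem: "mat r basis_elem"
  by (simp add: mat_def basis_elem_def)

text \<open>The interchange law. With it, identities between maps on tensor products become
  rearrangements of layers, each layer a tensor product of matrices.\<close>

lemma mtensor_mcomp:
  assumes "mat r \<phi>" "mat r \<psi>" "mat r \<phi>'" "mat r \<psi>'"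
  shows "(\<phi> \<Zsemi> \<psi>) \<otimes> (\<phi>' \<Zsemi> \<psi>') = (\<phi> \<otimes> \<phi>') \<Zsemi> (\<psi> \<otimes> \<psi>')"
proof (intro ext, clarify)
  fix a a' c c'
  have fin: "finite {b. \<phi> a b * \<psi> b c \<noteq> 0}" "finite {b. \<phi>' a' b * \<psi>' b c' \<noteq> 0}"
    using assms finite_mid by simp_all
  have "((\<phi> \<Zsemi> \<psi>) \<otimes> (\<phi>' \<Zsemi> \<psi>')) (a, a') (c, c')
      = (\<Sum>b. \<phi> a b * \<psi> b c) * (\<Sum>b'. \<phi>' a' b' * \<psi>' b' c')"
    by (simp add: mcomp_apply)
  also have "\<dots> = (\<Sum>b. \<Sum>b'. (\<phi> a b * \<psi> b c) * (\<phi>' a' b' * \<psi>' b' c'))"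
    unfolding Sum_any_left_distrib[OF fin(1)] unfolding Sum_any_right_distrib[OF fin(2)] ..
  also have "\<dots> = (\<Sum>p. (\<phi> \<otimes> \<phi>') (a, a') p * (\<psi> \<otimes> \<psi>') p (c, c'))"
    using Sum_any_pair[of "\<lambda>p. (\<phi> \<otimes> \<phi>') (a, a') p * (\<psi> \<otimes> \<psi>') p (c, c')"]
      finite_mid[OF mat_mtensor[OF assms(1,3)] mat_mtensor[OF assms(2,4)]]
    by (simp add: mult_ac del: mtensor_apply) (simp add: mult_ac)
  finally show "((\<phi> \<Zsemi> \<psi>) \<otimes> (\<phi>' \<Zsemi> \<psi>')) (a, a') (c, c')
      = ((\<phi> \<otimes> \<phi>') \<Zsemi> (\<psi> \<otimes> \<psi>')) (a, a') (c, c')"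
    by (simp add: mcomp_apply)
qed

lemma basis_elem_mcomp [simp]: "basis_elem \<Zsemi> \<phi> = \<phi>"
proof (intro ext)
  fix a c
  have "(\<lambda>b. basis_elem a b * \<phi> b c) = (\<lambda>b. if b = a then \<phi> b c else 0)"
    by (auto simp: basis_elem_def)
  then show "(basis_elem \<Zsemi> \<phi>) a c = \<phi> a c"
    unfolding mcomp_apply by (simp only: Sum_any.delta)
qed

lemma mcomp_basis_elem [simp]: "\<phi> \<Zsemi> basis_elem = \<phi>"
proof (intro ext)
  fix a c
  have "(\<lambda>b. \<phi> a b * basis_elem b c) = (\<lambda>b. if b = c then \<phi> a b else 0)"
    by (auto simp: basis_elem_def)
  then show "(\<phi> \<Zsemi> basis_elem) a c = \<phi> a c"
    unfolding mcomp_apply by (simp only: Sum_any.delta)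
qed

section \<open>Linear combinations as one-row matrices\<close>

lemma lin_extend_basis_elem [simp]: "lin_extend \<phi> (basis_elem a) = \<phi> a"
  using fun_cong[OF basis_elem_mcomp[of \<phi>], of a] by (simp only: mcomp_def)

text \<open>For \<open>r = True\<close> the single row is finite because the combination is; for
  \<open>r = False\<close> each column has only one entry. Functoriality of
  \<open>lin_extend\<close> thus becomes associativity of matrix products.\<close>

lemma mat_row: "f \<in> combs r A \<Longrightarrow> mat r (\<lambda>_ :: unit. f)"
  by (auto simp: mat_def combs_def fin_combs_def)

lemma lin_extend_row: "lin_extend \<phi> f = ((\<lambda>_ :: unit. f) \<Zsemi> \<phi>) ()"
  by (simp add: mcomp_def)

lemma lin_extend_lin_extend:
  assumes "f \<in> combs r A" "mat r \<phi>" "mat r \<psi>"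
  shows "lin_extend \<psi> (lin_extend \<phi> f) = lin_extend (\<phi> \<Zsemi> \<psi>) f"
  using fun_cong[OF mcomp_assoc[OF mat_row[OF assms(1)] assms(2,3)], of "()"]
  by (simp add: mcomp_def)

lemma tensor_lin_extend:
  assumes "x \<in> combs r A" "y \<in> combs r B" "mat r \<phi>" "mat r \<psi>"
  shows "tensor (lin_extend \<phi> x) (lin_extend \<psi> y) = lin_extend (\<phi> \<otimes> \<psi>) (tensor x y)"
  using fun_cong[OF mtensor_mcomp[OF mat_row[OF assms(1)] assms(3) mat_row[OF assms(2)] assms(4)],
    of "((), ())"]
  by (simp add: mcomp_def tensor_def mtensor_def)

lemma lin_extend_combs:
  assumes "f \<in> combs r A" "mat r \<phi>" "\<And>a b. a \<in> A \<Longrightarrow> \<phi> a b \<noteq> 0 \<Longrightarrow> b \<in> B"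
  shows "lin_extend \<phi> f \<in> combs r B"
proof -
  have supp: "b \<in> B" if "lin_extend \<phi> f b \<noteq> 0" for b
  proof -
    from that obtain a where "f a \<noteq> 0" "\<phi> a b \<noteq> 0"
      unfolding lin_extend_row by (rule mcomp_nonzeroE)
    moreover from \<open>f a \<noteq> 0\<close> assms(1) have "a \<in> A"
      by (auto simp: combs_def fin_combs_def all_combs_def split: if_splits)
    ultimately show ?thesis using assms(3) by blast
  qed
  have "mat r ((\<lambda>_ :: unit. f) \<Zsemi> \<phi>)"
    using assms by (intro mat_mcomp mat_row)
  then have "r \<Longrightarrow> finite {b. lin_extend \<phi> f b \<noteq> 0}"
    using matD(1)[of "(\<lambda>_ :: unit. f) \<Zsemi> \<phi>" "()"] by (simp add: mcomp_def)
  with supp show ?thesis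
    by (auto simp: combs_def fin_combs_def all_combs_def)
qed

lemma lin_extend_cong:
  assumes "f \<in> combs r A" "\<And>a. a \<in> A \<Longrightarrow> \<phi> a = \<psi> a"
  shows "lin_extend \<phi> f = lin_extend \<psi> f"
proof (intro ext)
  fix b
  have "f a * \<phi> a b = f a * \<psi> a b" for a
    using assms by (cases "f a = 0") (auto simp: combs_def fin_combs_def all_combs_def split: if_splits)
  then show "lin_extend \<phi> f b = lin_extend \<psi> f b"
    unfolding lin_extend_Sum_any by (rule Sum_any.cong)
qed

lemma lin_extend_ident:
  assumes "f \<in> combs r A" "\<And>a. a \<in> A \<Longrightarrow> \<phi> a = basis_elem a"
  shows "lin_extend \<phi> f = f"
proof -
  have "lin_extend \<phi> f = lin_extend basis_elem f"
    using assms by (rule lin_extend_cong)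
  also have "\<dots> = f"
    unfolding lin_extend_row by simp
  finally show ?thesis .
qed

lemma combs_iff:
  "f \<in> combs r A \<longleftrightarrow> (r \<longrightarrow> finite {a. f a \<noteq> 0}) \<and> (\<forall>a. f a \<noteq> 0 \<longrightarrow> a \<in> A)"
  by (auto simp: combs_def fin_combs_def all_combs_def)

lemma tensor_combs:
  assumes "x \<in> combs r A" "y \<in> combs r B"
  shows "tensor x y \<in> combs r (A \<times> B)"
proof -
  have "{p. tensor x y p \<noteq> 0} = {a. x a \<noteq> 0} \<times> {b. y b \<noteq> 0}"
    by (auto simp: tensor_def)
  with assms show ?thesis
    by (auto simp: combs_iff tensor_def)
qed

lemma slice_combs:
  assumes "F \<in> combs r (A \<times> B)"
  shows "(\<lambda>a. F (a, b)) \<in> combs r A" "(\<lambda>b. F (a, b)) \<in> combs r B"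
proof -
  have "{a. F (a, b) \<noteq> 0} \<subseteq> fst ` {p. F p \<noteq> 0}" "{b. F (a, b) \<noteq> 0} \<subseteq> snd ` {p. F p \<noteq> 0}"
    by force+
  then show "(\<lambda>a. F (a, b)) \<in> combs r A" "(\<lambda>b. F (a, b)) \<in> combs r B"
    using assms by (auto simp: combs_iff intro: finite_subset)
qed

text \<open>\<open>map_left\<close> acts on slices, and these are again combinations of elements of
  \<open>A\<close>. Hence \<open>T\<close> has to be known only there.\<close>

lemma map_left_lin_extend:
  assumes "F \<in> combs r (A \<times> B)" "\<And>f. f \<in> combs r A \<Longrightarrow> T f = lin_extend \<phi> f"
  shows "map_left T F = lin_extend (\<phi> \<otimes> basis_elem) F"
proof (intro ext, clarify)
  fix c b
  have "map_left T F (c, b) = (\<Sum>a. F (a, b) * \<phi> a c)"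
    by (simp add: map_left_def assms(2)[OF slice_combs(1)[OF assms(1)]] lin_extend_Sum_any)
  also have "\<dots> = (\<Sum>p. F p * (\<phi> \<otimes> basis_elem) p (c, b))"
    by (rule Sum_any_inj[where h = "\<lambda>a. (a, b)", symmetric])
      (auto simp: inj_on_def basis_elem_def split: if_splits)
  finally show "map_left T F (c, b) = lin_extend (\<phi> \<otimes> basis_elem) F (c, b)"
    by (simp add: lin_extend_Sum_any)
qed

lemma map_right_lin_extend:
  assumes "F \<in> combs r (A \<times> B)" "\<And>f. f \<in> combs r B \<Longrightarrow> T f = lin_extend \<phi> f"
  shows "map_right T F = lin_extend (basis_elem \<otimes> \<phi>) F"
proof (intro ext, clarify)
  fix a c
  have "map_right T F (a, c) = (\<Sum>b. F (a, b) * \<phi> b c)"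
    by (simp add: map_right_def assms(2)[OF slice_combs(2)[OF assms(1)]] lin_extend_Sum_any)
  also have "\<dots> = (\<Sum>p. F p * (basis_elem \<otimes> \<phi>) p (a, c))"
    by (rule Sum_any_inj[where h = "\<lambda>b. (a, b)", symmetric])
      (auto simp: inj_on_def basis_elem_def split: if_splits)
  finally show "map_right T F (a, c) = lin_extend (basis_elem \<otimes> \<phi>) F (a, c)"
    by (simp add: lin_extend_Sum_any)
qed

definition mperm :: "('a \<Rightarrow> 'b) \<Rightarrow> 'a \<Rightarrow> 'b \<Rightarrow> int" where
  "mperm f a = basis_elem (f a)"

lemma mat_mperm:
  assumes "inj f"
  shows "mat r (mperm f)"
proof -
  have "{a. b = f a} = f -` {b}" for b
    by auto
  then have "finite {a. b = f a}" for b
    using finite_vimageI[OF _ assms, of "{b}"] by simp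
  then show ?thesis
    by (simp add: mat_def mperm_def basis_elem_def)
qed

lemma mperm_mcomp: "(mperm f \<Zsemi> \<phi>) a = \<phi> (f a)"
  by (simp add: mcomp_def mperm_def)

lemma mcomp_mperm: "inj f \<Longrightarrow> (\<phi> \<Zsemi> mperm f) a (f b) = \<phi> a b"
proof -
  assume "inj f"
  then have "(\<lambda>b'. \<phi> a b' * mperm f b' (f b)) = (\<lambda>b'. if b' = b then \<phi> a b' else 0)"
    by (auto simp: mperm_def basis_elem_def inj_eq fun_eq_iff)
  then show ?thesis unfolding mcomp_apply by (simp only: Sum_any.delta)
qed

section \<open>Linear and continuous maps given by matrices\<close>

lemma linear_functional_lin_extend:
  assumes "mat r \<phi>"
  shows "linear_functional (combs r A) (\<lambda>f. lin_extend \<phi> f b)"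
  unfolding linear_functional_def
proof (intro ballI allI)
  fix x y :: "'a \<Rightarrow> int" and c d :: int
  assume xy: "x \<in> combs r A" "y \<in> combs r A"
  have fin: "finite {a. x a * \<phi> a b \<noteq> 0}" "finite {a. y a * \<phi> a b \<noteq> 0}"
    using finite_mid[OF mat_row[OF xy(1)] assms] finite_mid[OF mat_row[OF xy(2)] assms] by auto
  have "finite {a. c * (x a * \<phi> a b) \<noteq> 0}" "finite {a. d * (y a * \<phi> a b) \<noteq> 0}"
    by (auto intro: finite_subset[OF _ fin(1)] finite_subset[OF _ fin(2)])
  then show "lin_extend \<phi> (\<lambda>a. c * x a + d * y a) b = c * lin_extend \<phi> x b + d * lin_extend \<phi> y b"
    using fin by (simp add: lin_extend_Sum_any Sum_any_right_distrib Sum_any.distrib[symmetric]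
        algebra_simps)
qed

lemma linear_functional_cong:
  assumes "\<And>c d x y. x \<in> M \<Longrightarrow> y \<in> M \<Longrightarrow> (\<lambda>a. c * x a + d * y a) \<in> M"
    and "\<And>f. f \<in> M \<Longrightarrow> \<phi> f = \<psi> f" and "linear_functional M \<psi>"
  shows "linear_functional M \<phi>"
  using assms by (simp add: linear_functional_def)

lemma combs_closed:
  assumes "x \<in> combs r A" "y \<in> combs r A"
  shows "(\<lambda>a. c * x a + d * y a) \<in> combs r A"
proof -
  have "{a. c * x a + d * y a \<noteq> 0} \<subseteq> {a. x a \<noteq> 0} \<union> {a. y a \<noteq> 0}"
    by auto
  with assms show ?thesis
    by (auto simp: combs_iff intro: finite_subset[OF _ finite_UnI])
qed

lemma basis_elem_combs: "a \<in> A \<Longrightarrow> basis_elem a \<in> combs r A"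
  by (auto simp: combs_def fin_combs_def all_combs_def basis_elem_def)

lemma linear_map_lin_extend:
  assumes "mat True \<phi>" "\<And>a b. a \<in> A \<Longrightarrow> \<phi> a b \<noteq> 0 \<Longrightarrow> b \<in> B"
    and T: "\<And>f. f \<in> fin_combs A \<Longrightarrow> T f = lin_extend \<phi> f"
  shows "linear_map (fin_combs A) (fin_combs B) T"
  unfolding linear_map_def
proof (intro conjI allI)
  show "T ` fin_combs A \<subseteq> fin_combs B"
    using lin_extend_combs[where r = True and A = A, OF _ assms(1,2)] T by (auto simp: combs_def)
  show "linear_functional (fin_combs A) (\<lambda>x. T x b)" for b
    using linear_functional_lin_extend[OF assms(1), where A = A and b = b] T combs_closed[where r = True]
    by (intro linear_functional_cong[of "fin_combs A" "\<lambda>x. T x b" "\<lambda>x. lin_extend \<phi> x b"])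
      (auto simp: combs_def)
qed

text \<open>Only the finite column \<open>b\<close> of \<phi> enters, so evaluation at an infinite
  combination reads finitely many coefficients.\<close>

lemma continuous_functional_lin_extend:
  assumes "mat False \<phi>" and T: "\<And>f. f \<in> all_combs A \<Longrightarrow> T f = lin_extend \<phi> f b"
  shows "continuous_functional A T"
  unfolding continuous_functional_def
proof (intro conjI ballI)
  show "linear_functional (all_combs A) T"
    using linear_functional_lin_extend[OF assms(1), where A = A and b = b] T combs_closed[where r = False]
    by (intro linear_functional_cong[of "all_combs A" T "\<lambda>x. lin_extend \<phi> x b"])
      (auto simp: combs_def)
  fix f assume f: "f \<in> all_combs A"
  have T_basis: "T (basis_elem a) = \<phi> a b" if "a \<in> A" for a
    using T[of "basis_elem a"] that basis_elem_combs[of a A False] by (simp add: combs_def)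
  have eq: "{a \<in> A. f a * T (basis_elem a) \<noteq> 0} = {a. f a * \<phi> a b \<noteq> 0}"
    using f T_basis by (auto simp: all_combs_def)
  show "finite {a \<in> A. f a * T (basis_elem a) \<noteq> 0}"
    unfolding eq by (rule finite_subset[OF _ matD(2)[OF assms(1), of b]]) auto
  show "T f = (\<Sum>a | a \<in> A \<and> f a * T (basis_elem a) \<noteq> 0. f a * T (basis_elem a))"
    unfolding eq T[OF f] lin_extend_def
    by (rule sum.cong) (use f T_basis in \<open>auto simp: all_combs_def\<close>)
qed

lemma continuous_map_lin_extend:
  assumes "mat False \<phi>" "\<And>a b. a \<in> A \<Longrightarrow> \<phi> a b \<noteq> 0 \<Longrightarrow> b \<in> B"
    and T: "\<And>f. f \<in> all_combs A \<Longrightarrow> T f = lin_extend \<phi> f"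
  shows "continuous_map A B T"
  unfolding continuous_map_def
proof (intro conjI allI)
  show "T ` all_combs A \<subseteq> all_combs B"
    using lin_extend_combs[where r = False and A = A, OF _ assms(1,2)] T by (auto simp: combs_def)
  show "continuous_functional A (\<lambda>f. T f b)" for b
    by (rule continuous_functional_lin_extend[OF assms(1), where b = b]) (simp add: T)
qed


section \<open>Bialgebras given by structure constants\<close>

text \<open>
  \<open>m a b x\<close> is the coefficient of \<open>x\<close> in the product of \<open>a\<close> and \<open>b\<close>, and \<open>d a b x\<close> the coefficient
  of \<open>a \<otimes> b\<close> in the coproduct of \<open>x\<close>.  With this convention the axioms are invariant under exchanging
  \<open>m\<close> and \<open>d\<close>, which is duality of bialgebras.
\<close>

locale structure_constants =
  fixes A :: "'a set" and e :: 'a and m d :: "'a \<Rightarrow> 'a \<Rightarrow> 'a \<Rightarrow> int"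
  assumes e_in: "e \<in> A"
    and m_supp: "m a b x \<noteq> 0 \<Longrightarrow> a \<in> A \<and> b \<in> A \<and> x \<in> A"
    and d_supp: "d a b x \<noteq> 0 \<Longrightarrow> a \<in> A \<and> b \<in> A \<and> x \<in> A"
    and m_assoc: "(\<Sum>y. m a b y * m y c x) = (\<Sum>y. m b c y * m a y x)"
    and d_assoc: "(\<Sum>y. d a b y * d y c x) = (\<Sum>y. d b c y * d a y x)"
    and m_unit: "a \<in> A \<Longrightarrow> m e a x = of_bool (x = a)" "a \<in> A \<Longrightarrow> m a e x = of_bool (x = a)"
    and d_unit: "a \<in> A \<Longrightarrow> d e a x = of_bool (x = a)" "a \<in> A \<Longrightarrow> d a e x = of_bool (x = a)"
    and compat: "(\<Sum>x. m a b x * d p q x) =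
      (\<Sum>((a1, a2), (b1, b2)). d a1 a2 a * d b1 b2 b * m a1 b1 p * m a2 b2 q)"
    and m_e: "m a b e = of_bool (a = e \<and> b = e)"
    and d_e: "d a b e = of_bool (a = e \<and> b = e)"

lemma bij_middle_swap: "bij (\<lambda>((a, b), (c, d)). ((a, c), (b, d)))"
  by (rule bij_betw_byWitness[where f' = "\<lambda>((a, b), (c, d)). ((a, c), (b, d))"]) auto

text \<open>Only \<open>compat\<close> is not visibly symmetric: exchanging \<open>m\<close> and
  \<open>d\<close> regroups the index ((a1, a2), (b1, b2)) as ((a1, b1), (a2, b2)), which is the
  middle swap.\<close>

lemma structure_constants_dual:
  assumes "structure_constants A e m d"
  shows "structure_constants A e d m"
proof -
  interpret structure_constants A e m d by fact
  show ?thesis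
  proof
    fix a b p q
    have "(\<Sum>((a1, a2), (b1, b2)). d a1 a2 p * d b1 b2 q * m a1 b1 a * m a2 b2 b) =
        (\<Sum>((a1, a2), (b1, b2)). m a1 a2 a * m b1 b2 b * d a1 b1 p * d a2 b2 q)"
      by (rule Sum_any.reindex_cong[OF bij_middle_swap]) (auto simp: fun_eq_iff)
    then show "(\<Sum>x. d a b x * m p q x) =
        (\<Sum>((a1, a2), (b1, b2)). m a1 a2 a * m b1 b2 b * d a1 b1 p * d a2 b2 q)"
      using compat[of p q a b] by (simp add: mult.commute)
  qed (fact e_in m_supp d_supp m_assoc d_assoc m_unit d_unit m_e d_e)+
qed

text \<open>The value 0 outside \<open>B\<close> is essential: index sums run over the whole type,
  while \<open>h\<close> is controlled only on \<open>B\<close>.\<close>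

definition pull_back :: "'b set \<Rightarrow> ('b \<Rightarrow> 'a) \<Rightarrow> ('a \<Rightarrow> 'a \<Rightarrow> 'a \<Rightarrow> int) \<Rightarrow> 'b \<Rightarrow> 'b \<Rightarrow> 'b \<Rightarrow> int" where
  "pull_back B h m a b x =
     (if a \<in> B \<and> b \<in> B \<and> x \<in> B then m (h a) (h b) (h x) else 0)"

lemma structure_constants_pull_back:
  assumes "structure_constants A e m d" and h: "bij_betw h B A" and e': "e' \<in> B" "h e' = e"
  shows "structure_constants B e' (pull_back B h m) (pull_back B h d)"
proof -
  interpret structure_constants A e m d by fact
  have inj: "a \<in> B \<Longrightarrow> b \<in> B \<Longrightarrow> h a = h b \<longleftrightarrow> a = b" for a b
    using h by (auto simp: bij_betw_def dest: inj_onD)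
  have in_A: "a \<in> B \<Longrightarrow> h a \<in> A" for a
    using h by (auto simp: bij_betw_def)
  \<comment> \<open>Sums over a single basis index are carried from \<open>A\<close> to
    \<open>B\<close> by this rule; the fourfold sum in \<open>compat\<close> needs its own
    reindexing.\<close>
  have sum: "(\<Sum>y. g y) = (\<Sum>y. f y)"
    if eq: "\<And>y. y \<in> B \<Longrightarrow> g y = f (h y)" and out: "\<And>y. y \<notin> B \<Longrightarrow> g y = 0"
      and supp: "\<And>y. f y \<noteq> 0 \<Longrightarrow> y \<in> A"
    for f :: "'a \<Rightarrow> int" and g :: "'b \<Rightarrow> int"
  proof (rule Sum_any_inj[symmetric, of h])
    have "{a. g a \<noteq> 0} \<subseteq> B" using out by blast
    then show "inj_on h {a. g a \<noteq> 0}"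
      using h by (auto simp: bij_betw_def intro: inj_on_subset)
    show "f (h a) = g a" if "g a \<noteq> 0" for a
      using that eq out by metis
    fix b assume "f b \<noteq> 0"
    then obtain a where "a \<in> B" "h a = b"
      using supp h unfolding bij_betw_def by blast
    with \<open>f b \<noteq> 0\<close> eq show "\<exists>a. g a \<noteq> 0 \<and> h a = b" by metis
  qed
  have assoc: "(\<Sum>y. pull_back B h k a b y * pull_back B h k y c x) =
      (\<Sum>y. pull_back B h k b c y * pull_back B h k a y x)"
    if supp: "\<And>a b x. k a b x \<noteq> 0 \<Longrightarrow> a \<in> A \<and> b \<in> A \<and> x \<in> A"
      and k: "\<And>a b c x. (\<Sum>y. k a b y * k y c x) = (\<Sum>y. k b c y * k a y x)"
    for k :: "'a \<Rightarrow> 'a \<Rightarrow> 'a \<Rightarrow> int" and a b c x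
  proof (cases "a \<in> B \<and> b \<in> B \<and> c \<in> B \<and> x \<in> B")
    case True
    have "(\<Sum>y. pull_back B h k a b y * pull_back B h k y c x) =
        (\<Sum>y. k (h a) (h b) y * k y (h c) (h x))"
      by (rule sum) (use True supp in \<open>auto simp: pull_back_def\<close>)
    moreover have "(\<Sum>y. pull_back B h k b c y * pull_back B h k a y x) =
        (\<Sum>y. k (h b) (h c) y * k (h a) y (h x))"
      by (rule sum) (use True supp in \<open>auto simp: pull_back_def\<close>)
    ultimately show ?thesis using k by simp
  qed (auto simp: pull_back_def)
  show ?thesis
  proof
    show "e' \<in> B" by fact
    show "pull_back B h m a b x \<noteq> 0 \<Longrightarrow> a \<in> B \<and> b \<in> B \<and> x \<in> B"
      "pull_back B h d a b x \<noteq> 0 \<Longrightarrow> a \<in> B \<and> b \<in> B \<and> x \<in> B" for a b x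
      by (auto simp: pull_back_def split: if_splits)
    show "(\<Sum>y. pull_back B h m a b y * pull_back B h m y c x) =
      (\<Sum>y. pull_back B h m b c y * pull_back B h m a y x)" for a b c x
      using m_supp m_assoc by (rule assoc)
    show "(\<Sum>y. pull_back B h d a b y * pull_back B h d y c x) =
      (\<Sum>y. pull_back B h d b c y * pull_back B h d a y x)" for a b c x
      using d_supp d_assoc by (rule assoc)
    show "pull_back B h m e' a x = of_bool (x = a)" "pull_back B h m a e' x = of_bool (x = a)"
      "pull_back B h d e' a x = of_bool (x = a)" "pull_back B h d a e' x = of_bool (x = a)"
      if "a \<in> B" for a x
      using that e' m_unit d_unit in_A inj by (auto simp: pull_back_def)
    show "pull_back B h m a b e' = of_bool (a = e' \<and> b = e')"
      "pull_back B h d a b e' = of_bool (a = e' \<and> b = e')" for a b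
      using e'(1) inj[of a e'] inj[of b e'] by (auto simp: pull_back_def e'(2) m_e d_e)
    show "(\<Sum>x. pull_back B h m a b x * pull_back B h d p q x) =
      (\<Sum>((a1, a2), (b1, b2)). pull_back B h d a1 a2 a * pull_back B h d b1 b2 b *
         pull_back B h m a1 b1 p * pull_back B h m a2 b2 q)" for a b p q
    proof (cases "a \<in> B \<and> b \<in> B \<and> p \<in> B \<and> q \<in> B")
      case True
      let ?H = "map_prod (map_prod h h) (map_prod h h)"
      let ?f = "\<lambda>((a1, a2), (b1, b2)).
        d a1 a2 (h a) * d b1 b2 (h b) * m a1 b1 (h p) * m a2 b2 (h q)"
      let ?g = "\<lambda>((a1, a2), (b1, b2)). pull_back B h d a1 a2 a * pull_back B h d b1 b2 b *
         pull_back B h m a1 b1 p * pull_back B h m a2 b2 q"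
      have "(\<Sum>x. pull_back B h m a b x * pull_back B h d p q x) =
          (\<Sum>x. m (h a) (h b) x * d (h p) (h q) x)"
        by (rule sum) (use True m_supp in \<open>auto simp: pull_back_def\<close>)
      also have "\<dots> = Sum_any ?f"
        by (rule compat)
      also have "Sum_any ?f = Sum_any ?g"
      proof (rule Sum_any_inj[of ?H])
        have "inj_on ?H ((B \<times> B) \<times> (B \<times> B))"
          using h unfolding bij_betw_def by (intro map_prod_inj_on) auto
        moreover have "{p. ?g p \<noteq> 0} \<subseteq> (B \<times> B) \<times> (B \<times> B)"
          by (auto simp: pull_back_def split: if_splits)
        ultimately show "inj_on ?H {p. ?g p \<noteq> 0}"
          by (rule inj_on_subset)
        show "?f (?H t) = ?g t" if "?g t \<noteq> 0" for t
          using that by (cases t) (auto simp: pull_back_def split: if_splits)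
        fix t assume t: "?f t \<noteq> 0"
        obtain a1 a2 b1 b2 where t_eq: "t = ((a1, a2), (b1, b2))"
          by (metis surj_pair)
        with t have "d a1 a2 (h a) \<noteq> 0" "d b1 b2 (h b) \<noteq> 0"
          by auto
        then have "a1 \<in> h ` B" "a2 \<in> h ` B" "b1 \<in> h ` B" "b2 \<in> h ` B"
          using d_supp h by (auto simp: bij_betw_def)
        then obtain a1' a2' b1' b2' where
          "a1' \<in> B" "h a1' = a1" "a2' \<in> B" "h a2' = a2" "b1' \<in> B" "h b1' = b1" "b2' \<in> B" "h b2' = b2"
          by auto
        then show "\<exists>s. ?g s \<noteq> 0 \<and> ?H s = t"
          using t True t_eq
          by (intro exI[of _ "((a1', a2'), (b1', b2'))"]) (auto simp: pull_back_def)
      qed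
      finally show ?thesis .
    next
      case False
      then have *: "(\<lambda>((a1, a2), (b1, b2)). pull_back B h d a1 a2 a * pull_back B h d b1 b2 b *
         pull_back B h m a1 b1 p * pull_back B h m a2 b2 q) = (\<lambda>_. 0)"
        "(\<lambda>x. pull_back B h m a b x * pull_back B h d p q x) = (\<lambda>_. 0)"
        by (auto simp: pull_back_def fun_eq_iff)
      show ?thesis unfolding * by simp
    qed
  qed
qed

abbreviation (input) prod_mat :: "('a \<Rightarrow> 'a \<Rightarrow> 'a \<Rightarrow> int) \<Rightarrow> 'a \<times> 'a \<Rightarrow> 'a \<Rightarrow> int" where
  "prod_mat m \<equiv> \<lambda>(a, b) x. m a b x"

abbreviation (input) coprod_mat :: "('a \<Rightarrow> 'a \<Rightarrow> 'a \<Rightarrow> int) \<Rightarrow> 'a \<Rightarrow> 'a \<times> 'a \<Rightarrow> int" where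
  "coprod_mat d \<equiv> \<lambda>x (p, q). d p q x"

definition massoc :: "('a \<times> 'b) \<times> 'c \<Rightarrow> 'a \<times> ('b \<times> 'c) \<Rightarrow> int" where
  "massoc = mperm (\<lambda>((a, b), c). (a, (b, c)))"

definition mswap :: "('a \<times> 'b) \<times> ('c \<times> 'd) \<Rightarrow> ('a \<times> 'c) \<times> ('b \<times> 'd) \<Rightarrow> int" where
  "mswap = mperm (\<lambda>((a, b), (c, d)). ((a, c), (b, d)))"

lemma mat_massoc: "mat r massoc"
  unfolding massoc_def by (rule mat_mperm) (auto simp: inj_def)

lemma mat_mswap: "mat r mswap"
  unfolding mswap_def by (rule mat_mperm) (auto simp: inj_def)

lemma mcomp_massoc: "(\<phi> \<Zsemi> massoc) x (a, (b, c)) = \<phi> x ((a, b), c)"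
  unfolding massoc_def
  using mcomp_mperm[of "\<lambda>((a, b), c). (a, (b, c))" \<phi> x "((a, b), c)"] by (auto simp: inj_def)

lemma massoc_mcomp: "(massoc \<Zsemi> \<phi>) ((a, b), c) = \<phi> (a, (b, c))"
  unfolding massoc_def by (simp add: mperm_mcomp)

lemma mswap_mcomp: "(mswap \<Zsemi> \<phi>) ((a, b), (c, d)) = \<phi> ((a, c), (b, d))"
  unfolding mswap_def by (simp add: mperm_mcomp)

lemma massoc_natural: "((f \<otimes> g) \<otimes> h) \<Zsemi> massoc = massoc \<Zsemi> (f \<otimes> (g \<otimes> h))"
  by (auto simp: fun_eq_iff mcomp_massoc massoc_mcomp mult.assoc)

text \<open>The identity factor pins one component of the inner pair, so a sum over pairs collapses
  to a single index. This and the next three lemmas translate between matrix identities and the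
  index form of the axioms.\<close>

lemma mtensor_ident_mcomp_left:
  "((\<phi> \<otimes> basis_elem) \<Zsemi> \<psi>) (a, c) x = (\<Sum>y. \<phi> a y * \<psi> (y, c) x)"
  unfolding mcomp_apply
  by (rule Sum_any_inj[where h = "\<lambda>y. (y, c)"]) (auto simp: inj_on_def basis_elem_def split: if_splits)

lemma mtensor_ident_mcomp_right:
  "((basis_elem \<otimes> \<phi>) \<Zsemi> \<psi>) (a, c) x = (\<Sum>y. \<phi> c y * \<psi> (a, y) x)"
  unfolding mcomp_apply
  by (rule Sum_any_inj[where h = "\<lambda>y. (a, y)"]) (auto simp: inj_on_def basis_elem_def split: if_splits)

lemma mcomp_mtensor_ident_left:
  "(\<psi> \<Zsemi> (\<phi> \<otimes> basis_elem)) x (a, c) = (\<Sum>y. \<phi> y a * \<psi> x (y, c))"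
  unfolding mcomp_apply
  by (rule Sum_any_inj[where h = "\<lambda>y. (y, c)"]) (auto simp: inj_on_def basis_elem_def split: if_splits)

lemma mcomp_mtensor_ident_right:
  "(\<psi> \<Zsemi> (basis_elem \<otimes> \<phi>)) x (a, c) = (\<Sum>y. \<phi> y c * \<psi> x (a, y))"
  unfolding mcomp_apply
  by (rule Sum_any_inj[where h = "\<lambda>y. (a, y)"]) (auto simp: inj_on_def basis_elem_def split: if_splits)

lemma lin_extend_mswap: "lin_extend mswap F = middle_swap F"
proof (intro ext, clarify)
  fix a b c d
  have "lin_extend mswap F = ((\<lambda>_ :: unit. F) \<Zsemi> mswap) ()"
    by (rule lin_extend_row)
  then show "lin_extend mswap F ((a, b), (c, d)) = middle_swap F ((a, b), (c, d))"
    unfolding mswap_def middle_swap_def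
    using mcomp_mperm[of "\<lambda>((a, b), (c, d)). ((a, c), (b, d))" "\<lambda>_ :: unit. F" "()" "((a, c), (b, d))"]
    by (auto simp: inj_def)
qed

locale bialgebra_mats = structure_constants +
  fixes r :: bool
  assumes mat_m: "mat r (prod_mat m)" and mat_d: "mat r (coprod_mat d)"
begin

abbreviation "M \<equiv> prod_mat m"
abbreviation "D \<equiv> coprod_mat d"

lemma M_assoc: "(M \<otimes> basis_elem) \<Zsemi> M = massoc \<Zsemi> (basis_elem \<otimes> M) \<Zsemi> M"
  by (auto simp: fun_eq_iff massoc_mcomp mtensor_ident_mcomp_left mtensor_ident_mcomp_right m_assoc)

lemma D_assoc: "(D \<Zsemi> (D \<otimes> basis_elem)) x ((a, b), c) = (D \<Zsemi> (basis_elem \<otimes> D)) x (a, (b, c))"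
  by (simp add: mcomp_mtensor_ident_left mcomp_mtensor_ident_right d_assoc)

lemma mats:
  "mat r (M \<otimes> M)" "mat r (D \<otimes> D)" "mat r (M \<otimes> basis_elem)" "mat r (basis_elem \<otimes> M)"
  "mat r (D \<otimes> basis_elem)" "mat r (basis_elem \<otimes> D)"
  by (intro mat_mtensor mat_m mat_d mat_basis_elem)+

lemma MD_compat: "M \<Zsemi> D = (D \<otimes> D) \<Zsemi> mswap \<Zsemi> (M \<otimes> M)"
proof (intro ext, clarify)
  fix a b p q
  have "(M \<Zsemi> D) (a, b) (p, q) =
      (\<Sum>((a1, a2), (b1, b2)). d a1 a2 a * d b1 b2 b * m a1 b1 p * m a2 b2 q)"
    using compat[of a b p q] by (simp add: mcomp_apply)
  also have "\<dots> = (\<Sum>t. (D \<otimes> D) (a, b) t * (mswap \<Zsemi> (M \<otimes> M)) t (p, q))"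
    by (rule Sum_any.cong) (auto simp: mswap_mcomp mult.assoc split: prod.splits)
  finally show "(M \<Zsemi> D) (a, b) (p, q) = ((D \<otimes> D) \<Zsemi> mswap \<Zsemi> (M \<otimes> M)) (a, b) (p, q)"
    by (simp add: mcomp_apply)
qed

lemma lin_extend_M_combs: "F \<in> combs r (A \<times> A) \<Longrightarrow> lin_extend M F \<in> combs r A"
  by (erule lin_extend_combs[OF _ mat_m]) (auto dest: m_supp)

lemma lin_extend_D_combs: "f \<in> combs r A \<Longrightarrow> lin_extend D f \<in> combs r (A \<times> A)"
  by (erule lin_extend_combs[OF _ mat_d]) (auto dest: d_supp)

lemma lin_extend_ident_on: "f \<in> combs r A \<Longrightarrow> lin_extend basis_elem f = f"
  by (erule lin_extend_ident) (rule refl)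

text \<open>Agreement with the matrices is demanded only on combinations of basis elements: the
  concrete operations are total functions whose values off the basis need not be those of the
  structure constants.\<close>

theorem bialgebra_laws:
  fixes H :: "'a bialg"
  assumes mult: "\<And>F. F \<in> combs r (A \<times> A) \<Longrightarrow> mult H F = lin_extend M F"
    and comult: "\<And>f. f \<in> combs r A \<Longrightarrow> comult H f = lin_extend D f"
    and unit: "unit_map H = (\<lambda>n a. n * basis_elem e a)"
    and counit: "counit H = (\<lambda>f. f e)"
  shows "bialgebra_laws (combs r A) H"
proof -
  have unit1: "unit_map H 1 = basis_elem e"
    by (simp add: unit)
  note e_combs = basis_elem_combs[OF e_in, of r]
  have t_mult: "mult H (tensor x y) = lin_extend M (tensor x y)"
    "mult H (tensor x y) \<in> combs r A" if "x \<in> combs r A" "y \<in> combs r A" for x y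
    using that by (simp_all add: mult tensor_combs lin_extend_M_combs)
  have assoc: "mult H (tensor (mult H (tensor x y)) z) = mult H (tensor x (mult H (tensor y z)))"
    if xyz: "x \<in> combs r A" "y \<in> combs r A" "z \<in> combs r A" for x y z
  proof -
    note xy = tensor_combs[OF xyz(1,2)] and yz = tensor_combs[OF xyz(2,3)]
    note xy_z = tensor_combs[OF xy xyz(3)] and x_yz = tensor_combs[OF xyz(1) yz]
    have "mult H (tensor (mult H (tensor x y)) z) = lin_extend M (tensor (lin_extend M (tensor x y)) z)"
      using xyz by (simp add: t_mult lin_extend_M_combs tensor_combs)
    also have "tensor (lin_extend M (tensor x y)) z =
        lin_extend (M \<otimes> basis_elem) (tensor (tensor x y) z)"
      using tensor_lin_extend[OF xy xyz(3) mat_m mat_basis_elem] xyz by (simp add: lin_extend_ident_on)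
    also have "lin_extend M \<dots> =
        lin_extend (massoc \<Zsemi> (basis_elem \<otimes> M) \<Zsemi> M) (tensor (tensor x y) z)"
      by (simp only: lin_extend_lin_extend[OF xy_z mats(3) mat_m] M_assoc)
    also have "\<dots> = lin_extend ((basis_elem \<otimes> M) \<Zsemi> M) (lin_extend massoc (tensor (tensor x y) z))"
      by (simp only: lin_extend_lin_extend[OF xy_z mat_massoc mat_mcomp[OF mats(4) mat_m]])
    also have "lin_extend massoc (tensor (tensor x y) z) = tensor x (tensor y z)"
      by (auto simp: fun_eq_iff lin_extend_row mcomp_massoc tensor_def mult.assoc)
    also have "lin_extend ((basis_elem \<otimes> M) \<Zsemi> M) (tensor x (tensor y z)) =
        lin_extend M (lin_extend (basis_elem \<otimes> M) (tensor x (tensor y z)))"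
      by (simp only: lin_extend_lin_extend[OF x_yz mats(4) mat_m])
    also have "lin_extend (basis_elem \<otimes> M) (tensor x (tensor y z)) =
        tensor x (lin_extend M (tensor y z))"
      using tensor_lin_extend[OF xyz(1) yz mat_basis_elem mat_m] xyz by (simp add: lin_extend_ident_on)
    finally show ?thesis
      using xyz by (simp add: t_mult lin_extend_M_combs tensor_combs)
  qed
  have unit_law: "mult H (tensor (unit_map H 1) x) = x" "mult H (tensor x (unit_map H 1)) = x"
    if x: "x \<in> combs r A" for x
  proof -
    have x_supp: "x a \<noteq> 0 \<Longrightarrow> a \<in> A" for a
      using x by (auto simp: combs_iff)
    have "(\<Sum>p. tensor (basis_elem e) x p * M p b) = (\<Sum>a. x a * basis_elem a b)" for b
      by (rule Sum_any_inj[where h = "Pair e"])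
        (auto simp: inj_on_def tensor_def basis_elem_def m_unit x_supp split: if_splits)
    moreover have "(\<Sum>p. tensor x (basis_elem e) p * M p b) = (\<Sum>a. x a * basis_elem a b)" for b
      by (rule Sum_any_inj[where h = "\<lambda>a. (a, e)"])
        (auto simp: inj_on_def tensor_def basis_elem_def m_unit x_supp split: if_splits)
    ultimately have "lin_extend M (tensor (basis_elem e) x) = lin_extend basis_elem x"
      "lin_extend M (tensor x (basis_elem e)) = lin_extend basis_elem x"
      by (simp_all add: lin_extend_Sum_any fun_eq_iff)
    then show "mult H (tensor (unit_map H 1) x) = x" "mult H (tensor x (unit_map H 1)) = x"
      using x e_combs by (simp_all add: unit1 t_mult lin_extend_ident_on)
  qed
  have coassoc: "map_left (comult H) (comult H x) ((a, b), c) =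
      map_right (comult H) (comult H x) (a, (b, c))" if x: "x \<in> combs r A" for x a b c
  proof -
    note Dx = lin_extend_D_combs[OF x]
    have "map_left (comult H) (comult H x) = lin_extend (D \<Zsemi> (D \<otimes> basis_elem)) x"
      using map_left_lin_extend[OF Dx comult] x
      by (simp add: comult lin_extend_lin_extend[OF x mat_d mats(5)])
    moreover have "map_right (comult H) (comult H x) = lin_extend (D \<Zsemi> (basis_elem \<otimes> D)) x"
      using map_right_lin_extend[OF Dx comult] x
      by (simp add: comult lin_extend_lin_extend[OF x mat_d mats(6)])
    ultimately show ?thesis
      by (simp add: lin_extend_Sum_any D_assoc)
  qed
  have counit_law: "(\<lambda>b. counit H (\<lambda>a. comult H x (a, b))) = x"
    "(\<lambda>a. counit H (\<lambda>b. comult H x (a, b))) = x" if x: "x \<in> combs r A" for x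
  proof -
    have x_supp: "x a \<noteq> 0 \<Longrightarrow> a \<in> A" for a
      using x by (auto simp: combs_iff)
    have left: "x a * d e b a = x a * basis_elem a b" for a b
      using d_supp[of e b a] d_unit(1)[of b a] x_supp[of a]
      by (cases "b \<in> A") (auto simp: basis_elem_def)
    have right: "x a * d b e a = x a * basis_elem a b" for a b
      using d_supp[of b e a] d_unit(2)[of b a] x_supp[of a]
      by (cases "b \<in> A") (auto simp: basis_elem_def)
    have "(\<lambda>b. lin_extend D x (e, b)) = lin_extend basis_elem x"
      "(\<lambda>b. lin_extend D x (b, e)) = lin_extend basis_elem x"
      by (simp_all only: fun_eq_iff lin_extend_Sum_any prod.case left right simp_thms)
    then show "(\<lambda>b. counit H (\<lambda>a. comult H x (a, b))) = x"
      "(\<lambda>a. counit H (\<lambda>b. comult H x (a, b))) = x"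
      using x by (simp_all add: counit comult lin_extend_ident_on)
  qed
  have compat': "comult H (mult H (tensor x y)) =
      map_left (mult H) (map_right (mult H) (middle_swap (tensor (comult H x) (comult H y))))"
    if x: "x \<in> combs r A" and y: "y \<in> combs r A" for x y
  proof -
    note xy = tensor_combs[OF x y]
    let ?F = "lin_extend (D \<otimes> D) (tensor x y)"
    have F: "?F = tensor (lin_extend D x) (lin_extend D y)"
      using tensor_lin_extend[OF x y mat_d mat_d] by simp
    have F_combs: "?F \<in> combs r ((A \<times> A) \<times> (A \<times> A))"
      unfolding F using x y by (intro tensor_combs lin_extend_D_combs)
    have sF: "lin_extend mswap ?F \<in> combs r ((A \<times> A) \<times> (A \<times> A))"
      by (rule lin_extend_combs[OF F_combs mat_mswap])
        (auto simp: mswap_def mperm_def basis_elem_def split: if_splits)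
    have rF: "lin_extend (basis_elem \<otimes> M) (lin_extend mswap ?F) \<in> combs r ((A \<times> A) \<times> A)"
      by (rule lin_extend_combs[OF sF mats(4)])
        (auto simp: basis_elem_def dest: m_supp split: if_splits)
    have "map_left (mult H) (map_right (mult H) (middle_swap (tensor (comult H x) (comult H y))))
        = map_left (mult H) (map_right (mult H) (lin_extend mswap ?F))"
      using x y by (simp add: comult F lin_extend_mswap)
    also have "\<dots> = map_left (mult H) (lin_extend (basis_elem \<otimes> M) (lin_extend mswap ?F))"
      by (simp only: map_right_lin_extend[OF sF mult])
    also have "\<dots> = lin_extend (M \<otimes> basis_elem) (lin_extend (basis_elem \<otimes> M) (lin_extend mswap ?F))"
      by (simp only: map_left_lin_extend[OF rF mult])
    also have "\<dots> = lin_extend ((basis_elem \<otimes> M) \<Zsemi> (M \<otimes> basis_elem)) (lin_extend mswap ?F)"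
      by (rule lin_extend_lin_extend[OF sF mats(4,3)])
    also have "(basis_elem \<otimes> M) \<Zsemi> (M \<otimes> basis_elem) = M \<otimes> M"
      by (simp add: mtensor_mcomp[symmetric, OF mat_basis_elem mat_m mat_m mat_basis_elem])
    also have "lin_extend (M \<otimes> M) (lin_extend mswap ?F) =
        lin_extend ((D \<otimes> D) \<Zsemi> mswap \<Zsemi> (M \<otimes> M)) (tensor x y)"
      by (simp only: lin_extend_lin_extend[OF F_combs mat_mswap mats(1)]
          lin_extend_lin_extend[OF xy mats(2) mat_mcomp[OF mat_mswap mats(1)]])
    also have "\<dots> = lin_extend D (lin_extend M (tensor x y))"
      by (simp only: MD_compat lin_extend_lin_extend[OF xy mat_m mat_d])
    also have "\<dots> = comult H (mult H (tensor x y))"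
      using x y t_mult[OF x y] by (simp add: comult)
    finally show ?thesis ..
  qed
  have comult_unit: "comult H (unit_map H 1) = tensor (unit_map H 1) (unit_map H 1)"
    unfolding unit1 comult[OF e_combs] lin_extend_basis_elem
    by (auto simp: fun_eq_iff d_e tensor_def basis_elem_def)
  have counit_mult: "counit H (mult H (tensor x y)) = counit H x * counit H y"
    if x: "x \<in> combs r A" and y: "y \<in> combs r A" for x y
  proof -
    have "(\<Sum>p. tensor x y p * M p e) = (\<Sum>p. if p = (e, e) then tensor x y p else 0)"
      by (rule Sum_any.cong) (auto simp: m_e)
    also have "\<dots> = x e * y e"
      by (simp only: Sum_any.delta) (simp add: tensor_def)
    finally show ?thesis
      using x y by (simp add: t_mult counit lin_extend_Sum_any)
  qed
  have unit_in: "unit_map H n \<in> combs r A" for n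
    using combs_closed[OF e_combs e_combs, of n 0] by (simp add: unit)
  show ?thesis
    unfolding bialgebra_laws_def
    using assoc unit_law coassoc counit_law compat' comult_unit counit_mult unit_in
    by (auto simp: unit counit basis_elem_def)
qed

end


section \<open>Antipodes\<close>

context bialgebra_mats
begin

definition conv :: "('a \<Rightarrow> 'a \<Rightarrow> int) \<Rightarrow> ('a \<Rightarrow> 'a \<Rightarrow> int) \<Rightarrow> 'a \<Rightarrow> 'a \<Rightarrow> int" where
  "conv f g = D \<Zsemi> (f \<otimes> g) \<Zsemi> M"

definition conv_unit :: "'a \<Rightarrow> 'a \<Rightarrow> int" where
  "conv_unit x z = of_bool (x = e \<and> z = e)"

text \<open>With support in \<open>A \<times> A\<close> a matrix is determined by its action on
  combinations of \<open>A\<close>, so laws for maps can be turned into equations of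
  matrices.\<close>

definition endo :: "('a \<Rightarrow> 'a \<Rightarrow> int) \<Rightarrow> bool" where
  "endo f \<longleftrightarrow> mat r f \<and> (\<forall>a b. f a b \<noteq> 0 \<longrightarrow> a \<in> A \<and> b \<in> A)"

text \<open>\<open>basis_elem\<close> is the identity on the whole type and is not supported in
  \<open>A\<close>; this is its restriction that satisfies \<open>endo\<close>.\<close>

definition ident_on :: "'a \<Rightarrow> 'a \<Rightarrow> int" where
  "ident_on a b = of_bool (a \<in> A \<and> b = a)"

lemma endo_ident_on: "endo ident_on"
  using mat_basis_elem[of r]
  by (auto simp: endo_def mat_def ident_on_def basis_elem_def intro: finite_subset)

lemma endo_conv_unit: "endo conv_unit"
  using finite_subset[of "{b. a = e \<and> b = e}" "{e}" for a]
    finite_subset[of "{a. a = e \<and> b = e}" "{e}" for b]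
  by (auto simp: endo_def mat_def conv_unit_def e_in)

lemma endoD: "endo f \<Longrightarrow> mat r f" "endo f \<Longrightarrow> f a b \<noteq> 0 \<Longrightarrow> a \<in> A \<and> b \<in> A"
  by (auto simp: endo_def)

lemma endo_diff:
  assumes "endo f" "endo g"
  shows "endo (\<lambda>a b. f a b - g a b)"
proof -
  have "{b. f a b - g a b \<noteq> 0} \<subseteq> {b. f a b \<noteq> 0} \<union> {b. g a b \<noteq> 0}"
    "{b. f b a - g b a \<noteq> 0} \<subseteq> {b. f b a \<noteq> 0} \<union> {b. g b a \<noteq> 0}" for a
    by auto
  then have "mat r (\<lambda>a b. f a b - g a b)"
    using assms[THEN endoD(1)]
    by (cases r) (simp_all only: mat_def if_True if_False, (meson finite_UnI finite_subset)+)
  moreover have "f a b \<noteq> 0 \<or> g a b \<noteq> 0" if "f a b - g a b \<noteq> 0" for a b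
    using that by auto
  ultimately show ?thesis
    using endoD(2)[OF assms(1)] endoD(2)[OF assms(2)] unfolding endo_def by metis
qed

lemma mat_conv: "mat r f \<Longrightarrow> mat r g \<Longrightarrow> mat r (conv f g)"
  unfolding conv_def by (intro mat_mcomp mat_d mat_m mat_mtensor)

lemma endo_conv:
  assumes "endo f" "endo g"
  shows "endo (conv f g)"
  unfolding endo_def
proof (intro conjI allI impI)
  show "mat r (conv f g)"
    using assms by (simp add: mat_conv endoD)
  fix a b assume "conv f g a b \<noteq> 0"
  then have "\<exists>p q. D a p \<noteq> 0 \<and> M q b \<noteq> 0"
    unfolding conv_def by (auto elim!: mcomp_nonzeroE)
  then show "a \<in> A" "b \<in> A"
    using m_supp d_supp by auto
qed

lemma conv_Sum_any:
  assumes "mat r f" "mat r g"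
  shows "conv f g x z = (\<Sum>((a, b), (p, q)). d a b x * (f a p * g b q) * m p q z)"
  unfolding conv_def mcomp_Sum_any[OF mat_d mat_mtensor[OF assms] mat_m]
  by (rule Sum_any.cong) (auto split: prod.splits)

lemma conv_assoc:
  assumes "mat r f" "mat r g" "mat r h"
  shows "conv (conv f g) h = conv f (conv g h)"
proof -
  note mats' = mats mat_d mat_m mat_basis_elem mat_massoc assms
  \<comment> \<open>Padding \<open>h\<close> with identities on both sides lets the interchange law
    cut the tensor product into three layers: coproduct, maps, product. Coassociativity and
    associativity then act on the outer layers, and \<open>massoc\<close> passes through the middle
    one.\<close>
  have "conv (conv f g) h = D \<Zsemi> ((D \<Zsemi> (f \<otimes> g) \<Zsemi> M) \<otimes> (basis_elem \<Zsemi> h \<Zsemi> basis_elem)) \<Zsemi> M"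
    by (simp add: conv_def)
  also have "(D \<Zsemi> (f \<otimes> g) \<Zsemi> M) \<otimes> (basis_elem \<Zsemi> h \<Zsemi> basis_elem) =
      (D \<otimes> basis_elem) \<Zsemi> ((f \<otimes> g) \<otimes> h) \<Zsemi> (M \<otimes> basis_elem)"
    by (simp only: mtensor_mcomp[of r] mats' mat_mcomp mat_mtensor)
  also have "D \<Zsemi> ((D \<otimes> basis_elem) \<Zsemi> ((f \<otimes> g) \<otimes> h) \<Zsemi> (M \<otimes> basis_elem)) \<Zsemi> M =
      (D \<Zsemi> (D \<otimes> basis_elem)) \<Zsemi> ((f \<otimes> g) \<otimes> h) \<Zsemi> (M \<otimes> basis_elem) \<Zsemi> M"
    by (simp only: mcomp_assoc[of r] mats' mat_mcomp mat_mtensor)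
  also have "((f \<otimes> g) \<otimes> h) \<Zsemi> (M \<otimes> basis_elem) \<Zsemi> M =
      (((f \<otimes> g) \<otimes> h) \<Zsemi> massoc) \<Zsemi> (basis_elem \<otimes> M) \<Zsemi> M"
    by (simp only: M_assoc mcomp_assoc[of r] mats' mat_mcomp mat_mtensor)
  also have "\<dots> = massoc \<Zsemi> (f \<otimes> (g \<otimes> h)) \<Zsemi> (basis_elem \<otimes> M) \<Zsemi> M"
    by (simp only: massoc_natural mcomp_assoc[of r] mats' mat_mcomp mat_mtensor)
  also have "(D \<Zsemi> (D \<otimes> basis_elem)) \<Zsemi> \<dots> =
      ((D \<Zsemi> (D \<otimes> basis_elem)) \<Zsemi> massoc) \<Zsemi> (f \<otimes> (g \<otimes> h)) \<Zsemi> (basis_elem \<otimes> M) \<Zsemi> M"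
    by (simp only: mcomp_assoc[of r] mats' mat_mcomp mat_mtensor)
  also have "(D \<Zsemi> (D \<otimes> basis_elem)) \<Zsemi> massoc = D \<Zsemi> (basis_elem \<otimes> D)"
    by (auto simp: fun_eq_iff mcomp_massoc D_assoc)
  also have "(D \<Zsemi> (basis_elem \<otimes> D)) \<Zsemi> (f \<otimes> (g \<otimes> h)) \<Zsemi> (basis_elem \<otimes> M) \<Zsemi> M =
      D \<Zsemi> ((basis_elem \<otimes> D) \<Zsemi> (f \<otimes> (g \<otimes> h)) \<Zsemi> (basis_elem \<otimes> M)) \<Zsemi> M"
    by (simp only: mcomp_assoc[of r] mats' mat_mcomp mat_mtensor)
  also have "(basis_elem \<otimes> D) \<Zsemi> (f \<otimes> (g \<otimes> h)) \<Zsemi> (basis_elem \<otimes> M) =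
      (basis_elem \<Zsemi> f \<Zsemi> basis_elem) \<otimes> (D \<Zsemi> (g \<otimes> h) \<Zsemi> M)"
    by (simp only: mtensor_mcomp[of r] mats' mat_mcomp mat_mtensor)
  also have "D \<Zsemi> \<dots> \<Zsemi> M = conv f (conv g h)"
    by (simp add: conv_def)
  finally show ?thesis .
qed

lemma finite_conv:
  assumes "mat r f" "mat r g"
  shows "finite {t. (\<lambda>((a, b), (p, q)). d a b x * (f a p * g b q) * m p q z) t \<noteq> 0}"
  using finite_mid2[OF mat_d mat_mtensor[OF assms] mat_m]
  by (rule rev_finite_subset) (auto split: prod.splits)

text \<open>One identity between entries covers linearity in either argument. In the proof the
  subtracted term is moved to the other side, so that only addition of finite sums occurs.\<close>

lemma conv_diff:
  assumes "mat r f" "mat r g" "mat r f1" "mat r g1" "mat r f2" "mat r g2"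
    and eq: "\<And>a b p q. f a p * g b q = f1 a p * g1 b q - f2 a p * g2 b q"
  shows "conv f g = (\<lambda>x z. conv f1 g1 x z - conv f2 g2 x z)"
proof (intro ext)
  fix x z
  have "conv f g x z + conv f2 g2 x z = conv f1 g1 x z"
    unfolding conv_Sum_any[OF assms(1,2)] conv_Sum_any[OF assms(3,4)] conv_Sum_any[OF assms(5,6)]
    unfolding Sum_any.distrib[OF finite_conv[OF assms(1,2)] finite_conv[OF assms(5,6)], symmetric]
    by (rule Sum_any.cong) (auto simp: eq algebra_simps split: prod.splits)
  then show "conv f g x z = conv f1 g1 x z - conv f2 g2 x z"
    by simp
qed

lemma conv_diff_left:
  assumes "mat r f" "mat r f'" "mat r g" "mat r (\<lambda>a b. f a b - f' a b)"
  shows "conv (\<lambda>a b. f a b - f' a b) g = (\<lambda>x z. conv f g x z - conv f' g x z)"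
  by (rule conv_diff) (use assms in \<open>auto simp: algebra_simps\<close>)

lemma conv_diff_right:
  assumes "mat r f" "mat r g" "mat r g'" "mat r (\<lambda>a b. g a b - g' a b)"
  shows "conv f (\<lambda>a b. g a b - g' a b) = (\<lambda>x z. conv f g x z - conv f g' x z)"
  by (rule conv_diff) (use assms in \<open>auto simp: algebra_simps\<close>)

text \<open>The unit forces b = q = e, and then the unit axioms for \<open>d\<close> and
  \<open>m\<close> leave a single index. These axioms apply because nonzero entries of
  \<open>f\<close> lie over \<open>A\<close>.\<close>

lemma conv_unit_right:
  assumes "endo f"
  shows "conv f conv_unit = f"
proof (intro ext)
  fix x z
  have "conv f conv_unit x z = (\<Sum>t. if t = ((x, e), (z, e)) then f x z else 0)"
    unfolding conv_Sum_any[OF endoD(1)[OF assms] endoD(1)[OF endo_conv_unit]]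
  proof (rule Sum_any.cong)
    fix t :: "('a \<times> 'a) \<times> ('a \<times> 'a)"
    obtain a b p q where "t = ((a, b), (p, q))" by (metis surj_pair)
    then show "(\<lambda>((a, b), (p, q)). d a b x * (f a p * conv_unit b q) * m p q z) t = (if t = ((x, e), (z, e)) then f x z else 0)"
      using endoD(2)[OF assms, of a p] d_unit(2)[of a x] m_unit(2)[of p z]
      by (cases "f a p = 0") (auto simp: conv_unit_def)
  qed
  then show "conv f conv_unit x z = f x z"
    by (simp only: Sum_any.delta)
qed

lemma conv_unit_left:
  assumes "endo f"
  shows "conv conv_unit f = f"
proof (intro ext)
  fix x z
  have "conv conv_unit f x z = (\<Sum>t. if t = ((e, x), (e, z)) then f x z else 0)"
    unfolding conv_Sum_any[OF endoD(1)[OF endo_conv_unit] endoD(1)[OF assms]]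
  proof (rule Sum_any.cong)
    fix t :: "('a \<times> 'a) \<times> ('a \<times> 'a)"
    obtain a b p q where "t = ((b, a), (q, p))" by (metis surj_pair)
    then show "(\<lambda>((a, b), (p, q)). d a b x * (conv_unit a p * f b q) * m p q z) t = (if t = ((e, x), (e, z)) then f x z else 0)"
      using endoD(2)[OF assms, of a p] d_unit(1)[of a x] m_unit(1)[of p z]
      by (cases "f a p = 0") (auto simp: conv_unit_def)
  qed
  then show "conv conv_unit f x z = f x z"
    by (simp only: Sum_any.delta)
qed

text \<open>Row \<open>x\<close> of a convolution sees only the pairs in the coproduct of
  \<open>x\<close>. The first alternative is meant for b = e and \<open>g = aug\<close>: there
  \<open>aug\<close> vanishes, so \<open>f\<close> and \<open>f'\<close> may differ at
  \<open>a\<close>.\<close>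

lemma conv_cong:
  assumes "\<And>a b. d a b x \<noteq> 0 \<Longrightarrow>
      g b = (\<lambda>_. 0) \<and> g' b = (\<lambda>_. 0) \<or> f a = f' a \<and> g b = g' b"
  shows "conv f g x = conv f' g' x"
proof (intro ext)
  fix z
  have "D x t * ((f \<otimes> g) \<Zsemi> M) t z = D x t * ((f' \<otimes> g') \<Zsemi> M) t z" for t
  proof (cases t)
    case (Pair a b)
    show ?thesis
    proof (cases "d a b x = 0")
      case False
      then have "(f \<otimes> g) (a, b) = (f' \<otimes> g') (a, b)"
        using assms[of a b] by (auto simp: fun_eq_iff)
      then show ?thesis by (simp add: Pair mcomp_def)
    qed (simp add: Pair)
  qed
  then show "conv f g x z = conv f' g' x z"
    unfolding conv_def mcomp_apply[of D] by (rule Sum_any.cong)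
qed

text \<open>Used in both directions: to extract matrix equations from a given antipode, and to
  obtain an antipode from a solution of these equations.\<close>

lemma antipode_laws_iff:
  fixes H :: "'a bialg"
  assumes mult: "\<And>F. F \<in> combs r (A \<times> A) \<Longrightarrow> mult H F = lin_extend M F"
    and comult: "\<And>f. f \<in> combs r A \<Longrightarrow> comult H f = lin_extend D f"
    and unit: "unit_map H = (\<lambda>n a. n * basis_elem e a)"
    and counit: "counit H = (\<lambda>f. f e)"
    and s: "endo s" and S: "\<And>f. f \<in> combs r A \<Longrightarrow> S f = lin_extend s f"
  shows "antipode_laws (combs r A) H S \<longleftrightarrow>
    conv s ident_on = conv_unit \<and> conv ident_on s = conv_unit"
proof -
  have s_mat: "mat r s" and s_supp: "s a b \<noteq> 0 \<Longrightarrow> b \<in> A" for a b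
    using endoD[OF s] by auto
  note mats' = mat_mtensor[OF s_mat mat_basis_elem] mat_mtensor[OF mat_basis_elem s_mat]
  \<comment> \<open>The coproduct yields indices in \<open>A\<close> only, so the identity of the
    whole type may be cut down to \<open>A\<close>.\<close>
  have conv_id: "conv s basis_elem = conv s ident_on" "conv basis_elem s = conv ident_on s"
    by (auto simp: fun_eq_iff ident_on_def basis_elem_def dest!: d_supp intro!: conv_cong[THEN fun_cong])
  have "mult H (map_left S (comult H x)) = lin_extend (conv s ident_on) x \<and>
      mult H (map_right S (comult H x)) = lin_extend (conv ident_on s) x"
    if x: "x \<in> combs r A" for x
  proof -
    note Dx = lin_extend_D_combs[OF x]
    have "lin_extend (s \<otimes> basis_elem) (lin_extend D x) \<in> combs r (A \<times> A)"
      "lin_extend (basis_elem \<otimes> s) (lin_extend D x) \<in> combs r (A \<times> A)"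
      by (rule lin_extend_combs[OF Dx]; auto simp: mats' basis_elem_def s_supp split: if_splits)+
    then show ?thesis
      using x by (simp add: comult map_left_lin_extend[OF Dx S] map_right_lin_extend[OF Dx S] mult
          lin_extend_lin_extend[OF Dx mats'(1) mat_m] lin_extend_lin_extend[OF Dx mats'(2) mat_m]
          lin_extend_lin_extend[OF x mat_d mat_mcomp[OF mats'(1) mat_m]]
          lin_extend_lin_extend[OF x mat_d mat_mcomp[OF mats'(2) mat_m]]
          conv_id[symmetric]) (simp add: conv_def)
  qed
  moreover have "unit_map H (counit H x) = lin_extend conv_unit x" for x
  proof
    fix z
    have "lin_extend conv_unit x z = (\<Sum>a. if a = e then x e * basis_elem e z else 0)"
      unfolding lin_extend_Sum_any
      by (rule Sum_any.cong) (auto simp: conv_unit_def basis_elem_def)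
    then show "unit_map H (counit H x) z = lin_extend conv_unit x z"
      by (simp only: Sum_any.delta unit counit)
  qed
  ultimately have "antipode_laws (combs r A) H S \<longleftrightarrow> (\<forall>x\<in>combs r A.
      lin_extend (conv s ident_on) x = lin_extend conv_unit x \<and>
      lin_extend (conv ident_on s) x = lin_extend conv_unit x)"
    by (auto simp: antipode_laws_def)
  also have "\<dots> \<longleftrightarrow> conv s ident_on = conv_unit \<and> conv ident_on s = conv_unit"
  proof -
    \<comment> \<open>Evaluation at basis elements compares the rows over \<open>A\<close>; the
      other rows of both matrices are zero.\<close>
    have "f = g" if "\<forall>x\<in>combs r A. lin_extend f x = lin_extend g x" "endo f" "endo g" for f g
    proof (intro ext)
      fix a b
      show "f a b = g a b"
      proof (cases "a \<in> A")
        case True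
        then show ?thesis
          using that(1) basis_elem_combs[of a A r] by fastforce
      next
        case False
        then show ?thesis using endoD(2)[OF that(2), of a b] endoD(2)[OF that(3), of a b] by metis
      qed
    qed
    then show ?thesis
      using endo_conv s endo_ident_on endo_conv_unit by (metis (no_types, lifting))
  qed
  finally show ?thesis .
qed

text \<open>
  The inverse of the identity under convolution is the geometric series in \<open>\<eta>\<epsilon> - id\<close>, whose partial
  sums \<open>antipode_approx n\<close> are stationary on every basis element when the coproduct is graded.
\<close>

definition aug :: "'a \<Rightarrow> 'a \<Rightarrow> int" where
  "aug a b = ident_on a b - conv_unit a b"

primrec antipode_approx :: "nat \<Rightarrow> 'a \<Rightarrow> 'a \<Rightarrow> int" where
  "antipode_approx 0 = (\<lambda>_ _. 0)"
| "antipode_approx (Suc n) = (\<lambda>a b. conv_unit a b - conv (antipode_approx n) aug a b)"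

lemma endo_aug: "endo aug"
  unfolding aug_def by (intro endo_diff endo_ident_on endo_conv_unit)

lemma endo_antipode_approx: "endo (antipode_approx n)"
proof (induction n)
  case 0
  show ?case by (simp add: endo_def mat_def)
next
  case (Suc n)
  then show ?case by (simp add: endo_diff endo_conv endo_conv_unit endo_aug)
qed

lemma conv_zero: "conv (\<lambda>_ _. 0) f = (\<lambda>_ _. 0)" "conv f (\<lambda>_ _. 0) = (\<lambda>_ _. 0)"
proof -
  have "((\<lambda>_ _. 0) :: 'a \<Rightarrow> 'a \<Rightarrow> int) \<otimes> f = (\<lambda>_ _. 0)"
    "f \<otimes> ((\<lambda>_ _. 0) :: 'a \<Rightarrow> 'a \<Rightarrow> int) = (\<lambda>_ _. 0)"
    by (auto simp: fun_eq_iff)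
  then show "conv (\<lambda>_ _. 0) f = (\<lambda>_ _. 0)" "conv f (\<lambda>_ _. 0) = (\<lambda>_ _. 0)"
    by (simp_all only: conv_def) (simp_all add: fun_eq_iff mcomp_apply)
qed

text \<open>The approximants are polynomials in \<open>aug\<close>, hence commute with it. The
  recursion multiplies by \<open>aug\<close> on the right only, whereas an antipode must be a
  two-sided inverse.\<close>

lemma antipode_approx_commute: "conv aug (antipode_approx n) = conv (antipode_approx n) aug"
proof (induction n)
  case 0
  show ?case by (simp add: conv_zero)
next
  case (Suc n)
  note ms = endo_conv_unit[THEN endoD(1)] endo_antipode_approx[THEN endoD(1)] endo_aug[THEN endoD(1)]
    endo_conv[OF endo_antipode_approx endo_aug, THEN endoD(1)]
    endo_antipode_approx[of "Suc n", THEN endoD(1), simplified]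
  have "conv aug (conv (antipode_approx n) aug) = conv (conv (antipode_approx n) aug) aug"
    using ms by (simp add: conv_assoc[symmetric] Suc)
  then show ?case
    using ms by (simp add: conv_diff_left conv_diff_right conv_unit_left conv_unit_right endo_aug)
qed

section \<open>Convergence of the geometric series for a graded coproduct\<close>

context
  fixes deg :: "'a \<Rightarrow> nat"
  assumes r: r
    and deg_add: "\<And>a b x. d a b x \<noteq> 0 \<Longrightarrow> deg x = deg a + deg b"
    and deg_0: "\<And>a. a \<in> A \<Longrightarrow> deg a = 0 \<Longrightarrow> a = e"
begin

text \<open>\<open>aug\<close> kills \<open>e\<close>, the only basis element of degree 0. So the
  terms that survive have deg b > 0 and therefore deg a < deg x.\<close>

lemma conv_aug_cong:
  assumes "\<And>a. deg a < deg x \<Longrightarrow> f a = g a"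
  shows "conv f aug x = conv g aug x"
proof (rule conv_cong)
  fix a b assume "d a b x \<noteq> 0"
  then have *: "deg x = deg a + deg b" "b \<in> A"
    using deg_add d_supp by auto
  have "aug b = (\<lambda>_. 0)" if "b = e"
    using that by (auto simp: aug_def ident_on_def conv_unit_def e_in fun_eq_iff)
  moreover have "f a = g a" if "b \<noteq> e"
    using that * deg_0[of b] assms[of a] by auto
  ultimately show "aug b = (\<lambda>_. 0) \<and> aug b = (\<lambda>_. 0) \<or> f a = g a \<and> aug b = aug b"
    by blast
qed

text \<open>Every further factor \<open>aug\<close> consumes at least one degree, so powers of
  \<open>aug\<close> beyond deg x contribute nothing to row \<open>x\<close>.\<close>

lemma antipode_approx_stable: "deg x < n \<Longrightarrow> antipode_approx n x = antipode_approx (Suc (deg x)) x"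
proof (induction "deg x" arbitrary: x n rule: less_induct)
  case less
  obtain n' where n: "n = Suc n'" "deg x \<le> n'"
    using less.prems by (cases n) auto
  have "antipode_approx n' a = antipode_approx (deg x) a" if "deg a < deg x" for a
    using less.hyps[OF that, of n'] less.hyps[OF that, of "deg x"] that n by simp
  then have "conv (antipode_approx n') aug x = conv (antipode_approx (deg x)) aug x"
    by (rule conv_aug_cong)
  then show ?case by (simp add: n)
qed

lemma conv_inverse_exists:
  "\<exists>s. endo s \<and> conv s ident_on = conv_unit \<and> conv ident_on s = conv_unit"
proof -
  \<comment> \<open>Each row is read off at its own stage. Since \<open>r\<close> holds, only
    finiteness of rows has to be checked, and this is unaffected by the choice of a different stage
    in every row.\<close>
  define s where "s x = antipode_approx (Suc (deg x)) x" for x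
  have s_eq: "s a = antipode_approx n a" if "deg a < n" for a n
    using antipode_approx_stable[OF that] by (simp add: s_def)
  have endo_s: "endo s"
    using endo_antipode_approx r unfolding endo_def mat_def s_def
    by (auto simp del: antipode_approx.simps)
  note ms = endo_conv_unit[THEN endoD(1)] endo_antipode_approx[THEN endoD(1)] endo_ident_on[THEN endoD(1)]
    endo_aug[THEN endoD(1)]
  note ms' = ms(1-3) ms(4)[unfolded aug_def[abs_def]]
  have approx: "conv (antipode_approx n) ident_on x z = conv_unit x z"
    "conv ident_on (antipode_approx n) x z = conv_unit x z" if n: "n = Suc (deg x)" for x z n
  proof -
    \<comment> \<open>Stages \<open>n\<close> and \<open>Suc n\<close> agree at row
      \<open>x\<close>, so the recursion becomes a fixed-point equation there. Inserting
      \<open>aug\<close> as the identity minus the unit cancels the approximant.\<close>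
    have stable: "antipode_approx n x z = conv_unit x z - conv (antipode_approx n) aug x z"
      using antipode_approx_stable[of x n] antipode_approx_stable[of x "Suc n"] n
      by (metis antipode_approx.simps(2) lessI less_SucI)
    have "conv (antipode_approx n) aug x z =
        conv (antipode_approx n) ident_on x z - antipode_approx n x z"
      unfolding aug_def[abs_def]
      by (simp add: conv_diff_right ms' conv_unit_right endo_antipode_approx)
    with stable show "conv (antipode_approx n) ident_on x z = conv_unit x z" by simp
    have "conv aug (antipode_approx n) x z =
        conv ident_on (antipode_approx n) x z - antipode_approx n x z"
      unfolding aug_def[abs_def]
      by (simp add: conv_diff_left ms' conv_unit_left endo_antipode_approx)
    with stable show "conv ident_on (antipode_approx n) x z = conv_unit x z"
      by (simp add: antipode_approx_commute)
  qed
  \<comment> \<open>Both factors in the coproduct of \<open>x\<close> have degree at most deg x, so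
    a single approximant serves for the whole row.\<close>
  have "s a = antipode_approx (Suc (deg x)) a" if "d a b x \<noteq> 0 \<or> d b a x \<noteq> 0" for a b x
    using that deg_add[of a b x] deg_add[of b a x] by (intro s_eq) auto
  then have "conv s ident_on x = conv (antipode_approx (Suc (deg x))) ident_on x"
    "conv ident_on s x = conv ident_on (antipode_approx (Suc (deg x))) x" for x
    by (intro conv_cong; blast)+
  then have "conv s ident_on = conv_unit" "conv ident_on s = conv_unit"
    using approx by (auto simp: fun_eq_iff)
  with endo_s show ?thesis by blast
qed

end

end


section \<open>Continuous duality\<close>

lemma bij_betw_the_inv_into_simps:
  assumes "bij_betw h B A"
  shows "b \<in> B \<Longrightarrow> the_inv_into B h (h b) = b" "a \<in> A \<Longrightarrow> the_inv_into B h a \<in> B"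
    "a \<in> A \<Longrightarrow> h (the_inv_into B h a) = a"
  using assms by (auto simp: bij_betw_def the_inv_into_f_f the_inv_into_into f_the_inv_into_f)

lemma pairing_Sum_any:
  assumes "g \<in> fin_combs B"
  shows "pairing h f g = (\<Sum>b. f (h b) * g b)"
  unfolding pairing_def
  by (rule Sum_any.expand_superset[symmetric]) (use assms in \<open>auto simp: fin_combs_def\<close>)

lemma pairing_basis_elem_right: "pairing h f (basis_elem b) = f (h b)"
proof -
  have "{b'. basis_elem b b' \<noteq> (0 :: int)} = {b}"
    by (auto simp: basis_elem_def)
  then show ?thesis
    by (simp add: pairing_def basis_elem_def)
qed

lemma pairing_basis_elem_left:
  assumes "bij_betw h B A" "g \<in> fin_combs B" "b \<in> B"
  shows "pairing h (basis_elem (h b)) g = g b"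
proof -
  have "pairing h (basis_elem (h b)) g = (\<Sum>b'. if b' = b then g b' else 0)"
    unfolding pairing_Sum_any[OF assms(2)] using assms
    by (intro Sum_any.cong) (auto simp: basis_elem_def fin_combs_def bij_betw_def dest: inj_onD)
  then show ?thesis by (simp only: Sum_any.delta)
qed

text \<open>A functional is a matrix with a single column, indexed by \<open>unit\<close>;
  finiteness of the support of \<open>g\<close> is finiteness of this column.\<close>

lemma continuous_functional_pairing:
  assumes h: "bij_betw h B A" and g: "g \<in> fin_combs B"
  shows "continuous_functional A (\<lambda>f. pairing h f g)"
proof (rule continuous_functional_lin_extend[where b = "()"])
  let ?\<phi> = "\<lambda>a (_ :: unit). if a \<in> A then g (the_inv_into B h a) else 0"
  note inv = bij_betw_the_inv_into_simps(1)[OF h]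
  have g_supp: "g b \<noteq> 0 \<Longrightarrow> b \<in> B" for b
    using g by (auto simp: fin_combs_def)
  have "{a. ?\<phi> a u \<noteq> 0} \<subseteq> h ` {b. g b \<noteq> 0}" for u
    using h by (auto simp: bij_betw_def inv image_iff split: if_splits)
  then have "finite {a. ?\<phi> a u \<noteq> 0}" for u
    by (rule finite_subset) (use g in \<open>simp add: fin_combs_def\<close>)
  then show "mat False ?\<phi>"
    unfolding mat_def by simp
  fix f
  have "(\<Sum>a. f a * ?\<phi> a ()) = (\<Sum>b. f (h b) * g b)"
  proof (rule Sum_any_inj[of h])
    show "inj_on h {b. f (h b) * g b \<noteq> 0}"
      using h by (auto simp: bij_betw_def inj_on_def g_supp)
    show "f (h b) * ?\<phi> (h b) () = f (h b) * g b" if "f (h b) * g b \<noteq> 0" for b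
      using that g_supp[of b] h inv[of b] by (auto simp: bij_betw_def)
    show "\<exists>b. f (h b) * g b \<noteq> 0 \<and> h b = a" if "f a * ?\<phi> a () \<noteq> 0" for a
    proof -
      from that have "a \<in> A" by (auto split: if_splits)
      then obtain b where "b \<in> B" "a = h b" using h by (auto simp: bij_betw_def)
      with that inv show ?thesis by (auto split: if_splits)
    qed
  qed
  then show "pairing h f g = lin_extend ?\<phi> f ()"
    by (simp add: pairing_Sum_any[OF g] lin_extend_Sum_any)
qed

lemma linear_functional_eq_sum:
  assumes "linear_functional (fin_combs B) \<psi>" "g \<in> fin_combs B"
  shows "\<psi> g = (\<Sum>b | g b \<noteq> 0. \<psi> (basis_elem b) * g b)"
proof -
  have lin: "\<psi> (\<lambda>a. c * x a + d * y a) = c * \<psi> x + d * \<psi> y"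
    if "x \<in> fin_combs B" "y \<in> fin_combs B" for c d x y
    using assms(1) that by (simp add: linear_functional_def)
  have "\<psi> (\<lambda>b. if b \<in> F then g b else 0) = (\<Sum>b\<in>F. \<psi> (basis_elem b) * g b)"
    if "finite F" "F \<subseteq> B" for F
    using that
  proof (induction F rule: finite_induct)
    case empty
    show ?case using lin[of "\<lambda>_. 0" "\<lambda>_. 0" 0 0] by (simp add: fin_combs_def)
  next
    case (insert b F)
    have "(\<lambda>c. if c \<in> F then g c else 0) \<in> fin_combs B" "basis_elem b \<in> fin_combs B"
      using insert basis_elem_combs[of b B True]
      by (auto simp: fin_combs_def combs_def intro: finite_subset[of _ F])
    note eq = lin[OF this, of 1 "g b"]
    have "(\<lambda>c. if c \<in> insert b F then g c else 0) =
        (\<lambda>c. 1 * (if c \<in> F then g c else 0) + g b * basis_elem b c)"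
      using insert.hyps by (auto simp: basis_elem_def)
    then show ?case using eq insert by simp
  qed
  from this[of "{b. g b \<noteq> 0}"] assms(2)
  have "\<psi> (\<lambda>b. if b \<in> {b. g b \<noteq> 0} then g b else 0) = (\<Sum>b | g b \<noteq> 0. \<psi> (basis_elem b) * g b)"
    by (simp add: fin_combs_def)
  moreover have "(\<lambda>b. if b \<in> {b. g b \<noteq> 0} then g b else 0) = g"
    by auto
  ultimately show ?thesis by simp
qed

lemma linear_functional_pairing: "linear_functional (fin_combs B) (\<lambda>g. pairing h f g)"
proof (rule linear_functional_cong)
  let ?\<phi> = "\<lambda>b (_ :: unit). f (h b)"
  show "(\<lambda>a. c * x a + d * y a) \<in> fin_combs B" if "x \<in> fin_combs B" "y \<in> fin_combs B" for c d x y
    using combs_closed[where r = True and A = B] that by (simp add: combs_def)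
  show "pairing h f g = lin_extend ?\<phi> g ()" if "g \<in> fin_combs B" for g
    by (simp add: pairing_Sum_any[OF that] lin_extend_Sum_any mult.commute)
  show "linear_functional (fin_combs B) (\<lambda>g. lin_extend ?\<phi> g ())"
    using linear_functional_lin_extend[where r = True and A = B and b = "()" and \<phi> = ?\<phi>]
    by (simp add: combs_def mat_def)
qed

lemma continuous_duals_bij:
  assumes h: "bij_betw h B A"
  shows "continuous_duals h A B"
  unfolding continuous_duals_def
proof (intro conjI ballI allI impI)
  let ?inv = "the_inv_into B h"
  note inv = bij_betw_the_inv_into_simps(1)[OF h] and inv_in = bij_betw_the_inv_into_simps(2,3)[OF h]
  have h_in: "h b \<in> A" if "b \<in> B" for b
    using h that by (auto simp: bij_betw_def)
  have basis_A: "basis_elem a \<in> all_combs A" if "a \<in> A" for a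
    using basis_elem_combs[OF that, of False] by (simp add: combs_def)
  have basis_B: "basis_elem b \<in> fin_combs B" if "b \<in> B" for b
    using basis_elem_combs[OF that, of True] by (simp add: combs_def)
  show "bij_betw h B A" by fact
  show "pairing h (basis_elem a) (basis_elem b) = of_bool (a = h b)" for a b
    unfolding pairing_basis_elem_right by (auto simp: basis_elem_def)
  show "continuous_functional A (\<lambda>f. pairing h f g)" if "g \<in> fin_combs B" for g
    using h that by (rule continuous_functional_pairing)
  show "linear_functional (fin_combs B) (\<lambda>g. pairing h f g)" for f
    by (rule linear_functional_pairing)
  show "\<exists>!g. g \<in> fin_combs B \<and> (\<forall>f\<in>all_combs A. \<phi> f = pairing h f g)"
    if \<phi>: "continuous_functional A \<phi>" for \<phi>
  proof -
    let ?g = "\<lambda>b. if b \<in> B then \<phi> (basis_elem (h b)) else 0"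
    \<comment> \<open>Continuity at the formal sum of all basis elements forces \<phi> to vanish on
      all but finitely many of them; this is why continuous functionals come from finite
      combinations.\<close>
    let ?one = "\<lambda>a. of_bool (a \<in> A) :: int"
    have "?one \<in> all_combs A" by (auto simp: all_combs_def)
    then have fin: "finite {a \<in> A. \<phi> (basis_elem a) \<noteq> 0}"
      using \<phi> by (auto simp: continuous_functional_def cong: conj_cong)
    have "{b. ?g b \<noteq> 0} \<subseteq> ?inv ` {a \<in> A. \<phi> (basis_elem a) \<noteq> 0}"
      using inv h_in by (auto simp: image_iff split: if_splits) (metis)
    then have "finite {b. ?g b \<noteq> 0}"
      by (rule finite_subset) (use fin in simp)
    then have g: "?g \<in> fin_combs B"
      by (auto simp only: fin_combs_def mem_Collect_eq split: if_splits)
    have "\<phi> f = pairing h f ?g" if f: "f \<in> all_combs A" for f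
    proof -
      have "\<phi> f = (\<Sum>a | a \<in> A \<and> f a * \<phi> (basis_elem a) \<noteq> 0. f a * \<phi> (basis_elem a))"
        using \<phi> f by (auto simp: continuous_functional_def)
      also have "\<dots> = (\<Sum>a\<in>{a \<in> A. \<phi> (basis_elem a) \<noteq> 0}. f a * \<phi> (basis_elem a))"
        by (rule sum.mono_neutral_left) (use fin in auto)
      also have "\<dots> = (\<Sum>b | ?g b \<noteq> 0. f (h b) * ?g b)"
        by (rule sum.reindex_bij_witness[of _ h ?inv]) (use inv inv_in h_in in \<open>auto split: if_splits\<close>)
      finally show ?thesis by (simp add: pairing_def)
    qed
    moreover have "g = ?g" if g: "g \<in> fin_combs B" "\<forall>f\<in>all_combs A. \<phi> f = pairing h f g" for g
    proof
      fix b show "g b = ?g b"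
        using g basis_A h_in[of b] pairing_basis_elem_left[OF h g(1), of b]
        by (cases "b \<in> B") (auto simp: fin_combs_def)
    qed
    ultimately show ?thesis using g by blast
  qed
  show "\<exists>!f. f \<in> all_combs A \<and> (\<forall>g\<in>fin_combs B. \<psi> g = pairing h f g)"
    if \<psi>: "linear_functional (fin_combs B) \<psi>" for \<psi>
  proof -
    let ?f = "\<lambda>a. if a \<in> A then \<psi> (basis_elem (?inv a)) else 0"
    have "?f \<in> all_combs A" by (auto simp: all_combs_def)
    moreover have "\<psi> g = pairing h ?f g" if g: "g \<in> fin_combs B" for g
      unfolding linear_functional_eq_sum[OF \<psi> g] pairing_def
      by (rule sum.cong) (use g inv h_in in \<open>auto simp: fin_combs_def\<close>)
    moreover have "f = ?f" if f: "f \<in> all_combs A" "\<forall>g\<in>fin_combs B. \<psi> g = pairing h f g" for f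
    proof
      fix a show "f a = ?f a"
        using f basis_B inv_in[of a] pairing_basis_elem_right[of h f "?inv a"]
        by (cases "a \<in> A") (auto simp: all_combs_def)
    qed
    ultimately show ?thesis by blast
  qed
qed

text \<open>Serves product, coproduct and antipode alike. The two sums may be exchanged because
  \<open>g\<close> has finite support and \<psi> has finite rows; the finite columns of \<phi> are
  the same condition on the transpose.\<close>

lemma pairing_transpose:
  assumes g: "g \<in> fin_combs B'" and f: "f \<in> all_combs A" and h: "bij_betw h B A"
    and \<phi>: "mat False \<phi>" and \<psi>: "mat True \<psi>"
    and supp: "\<And>b' b. b' \<in> B' \<Longrightarrow> \<psi> b' b \<noteq> 0 \<Longrightarrow> b \<in> B"
    and eq: "\<And>b b'. b \<in> B \<Longrightarrow> b' \<in> B' \<Longrightarrow> \<phi> (h b) (h' b') = \<psi> b' b"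
  shows "pairing h' (lin_extend \<phi> f) g = pairing h f (lin_extend \<psi> g)"
proof -
  have g_supp: "g b' \<noteq> 0 \<Longrightarrow> b' \<in> B'" for b'
    using g by (auto simp: fin_combs_def)
  have g': "lin_extend \<psi> g \<in> fin_combs B"
    using lin_extend_combs[where r = True, OF _ \<psi> supp] g by (simp add: combs_def)
  let ?G = "\<lambda>b' b. f (h b) * \<psi> b' b * g b'"
  have inner: "lin_extend \<phi> f (h' b') * g b' = (\<Sum>b. ?G b' b)" for b'
  proof (cases "g b' = 0")
    case False
    then have b': "b' \<in> B'" by (rule g_supp)
    have "lin_extend \<phi> f (h' b') = (\<Sum>b. f (h b) * \<psi> b' b)"
      unfolding lin_extend_Sum_any
    proof (rule Sum_any_inj[of h])
      have B: "{b. f (h b) * \<psi> b' b \<noteq> 0} \<subseteq> B"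
        using supp[OF b'] by auto
      then show "inj_on h {b. f (h b) * \<psi> b' b \<noteq> 0}"
        using h by (auto simp: bij_betw_def intro: inj_on_subset)
      show "f (h b) * \<phi> (h b) (h' b') = f (h b) * \<psi> b' b" if "f (h b) * \<psi> b' b \<noteq> 0" for b
        using that supp[OF b', of b] eq[OF _ b'] by auto
      show "\<exists>b. f (h b) * \<psi> b' b \<noteq> 0 \<and> h b = a" if "f a * \<phi> a (h' b') \<noteq> 0" for a
      proof -
        from that have "a \<in> A" using f by (auto simp: all_combs_def)
        then obtain b where "b \<in> B" "a = h b" using h by (auto simp: bij_betw_def)
        with that eq[OF _ b'] show ?thesis by auto
      qed
    qed
    moreover have "finite {b. f (h b) * \<psi> b' b \<noteq> 0}"
      by (rule finite_subset[OF _ matD(1)[OF \<psi>, of b']]) auto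
    ultimately show ?thesis by (simp only: Sum_any_left_distrib)
  qed simp
  have "finite (SIGMA b':{b'. g b' \<noteq> 0}. {b. \<psi> b' b \<noteq> 0})"
    using g \<psi> by (auto simp: fin_combs_def intro!: finite_SigmaI matD(1))
  then have fin: "finite {p. case_prod ?G p \<noteq> 0}"
    by (rule rev_finite_subset) auto
  have "pairing h' (lin_extend \<phi> f) g = (\<Sum>b'. \<Sum>b. ?G b' b)"
    by (simp only: pairing_Sum_any[OF g] inner)
  also have "\<dots> = (\<Sum>b. \<Sum>b'. ?G b' b)"
    using fin by (rule Sum_any_swap)
  also have "\<dots> = (\<Sum>b. f (h b) * lin_extend \<psi> g b)"
  proof (rule Sum_any.cong)
    fix b
    have "finite {b'. g b' * \<psi> b' b \<noteq> 0}"
      by (rule finite_subset[of _ "{b'. g b' \<noteq> 0}"]) (use g in \<open>auto simp: fin_combs_def\<close>)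
    then have "f (h b) * lin_extend \<psi> g b = (\<Sum>b'. f (h b) * (g b' * \<psi> b' b))"
      unfolding lin_extend_Sum_any by (rule Sum_any_right_distrib)
    then show "(\<Sum>b'. ?G b' b) = f (h b) * lin_extend \<psi> g b"
      by (simp add: mult_ac)
  qed
  also have "\<dots> = pairing h f (lin_extend \<psi> g)"
    by (simp only: pairing_Sum_any[OF g'])
  finally show ?thesis .
qed

section \<open>Dual pairs of bialgebras and transposed antipodes\<close>

lemma bij_betw_map_prod: "bij_betw h B A \<Longrightarrow> bij_betw h' B' A' \<Longrightarrow> bij_betw (map_prod h h') (B \<times> B') (A \<times> A')"
  by (auto simp: bij_betw_def map_prod_inj_on map_prod_surj_on)

text \<open>\<open>K\<close> multiplies with \<open>d\<close> and comultiplies with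
  \<open>m\<close>. The assumptions \<open>m_finite\<close> and \<open>d_finite\<close> are at once
  column finiteness for \<open>H\<close> and, transposed, row finiteness for
  \<open>K\<close>.\<close>

locale dual_bialgebras = structure_constants +
  fixes H :: "'a bialg" and K :: "'b bialg" and B :: "'b set" and h :: "'b \<Rightarrow> 'a" and e' :: 'b
  assumes h: "bij_betw h B A" and e': "e' \<in> B" "h e' = e"
    and m_finite: "\<And>x. finite {(a, b). m a b x \<noteq> 0}"
    and d_finite: "\<And>a b. finite {x. d a b x \<noteq> 0}"
    and H_mult: "\<And>F. F \<in> all_combs (A \<times> A) \<Longrightarrow> mult H F = lin_extend (prod_mat m) F"
    and H_comult: "\<And>f. f \<in> all_combs A \<Longrightarrow> comult H f = lin_extend (coprod_mat d) f"
    and H_rest: "basis H = A" "unit_map H = (\<lambda>n a. n * basis_elem e a)" "counit H = (\<lambda>f. f e)"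
    and K_mult: "\<And>F. F \<in> fin_combs (B \<times> B) \<Longrightarrow>
      mult K F = lin_extend (prod_mat (pull_back B h d)) F"
    and K_comult: "\<And>f. f \<in> fin_combs B \<Longrightarrow>
      comult K f = lin_extend (coprod_mat (pull_back B h m)) f"
    and K_rest: "basis K = B" "unit_map K = (\<lambda>n a. n * basis_elem e' a)" "counit K = (\<lambda>f. f e')"
begin

abbreviation "mK \<equiv> pull_back B h d"
abbreviation "dK \<equiv> pull_back B h m"

lemma h_inj: "a \<in> B \<Longrightarrow> b \<in> B \<Longrightarrow> h a = h b \<longleftrightarrow> a = b"
  using h by (auto simp: bij_betw_def dest: inj_onD)

lemma h_in: "b \<in> B \<Longrightarrow> h b \<in> A"
  using h by (auto simp: bij_betw_def)

lemma pull_back_eq: "a \<in> B \<Longrightarrow> b \<in> B \<Longrightarrow> x \<in> B \<Longrightarrow> pull_back B h k a b x = k (h a) (h b) (h x)"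
  by (simp add: pull_back_def)

sublocale H: bialgebra_mats A e m d False
proof
  show "mat False (\<lambda>(a, b) x. m a b x)"
    using m_finite by (simp add: mat_def case_prod_unfold)
  show "mat False (\<lambda>x (p, q). d p q x)"
    using d_finite by (simp add: mat_def case_prod_unfold)
qed

text \<open>The axioms for \<open>K\<close> are those for \<open>H\<close> with product and
  coproduct exchanged, transported along \<open>h\<close>.\<close>

sublocale K: structure_constants B e' mK dK
  using structure_constants_pull_back[OF structure_constants_dual[OF structure_constants_axioms] h e'] .

sublocale K: bialgebra_mats B e' mK dK True
proof
  have inj: "inj_on h B" "inj_on (map_prod h h) (B \<times> B)"
    using h by (auto simp: bij_betw_def map_prod_inj_on)
  have "finite {x \<in> B. d (h a) (h b) (h x) \<noteq> 0}" for a b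
    using finite_vimage_IntI[OF d_finite[of "h a" "h b"] inj(1)]
    by (rule rev_finite_subset) auto
  then show "mat True (\<lambda>(a, b) x. mK a b x)"
    by (auto simp: mat_def pull_back_def intro: rev_finite_subset split: if_splits)
  have "finite {p \<in> B \<times> B. case map_prod h h p of (a, b) \<Rightarrow> m a b (h x) \<noteq> 0}" for x
    using finite_vimage_IntI[OF m_finite[of "h x"] inj(2)]
    by (rule rev_finite_subset) auto
  then have "finite {p. (\<lambda>(p, q). dK p q x) p \<noteq> 0}" for x
    by (rule rev_finite_subset) (auto simp: pull_back_def split: if_splits)
  then show "mat True (\<lambda>x (p, q). dK p q x)"
    by (simp add: mat_def)
qed

theorem continuous_dual_bialgebras: "continuous_dual_bialgebras h H K"
proof -
  have "linear_map (fin_combs (B \<times> B)) (fin_combs B) (mult K)"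
    by (rule linear_map_lin_extend[OF K.mat_m]) (auto simp: K_mult dest: K.m_supp)
  moreover have "linear_map (fin_combs B) (fin_combs (B \<times> B)) (comult K)"
    by (rule linear_map_lin_extend[OF K.mat_d]) (auto simp: K_comult dest: K.d_supp)
  moreover have "linear_functional (fin_combs B) (counit K)"
    by (simp add: K_rest linear_functional_def)
  moreover have "bialgebra_laws (fin_combs B) K"
    using K.bialgebra_laws[of K] K_mult K_comult K_rest by (simp add: combs_def)
  ultimately have K: "free_bialgebra K"
    by (simp add: free_bialgebra_def K_rest(1))
  have "continuous_map (A \<times> A) A (mult H)"
    by (rule continuous_map_lin_extend[OF H.mat_m]) (auto simp: H_mult dest: m_supp)
  moreover have "continuous_map A (A \<times> A) (comult H)"
    by (rule continuous_map_lin_extend[OF H.mat_d]) (auto simp: H_comult dest: d_supp)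
  moreover have "continuous_functional A (counit H)"
    by (rule continuous_functional_lin_extend[OF mat_basis_elem, where b = e])
      (simp add: H_rest lin_extend_ident[where r = False and A = A] combs_def)
  moreover have "bialgebra_laws (all_combs A) H"
    using H.bialgebra_laws[of H] H_mult H_comult H_rest by (simp add: combs_def)
  ultimately have H: "complete_bialgebra H"
    by (simp add: complete_bialgebra_def H_rest(1))
  have "pairing h (mult H F) g = pairing (map_prod h h) F (comult K g)"
    if "F \<in> all_combs (A \<times> A)" "g \<in> fin_combs B" for F g
    unfolding H_mult[OF that(1)] K_comult[OF that(2)]
    by (rule pairing_transpose[OF that(2,1) bij_betw_map_prod[OF h h] H.mat_m K.mat_d])
      (auto simp: pull_back_eq dest: K.d_supp)
  moreover have "pairing (map_prod h h) (comult H f) G = pairing h f (mult K G)"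
    if "f \<in> all_combs A" "G \<in> fin_combs (B \<times> B)" for f G
    unfolding H_comult[OF that(1)] K_mult[OF that(2)]
    by (rule pairing_transpose[OF that(2,1) h H.mat_d K.mat_m])
      (auto simp: pull_back_eq dest: K.m_supp)
  moreover have "pairing h (unit_map H n) g = n * counit K g" if g: "g \<in> fin_combs B" for n g
  proof -
    have "pairing h (unit_map H n) g = (\<Sum>b. if b = e' then n * g b else 0)"
      unfolding pairing_Sum_any[OF g] H_rest using g h_inj[of _ e'] e'
      by (intro Sum_any.cong) (auto simp: fin_combs_def basis_elem_def)
    then show ?thesis by (simp only: Sum_any.delta K_rest)
  qed
  moreover have "counit H f * n = pairing h f (unit_map K n)" for f n
  proof -
    have "unit_map K n \<in> fin_combs B"
      using combs_closed[OF basis_elem_combs[OF e'(1)] basis_elem_combs[OF e'(1)], where r = True and c = n and d = 0]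
      by (simp add: K_rest combs_def)
    then have "pairing h f (unit_map K n) = (\<Sum>b. if b = e' then f (h b) * n else 0)"
      unfolding K_rest
      by (simp only: pairing_Sum_any) (rule Sum_any.cong, auto simp: basis_elem_def)
    then show ?thesis by (simp only: Sum_any.delta H_rest e')
  qed
  ultimately show ?thesis
    using H K continuous_duals_bij[OF h]
    by (simp add: continuous_dual_bialgebras_def H_rest(1) K_rest(1))
qed

text \<open>Transposition reverses the path coproduct, maps, product. As it also exchanges product
  and coproduct, a convolution goes to the convolution of the transposes, in the same order of
  factors.\<close>

lemma conv_transpose:
  assumes f: "H.endo f" "K.endo f'" and g: "H.endo g" "K.endo g'"
    and eq: "\<And>a b. a \<in> B \<Longrightarrow> b \<in> B \<Longrightarrow> f (h a) (h b) = f' b a"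
      "\<And>a b. a \<in> B \<Longrightarrow> b \<in> B \<Longrightarrow> g (h a) (h b) = g' b a"
    and xz: "x \<in> B" "z \<in> B"
  shows "H.conv f g (h x) (h z) = K.conv f' g' z x"
proof -
  let ?F = "\<lambda>((a, b), (p, q)). d a b (h x) * (f a p * g b q) * m p q (h z)"
  let ?G = "\<lambda>((a, b), (p, q)). dK a b z * (f' a p * g' b q) * mK p q x"
  \<comment> \<open>Besides applying \<open>h\<close>, the reindexing exchanges the pair entering
    the maps with the pair leaving them.\<close>
  let ?h = "\<lambda>((a, b), (p, q)). ((h p, h q), (h a, h b))"
  have "Sum_any ?F = Sum_any ?G"
  proof (rule Sum_any_inj[of ?h])
    have supp: "a \<in> B \<and> b \<in> B \<and> p \<in> B \<and> q \<in> B" if "?G ((a, b), (p, q)) \<noteq> 0" for a b p q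
      using that by (auto dest: K.m_supp K.d_supp)
    have "inj_on ?h ((B \<times> B) \<times> (B \<times> B))"
      by (auto simp: inj_on_def h_inj)
    moreover have "{t. ?G t \<noteq> 0} \<subseteq> (B \<times> B) \<times> (B \<times> B)"
      using supp by auto
    ultimately show "inj_on ?h {t. ?G t \<noteq> 0}"
      by (rule inj_on_subset)
    show "?F (?h t) = ?G t" if "?G t \<noteq> 0" for t
    proof -
      obtain a b p q where t: "t = ((a, b), (p, q))" by (metis surj_pair)
      with that supp[of a b p q] have "a \<in> B" "b \<in> B" "p \<in> B" "q \<in> B" by auto
      then show ?thesis
        using xz by (simp add: t pull_back_eq eq mult_ac)
    qed
    show "\<exists>s. ?G s \<noteq> 0 \<and> ?h s = t" if "?F t \<noteq> 0" for t
    proof -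
      obtain a b p q where t: "t = ((a, b), (p, q))" by (metis surj_pair)
      with that have "a \<in> h ` B" "b \<in> h ` B" "p \<in> h ` B" "q \<in> h ` B"
        using h d_supp[of a b "h x"] m_supp[of p q "h z"] by (auto simp: bij_betw_def)
      then obtain a' b' p' q' where "a' \<in> B" "h a' = a" "b' \<in> B" "h b' = b" "p' \<in> B" "h p' = p"
        "q' \<in> B" "h q' = q" by auto
      with that t xz eq show ?thesis
        by (intro exI[of _ "((p', q'), (a', b'))"]) (auto simp: pull_back_eq)
    qed
  qed
  then show ?thesis
    using H.conv_Sum_any[OF f(1)[THEN H.endoD(1)] g(1)[THEN H.endoD(1)]]
      K.conv_Sum_any[OF f(2)[THEN K.endoD(1)] g(2)[THEN K.endoD(1)]] by simp
qed

text \<open>The given \<open>T\<close> is an arbitrary linear map, known only on finite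
  combinations. It is first replaced by its matrix \<open>t\<close>; the antipode of
  \<open>H\<close> is then the continuous extension of the transpose of \<open>t\<close>.\<close>

theorem antipode_transpose:
  assumes T: "free_antipode K T"
  shows "\<exists>S. continuous_dual_Hopf_algebras h H S K T"
proof -
  define t where "t b b' = (if b \<in> B then T (basis_elem b) b' else 0)" for b b'
  have T_map: "linear_map (fin_combs B) (fin_combs B) T" and T_laws: "antipode_laws (fin_combs B) K T"
    using T by (auto simp: free_antipode_def K_rest)
  have T_basis: "T (basis_elem b) \<in> fin_combs B" if "b \<in> B" for b
    using T_map basis_elem_combs[OF that, of True] by (auto simp: linear_map_def combs_def)
  have T_eq: "T g = lin_extend t g" if g: "g \<in> fin_combs B" for g
  proof
    fix b
    have "linear_functional (fin_combs B) (\<lambda>x. T x b)"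
      using T_map by (simp add: linear_map_def)
    from linear_functional_eq_sum[OF this g]
    have "T g b = (\<Sum>b' | g b' \<noteq> 0. g b' * t b' b)"
      using g by (auto simp: t_def fin_combs_def mult.commute intro!: sum.cong)
    also have "\<dots> = lin_extend t g b"
      unfolding lin_extend_def
      by (rule sum.mono_neutral_right) (use g in \<open>auto simp: fin_combs_def\<close>)
    finally show "T g b = lin_extend t g b" .
  qed
  have endo_t: "K.endo t"
    using T_basis by (auto simp: K.endo_def mat_def t_def fin_combs_def)
  let ?inv = "the_inv_into B h"
  note inv = bij_betw_the_inv_into_simps(1)[OF h] and inv_in = bij_betw_the_inv_into_simps(2,3)[OF h]
  \<comment> \<open>The transpose of \<open>t\<close>. Its columns are images under \<open>h\<close>
    of rows of \<open>t\<close> and hence finite, which gives continuity.\<close>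
  define s where "s a a' = (if a \<in> A \<and> a' \<in> A then t (?inv a') (?inv a) else 0)" for a a'
  have s_eq: "s (h a) (h b) = t b a" if "a \<in> B" "b \<in> B" for a b
    using that by (simp add: s_def inv h_in)
  have "finite {a. s a a' \<noteq> 0}" for a'
  proof (rule finite_subset)
    show "{a. s a a' \<noteq> 0} \<subseteq> h ` {b. t (?inv a') b \<noteq> 0}"
      using inv_in(2) by (force simp: s_def split: if_splits)
    show "finite (h ` {b. t (?inv a') b \<noteq> 0})"
      using K.endoD(1)[OF endo_t] by (auto simp: mat_def)
  qed
  then have endo_s: "H.endo s"
    by (auto simp: H.endo_def mat_def s_def split: if_splits)
  have unit: "H.conv_unit (h x) (h z) = K.conv_unit z x" if "x \<in> B" "z \<in> B" for x z
    using that h_inj[of _ e'] e' by (auto simp: H.conv_unit_def K.conv_unit_def)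
  have ident: "H.ident_on (h x) (h z) = K.ident_on z x" if "x \<in> B" "z \<in> B" for x z
    using that h_inj h_in by (auto simp: H.ident_on_def K.ident_on_def)
  have K_conv: "K.conv t K.ident_on = K.conv_unit" "K.conv K.ident_on t = K.conv_unit"
    using K.antipode_laws_iff[of K t T] K_mult K_comult K_rest endo_t T_eq T_laws
    by (auto simp: combs_def)
  \<comment> \<open>The inverse equations need checking only at indices coming from
    \<open>B\<close>, where \<open>conv_transpose\<close> applies.\<close>
  have eqI: "f = g" if "H.endo f" "H.endo g" "\<And>x z. x \<in> B \<Longrightarrow> z \<in> B \<Longrightarrow> f (h x) (h z) = g (h x) (h z)" for f g
  proof (intro ext)
    fix x z
    show "f x z = g x z"
    proof (cases "x \<in> A \<and> z \<in> A")
      case True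
      then show ?thesis using that(3)[of "?inv x" "?inv z"] inv_in by simp
    next
      case False
      then show ?thesis using H.endoD(2)[OF that(1), of x z] H.endoD(2)[OF that(2), of x z] by metis
    qed
  qed
  have H_conv: "H.conv s H.ident_on = H.conv_unit" "H.conv H.ident_on s = H.conv_unit"
    by (intro eqI H.endo_conv H.endo_conv_unit H.endo_ident_on endo_s,
        simp add: conv_transpose[OF endo_s endo_t H.endo_ident_on K.endo_ident_on s_eq ident]
          conv_transpose[OF H.endo_ident_on K.endo_ident_on endo_s endo_t ident s_eq] K_conv unit)+
  let ?S = "lin_extend s"
  have "antipode_laws (all_combs A) H ?S"
    using H.antipode_laws_iff[of H s ?S] H_mult H_comult H_rest endo_s H_conv
    by (auto simp: combs_def)
  moreover have "continuous_map A A ?S"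
    by (rule continuous_map_lin_extend[OF H.endoD(1)[OF endo_s]]) (auto dest: H.endoD(2)[OF endo_s])
  ultimately have "complete_antipode H ?S"
    by (simp add: complete_antipode_def H_rest)
  moreover have "pairing h (?S f) g = pairing h f (T g)"
    if "f \<in> all_combs A" "g \<in> fin_combs B" for f g
    unfolding T_eq[OF that(2)]
    by (rule pairing_transpose[OF that(2,1) h H.endoD(1)[OF endo_s] K.endoD(1)[OF endo_t]])
      (auto simp: s_eq dest: K.endoD(2)[OF endo_t])
  ultimately have "continuous_dual_Hopf_algebras h H ?S K T"
    using T continuous_dual_bialgebras
    by (simp add: continuous_dual_Hopf_algebras_def H_rest K_rest)
  then show ?thesis by blast
qed

text \<open>The grading is a condition on \<open>m\<close>, which is the product of \<open>H\<close>
  but the coproduct of \<open>K\<close>.\<close>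

theorem antipode_exists:
  fixes deg :: "'a \<Rightarrow> nat"
  assumes deg_add: "\<And>a b x. m a b x \<noteq> 0 \<Longrightarrow> deg x = deg a + deg b"
    and deg_0: "\<And>a. a \<in> A \<Longrightarrow> deg a = 0 \<Longrightarrow> a = e"
  shows "\<exists>T. free_antipode K T"
proof -
  have "deg (h x) = deg (h a) + deg (h b)" if "dK a b x \<noteq> 0" for a b x
    using that by (intro deg_add) (auto simp: pull_back_def split: if_splits)
  moreover have "a = e'" if "a \<in> B" "deg (h a) = 0" for a
    using deg_0[OF h_in that(2)] that h_inj[of a e'] e' by auto
  ultimately obtain s where s: "K.endo s" "K.conv s K.ident_on = K.conv_unit"
      "K.conv K.ident_on s = K.conv_unit"
    using K.conv_inverse_exists[of "deg \<circ> h"] by auto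
  then have "antipode_laws (fin_combs B) K (lin_extend s)"
    using K.antipode_laws_iff[of K s "lin_extend s"] K_mult K_comult K_rest by (auto simp: combs_def)
  moreover have "linear_map (fin_combs B) (fin_combs B) (lin_extend s)"
    by (rule linear_map_lin_extend[OF K.endoD(1)[OF s(1)]]) (auto dest: K.endoD(2)[OF s(1)])
  ultimately show ?thesis
    by (auto simp: free_antipode_def K_rest)
qed

end


section \<open>Packed words\<close>

abbreviation "red \<equiv> remdups_adj"

lemma remdups_adj_append_remdups_adj_left: "red (red a @ b) = red (a @ b)"
proof (cases "a = []")
  case False
  then show ?thesis
    using remdups_adj_append''[of a b] remdups_adj_append''[of "red a" b]
    by (simp add: distinct_adj_altdef[THEN iffD1, OF distinct_adj_remdups_adj])
qed simp

lemma remdups_adj_append_remdups_adj_right: "red (a @ red b) = red (a @ b)"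
proof -
  have "red (rev (a @ red b)) = red (rev (a @ b))"
    by (simp only: rev_append remdups_adj_rev[symmetric] remdups_adj_append_remdups_adj_left)
  then show ?thesis
    by (metis remdups_adj_rev rev_rev_ident)
qed

lemma remdups_adj_Cons_cong:
  "red xs = red ys \<Longrightarrow> red (x # xs) = red (x # ys)"
  by (simp add: remdups_adj_Cons)

text \<open>Equal neighbours are kept or deleted together by \<open>filter\<close>, so a repetition
  removed beforehand would also be one afterwards.\<close>

lemma remdups_adj_filter_remdups_adj:
  "red (filter P (red xs)) = red (filter P xs)"
proof (induction xs rule: remdups_adj.induct)
  case (3 x y xs)
  then show ?case
    using remdups_adj_Cons_cong[of "filter P (red (y # xs))" "filter P (y # xs)" x]
    by (cases "x = y") auto
qed auto

lemma remdups_adj_map: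
  "inj_on g (set xs) \<Longrightarrow> red (map g xs) = map g (red xs)"
  by (induction xs rule: remdups_adj.induct) (auto simp: inj_on_def)

lemma remdups_adj_id: "distinct_adj xs \<Longrightarrow> red xs = xs"
  by (simp add: distinct_adj_altdef)

lemma distinct_adj_take_drop:
  assumes "distinct_adj xs"
  shows "distinct_adj (take i xs)" "distinct_adj (drop i xs)"
  using assms distinct_adj_append_iff[of "take i xs" "drop i xs"] by auto

section \<open>Standardization of words by ranks\<close>

lemma mperms_all_iff: "w \<in> mperms_all \<longleftrightarrow> distinct_adj w \<and> set w = {1..card (set w)}"
proof
  assume "w \<in> mperms_all"
  then obtain n where "set w = {1..n}" "distinct_adj w"
    by (auto simp: mperms_all_def mperms_def)
  then show "distinct_adj w \<and> set w = {1..card (set w)}"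
    by simp
qed (auto simp: mperms_all_def mperms_def)

text \<open>On \<open>X\<close> this is the order isomorphism onto an initial interval. It is also
  used at numbers outside \<open>X\<close>: the rank of a threshold counts the letters that do not
  exceed it.\<close>

definition rank :: "nat set \<Rightarrow> nat \<Rightarrow> nat" where
  "rank X a = card {b \<in> X. b \<le> a}"

lemma rank_strict_mono:
  assumes "finite X" "b \<in> X" "a < b"
  shows "rank X a < rank X b"
  unfolding rank_def
proof (rule psubset_card_mono)
  have "b \<in> {c \<in> X. c \<le> b}" "b \<notin> {c \<in> X. c \<le> a}"
    using assms by auto
  moreover have "{c \<in> X. c \<le> a} \<subseteq> {c \<in> X. c \<le> b}"
    using assms by auto
  ultimately show "{c \<in> X. c \<le> a} \<subset> {c \<in> X. c \<le> b}"
    by blast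
qed (use assms in simp)

lemma rank_mono: "finite X \<Longrightarrow> a \<le> b \<Longrightarrow> rank X a \<le> rank X b"
  unfolding rank_def by (rule card_mono) auto

lemma rank_less_iff: "finite X \<Longrightarrow> b \<in> X \<Longrightarrow> rank X a < rank X b \<longleftrightarrow> a < b"
  using rank_strict_mono[of X b a] rank_mono[of X b a] by (meson not_le)

lemma inj_on_rank: "finite X \<Longrightarrow> inj_on (rank X) X"
  by (rule linorder_inj_onI) (auto dest: rank_strict_mono)

lemma rank_image: "finite X \<Longrightarrow> rank X ` X = {1..card X}"
proof (rule card_subset_eq)
  assume X: "finite X"
  have "rank X a \<le> card X" "rank X a > 0" if "a \<in> X" for a
    using X that by (auto simp: rank_def card_gt_0_iff intro: card_mono)
  then show "rank X ` X \<subseteq> {1..card X}"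
    by (auto simp: Suc_le_eq)
  show "card (rank X ` X) = card {1..card X}"
    using card_image[OF inj_on_rank[OF X]] by simp
qed simp

lemma rank_atLeastAtMost: "a \<in> {1..n} \<Longrightarrow> rank {1..n} a = a"
proof -
  assume "a \<in> {1..n}"
  then have "{b \<in> {1..n}. b \<le> a} = {1..a}" by auto
  then show ?thesis by (simp add: rank_def)
qed

lemma rank_image_strict_mono:
  assumes "strict_mono_on X g" "a \<in> X"
  shows "rank (g ` X) (g a) = rank X a"
proof -
  have "{b \<in> g ` X. b \<le> g a} = g ` {b \<in> X. b \<le> a}"
    using assms strict_mono_on_less_eq by fastforce
  moreover have "inj_on g {b \<in> X. b \<le> a}"
    using strict_mono_on_imp_inj_on[OF assms(1)] by (rule inj_on_subset) auto
  ultimately show ?thesis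
    by (simp add: rank_def card_image)
qed

lemma card_image_eq_card_image:
  assumes "\<And>j k. j \<in> J \<Longrightarrow> k \<in> J \<Longrightarrow> f j = f k \<longleftrightarrow> g j = g k"
  shows "card (f ` J) = card (g ` J)"
proof (rule bij_betw_same_card, rule bij_betw_imageI)
  let ?h = "\<lambda>b. g (inv_into J f b)"
  have h: "?h (f j) = g j" if "j \<in> J" for j
    using assms[of "inv_into J f (f j)" j] that by (simp add: inv_into_into f_inv_into_f)
  show "inj_on ?h (f ` J)"
  proof (rule inj_onI)
    fix b b' assume "b \<in> f ` J" "b' \<in> f ` J" "?h b = ?h b'"
    then obtain j k where "j \<in> J" "k \<in> J" "b = f j" "b' = f k" "g j = g k"
      using h by auto
    with assms show "b = b'" by blast
  qed
  show "?h ` f ` J = g ` J"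
    unfolding image_image using h by (rule image_cong[OF refl])
qed

text \<open>\<open>rank\<close> counts letters, while the hypothesis compares positions. So the
  letters up to the given one are counted, in both words, as images of the same set of
  positions.\<close>

lemma rank_order_eq:
  assumes len: "length u = length w"
    and order: "\<And>i j. i < length w \<Longrightarrow> j < length w \<Longrightarrow> u ! i < u ! j \<longleftrightarrow> w ! i < w ! j"
    and i: "i < length w"
  shows "rank (set u) (u ! i) = rank (set w) (w ! i)"
proof -
  let ?J = "{j. j < length w \<and> w ! j \<le> w ! i}"
  have le: "u ! j \<le> u ! k \<longleftrightarrow> w ! j \<le> w ! k" if "j < length w" "k < length w" for j k
    using order[OF that(2,1)] by (simp add: not_less[symmetric])
  have u: "{b \<in> set u. b \<le> u ! i} = (!) u ` ?J"
    using len le i by (auto simp: set_conv_nth image_iff)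
  have w: "{b \<in> set w. b \<le> w ! i} = (!) w ` ?J"
    by (auto simp: set_conv_nth image_iff)
  have "card ((!) u ` ?J) = card ((!) w ` ?J)"
  proof (rule card_image_eq_card_image)
    fix j k assume "j \<in> ?J" "k \<in> ?J"
    then show "u ! j = u ! k \<longleftrightarrow> w ! j = w ! k"
      using le[of j k] le[of k j] by (auto simp: eq_iff)
  qed
  then show ?thesis
    by (simp add: rank_def u w)
qed

text \<open>Uniqueness holds because the letters of \<open>u\<close> fill an interval starting at 1,
  so each is its own rank, and ranks depend on the relative order only.\<close>

lemma mstd_eq:
  assumes "distinct_adj w"
  shows "mstd w = map (rank (set w)) w"
  unfolding mstd_def
proof (rule the_equality)
  have "set (map (rank (set w)) w) = {1..card (set w)}"
    by (simp add: rank_image)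
  moreover have "distinct_adj (map (rank (set w)) w)"
    using assms by (simp add: distinct_adj_map_iff inj_on_rank)
  ultimately show "map (rank (set w)) w \<in> mperms_all \<and>
      length (map (rank (set w)) w) = length w \<and>
      (\<forall>i<length w. \<forall>j<length w.
        map (rank (set w)) w ! i < map (rank (set w)) w ! j \<longleftrightarrow> w ! i < w ! j)"
    by (auto simp: mperms_all_def mperms_def rank_less_iff)
  fix u assume u: "u \<in> mperms_all \<and> length u = length w \<and>
      (\<forall>i<length w. \<forall>j<length w. u ! i < u ! j \<longleftrightarrow> w ! i < w ! j)"
  show "u = map (rank (set w)) w"
  proof (rule nth_equalityI)
    fix i assume i: "i < length u"
    then have "u ! i \<in> set u" by simp
    moreover obtain n where n: "set u = {1..n}"
      using u by (auto simp: mperms_all_def mperms_def)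
    ultimately have "rank (set u) (u ! i) = u ! i"
      using rank_atLeastAtMost by simp
    moreover have "rank (set u) (u ! i) = rank (set w) (w ! i)"
      using u i by (intro rank_order_eq) auto
    ultimately show "u ! i = map (rank (set w)) w ! i"
      using u i by simp
  qed (use u in simp)
qed

lemma mstd_in: "distinct_adj w \<Longrightarrow> mstd w \<in> mperms_all"
  by (auto simp: mstd_eq mperms_all_def mperms_def rank_image distinct_adj_map_iff inj_on_rank)

lemma length_mstd: "distinct_adj w \<Longrightarrow> length (mstd w) = length w"
  by (simp add: mstd_eq)

lemma card_set_mstd: "distinct_adj w \<Longrightarrow> card (set (mstd w)) = card (set w)"
  by (simp add: mstd_eq rank_image)

lemma mstd_Nil [simp]: "mstd [] = []"
  by (simp add: mstd_eq)

lemma mstd_eq_Nil_iff: "distinct_adj w \<Longrightarrow> mstd w = [] \<longleftrightarrow> w = []"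
  by (simp add: mstd_eq)

lemma mstd_id: "w \<in> mperms_all \<Longrightarrow> mstd w = w"
  using rank_atLeastAtMost by (auto simp: mstd_eq mperms_all_def mperms_def intro!: map_idI)

lemma mstd_map:
  assumes "distinct_adj w" "strict_mono_on (set w) g"
  shows "mstd (map g w) = mstd w"
proof -
  have "distinct_adj (map g w)"
    using assms(1) strict_mono_on_imp_inj_on[OF assms(2)] by (simp add: distinct_adj_map_iff)
  then show ?thesis
    using assms by (simp add: mstd_eq rank_image_strict_mono)
qed

text \<open>Standardization forgets nothing but the set of letters. Together with
  \<open>ex_mstd\<close>, reduced words with letter set \<open>U\<close> correspond to the basis
  words with \<open>card U\<close> letters.\<close>

lemma mstd_inject:
  assumes "distinct_adj u" "distinct_adj v" "set u = set v" "mstd u = mstd v"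
  shows "u = v"
  using assms inj_on_rank[of "set u"] by (auto simp: mstd_eq inj_on_map_eq_map)

lemma ex_mstd:
  assumes "p \<in> mperms_all" "finite U" "card U = card (set p)"
  obtains u where "distinct_adj u" "set u = U" "mstd u = p"
proof
  let ?g = "inv_into U (rank U)"
  let ?u = "map ?g p"
  have p: "set p = rank U ` U"
    using assms by (simp add: rank_image mperms_all_iff)
  have inj: "inj_on ?g (set p)"
    using p by (simp add: inj_on_inv_into)
  then show distinct: "distinct_adj ?u"
    using assms by (simp add: distinct_adj_map_iff mperms_all_iff)
  show set: "set ?u = U"
    using p inj_on_rank[OF assms(2)] by (simp add: image_comp)
  show "mstd ?u = p"
    using p unfolding mstd_eq[OF distinct] set
    by (auto intro!: map_idI simp: f_inv_into_f)
qed


section \<open>Cuts\<close>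

definition Cut :: "nat list \<Rightarrow> (nat list \<times> nat list) set" where
  "Cut x = {(a, b). distinct_adj a \<and> distinct_adj b \<and> red (a @ b) = x}"

text \<open>Two reduced words can be joined without cancellation, or the last letter of the first
  equals the initial letter of the second and these two merge. The cases are the two sums in the
  coproduct.\<close>

lemma Cut_eq:
  assumes "distinct_adj x"
  shows "Cut x = (\<lambda>i. (take i x, drop i x)) ` {0..length x} \<union>
    (\<lambda>i. (take i x, drop (i - 1) x)) ` {1..length x}" (is "_ = ?P \<union> ?Q")
proof (intro equalityI subsetI)
  fix c assume "c \<in> Cut x"
  then obtain a b where c: "c = (a, b)" and ab: "distinct_adj a" "distinct_adj b"
    and x: "red (a @ b) = x"
    by (auto simp: Cut_def)
  show "c \<in> ?P \<union> ?Q"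
  proof (cases "distinct_adj (a @ b)")
    case True
    then have "x = a @ b" using x by (simp add: remdups_adj_id)
    then have "c = (take (length a) x, drop (length a) x)" "length a \<le> length x"
      by (simp_all add: c)
    then show ?thesis by auto
  next
    case False
    then have "a \<noteq> []" "b \<noteq> []" "last a = hd b"
      using ab by (auto simp: distinct_adj_append_iff)
    then obtain a' y b' where a: "a = a' @ [y]" and b: "b = y # b'"
      by (metis append_butlast_last_id list.collapse)
    have "distinct_adj (a @ b')"
      using ab unfolding a b by (auto simp: distinct_adj_append_iff distinct_adj_Cons)
    moreover have "red (a @ b) = red (a' @ red (y # y # b'))"
      by (simp add: a b remdups_adj_append_remdups_adj_right del: remdups_adj.simps)
    ultimately have "x = a @ b'"
      using x by (simp add: remdups_adj_append_remdups_adj_right a remdups_adj_id)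
    then have "c = (take (length a) x, drop (length a - 1) x)" "1 \<le> length a" "length a \<le> length x"
      by (simp_all add: c a b)
    then show ?thesis by auto
  qed
next
  fix c assume "c \<in> ?P \<union> ?Q"
  then consider i where "c = (take i x, drop i x)"
    | i where "i \<in> {1..length x}" "c = (take i x, drop (i - 1) x)"
    by auto
  then show "c \<in> Cut x"
  proof cases
    case 1
    then show ?thesis
      using assms by (simp add: Cut_def remdups_adj_id distinct_adj_take_drop)
  next
    case 2
    \<comment> \<open>\<open>y\<close> is the shared letter: at index \<open>i - 1\<close> it ends
      \<open>take i x\<close> and begins \<open>drop (i - 1) x\<close>.\<close>
    define a' y b' where "a' = take (i - 1) x" and "y = x ! (i - 1)" and "b' = drop i x"
    have x: "x = a' @ y # b'"
      using 2 id_take_nth_drop[of "i - 1" x] unfolding a'_def y_def b'_def by (cases i) auto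
    have len: "length a' = i - 1"
      using 2 by (auto simp: a'_def)
    have c: "c = (a' @ [y], y # b')"
      using 2 len by (auto simp: x take_Cons')
    have "red ((a' @ [y]) @ y # b') = red (a' @ red (y # y # b'))"
      by (simp add: remdups_adj_append_remdups_adj_right del: remdups_adj.simps)
    also have "\<dots> = x"
      using assms by (simp add: x remdups_adj_append_remdups_adj_right remdups_adj_id)
    finally show ?thesis
      using assms unfolding x c Cut_def by (auto simp: distinct_adj_append_iff)
  qed
qed

lemma finite_Cut: "distinct_adj x \<Longrightarrow> finite (Cut x)"
  by (simp add: Cut_eq)

lemma CutD:
  "(a, b) \<in> Cut x \<Longrightarrow> distinct_adj a" "(a, b) \<in> Cut x \<Longrightarrow> distinct_adj b"
  "(a, b) \<in> Cut x \<Longrightarrow> distinct_adj x" "(a, b) \<in> Cut x \<Longrightarrow> set x = set a \<union> set b"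
  "(a, b) \<in> Cut x \<Longrightarrow> length x \<le> length a + length b"
  using remdups_adj_length[of "a @ b"] by (auto simp: Cut_def)

text \<open>The two kinds of cuts are told apart by their total length, which is
  \<open>length x\<close> or one more; within a kind, the length of the first word determines
  \<open>i\<close>.\<close>

lemma sum_Cut:
  assumes "distinct_adj x"
  shows "(\<Sum>(a, b)\<in>Cut x. f a b) = (\<Sum>i = 0..length x. f (take i x) (drop i x)) +
    (\<Sum>i = 1..length x. f (take i x) (drop (i - 1) x) :: int)"
proof -
  let ?p = "\<lambda>i. (take i x, drop i x)" and ?q = "\<lambda>i. (take i x, drop (i - 1) x)"
  have inj: "inj_on ?p {0..length x}" "inj_on ?q {1..length x}"
    by (auto simp: inj_on_def dest!: arg_cong[of "take _ x" _ length])
  have "?p ` {0..length x} \<inter> ?q ` {1..length x} = {}"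
    by (auto dest!: arg_cong[of _ _ length])
  then have "(\<Sum>(a, b)\<in>Cut x. f a b) =
      (\<Sum>(a, b)\<in>?p ` {0..length x}. f a b) + (\<Sum>(a, b)\<in>?q ` {1..length x}. f a b)"
    unfolding Cut_eq[OF assms] by (intro sum.union_disjoint) auto
  then show ?thesis
    unfolding sum.reindex[OF inj(1)] sum.reindex[OF inj(2)] by (simp add: o_def)
qed

lemma Cut_map:
  assumes "distinct_adj x" "inj_on g (set x)"
  shows "Cut (map g x) = map_prod (map g) (map g) ` Cut x"
  using assms
  by (simp add: Cut_eq distinct_adj_map_iff image_Un image_image take_map drop_map)

definition cut_count :: "nat list \<Rightarrow> nat list \<Rightarrow> nat list \<Rightarrow> int" where
  "cut_count p q x = (\<Sum>(a, b)\<in>Cut x. of_bool (mstd a = p \<and> mstd b = q))"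

lemma cut_count_map:
  assumes "distinct_adj x" "strict_mono_on (set x) g"
  shows "cut_count p q (map g x) = cut_count p q x"
proof -
  have inj: "inj_on g (set x)"
    using assms(2) by (rule strict_mono_on_imp_inj_on)
  have inj': "inj_on (map_prod (map g) (map g)) (Cut x)"
  proof (rule inj_onI, clarify)
    fix a b a' b' assume *: "(a, b) \<in> Cut x" "(a', b') \<in> Cut x"
      "map_prod (map g) (map g) (a, b) = map_prod (map g) (map g) (a', b')"
    have "inj_on g (set a \<union> set a')" "inj_on g (set b \<union> set b')"
      using inj CutD(4)[OF *(1)] CutD(4)[OF *(2)] by (auto intro: inj_on_subset)
    with * show "a = a' \<and> b = b'"
      by (auto simp: inj_on_map_eq_map)
  qed
  have "mstd (map g a) = mstd a \<and> mstd (map g b) = mstd b" if "(a, b) \<in> Cut x" for a b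
    using CutD[OF that] assms(2) by (auto intro!: mstd_map intro: monotone_on_subset)
  then show ?thesis
    unfolding cut_count_def Cut_map[OF assms(1) inj] sum.reindex[OF inj']
    by (intro sum.cong) auto
qed

text \<open>Coproducts of a standardized factor may thus be counted on the factor itself, before its
  letters are renumbered.\<close>

lemma cut_count_mstd:
  assumes "distinct_adj x"
  shows "cut_count p q (mstd x) = cut_count p q x"
  unfolding mstd_eq[OF assms]
  using assms by (intro cut_count_map) (auto intro!: strict_mono_onI rank_strict_mono)

text \<open>Turns a sum over intermediate basis elements, weighted by how often each occurs as a
  standardization, into a sum over the underlying cuts.\<close>

lemma sum_fibres:
  fixes G :: "'b \<Rightarrow> int"
  assumes "finite C"
  shows "(\<Sum>y. (\<Sum>c\<in>C. of_bool (f c = y)) * G y) = (\<Sum>c\<in>C. G (f c))"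
proof -
  have "(\<Sum>y. (\<Sum>c\<in>C. of_bool (f c = y)) * G y) = (\<Sum>y\<in>f ` C. (\<Sum>c\<in>C. of_bool (f c = y)) * G y)"
  proof (rule Sum_any.expand_superset)
    show "{y. (\<Sum>c\<in>C. of_bool (f c = y)) * G y \<noteq> 0} \<subseteq> f ` C"
      by (auto elim!: sum.not_neutral_contains_not_neutral split: if_splits)
  qed (use assms in simp)
  also have "\<dots> = (\<Sum>y\<in>f ` C. \<Sum>c\<in>C. of_bool (f c = y) * G y)"
    by (simp add: sum_distrib_right)
  also have "\<dots> = (\<Sum>c\<in>C. \<Sum>y\<in>f ` C. of_bool (f c = y) * G y)"
    by (rule sum.swap)
  also have "\<dots> = (\<Sum>c\<in>C. G (f c))"
  proof (rule sum.cong)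
    fix c assume "c \<in> C"
    then show "(\<Sum>y\<in>f ` C. of_bool (f c = y) * G y) = G (f c)"
      using assms sum.remove[of "f ` C" "f c" "\<lambda>y. of_bool (f c = y) * G y"] by simp
  qed simp
  finally show ?thesis .
qed

text \<open>Both sides run over triples of reduced words with \<open>red (s @ t @ v) = x\<close>;
  the intermediate word \<open>u\<close> or \<open>w\<close> is determined by the triple.\<close>

lemma Cut_assoc:
  fixes F :: "nat list \<Rightarrow> nat list \<Rightarrow> nat list \<Rightarrow> int"
  assumes "distinct_adj x"
  shows "(\<Sum>(u, v)\<in>Cut x. \<Sum>(s, t)\<in>Cut u. F s t v) = (\<Sum>(s, w)\<in>Cut x. \<Sum>(t, v)\<in>Cut w. F s t v)"
proof -
  have fin: "finite (Cut x)" "\<forall>c\<in>Cut x. finite (Cut (fst c))" "\<forall>c\<in>Cut x. finite (Cut (snd c))"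
    using assms finite_Cut CutD(1,2) by auto
  have "(\<Sum>(u, v)\<in>Cut x. \<Sum>(s, t)\<in>Cut u. F s t v) =
      (\<Sum>((u, v), (s, t))\<in>(SIGMA c:Cut x. Cut (fst c)). F s t v)"
    unfolding split_def using sum.Sigma[OF fin(1,2), of "\<lambda>c d. F (fst d) (snd d) (snd c)"]
    by (simp add: split_def)
  also have "\<dots> = (\<Sum>((s, w), (t, v))\<in>(SIGMA c:Cut x. Cut (snd c)). F s t v)"
    by (rule sum.reindex_bij_witness[where
          i = "\<lambda>((s, w), (t, v)). ((red (s @ t), v), (s, t))" and
          j = "\<lambda>((u, v), (s, t)). ((s, red (t @ v)), (t, v))"])
      (auto simp: Cut_def remdups_adj_append_remdups_adj_left remdups_adj_append_remdups_adj_right)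
  also have "\<dots> = (\<Sum>(s, w)\<in>Cut x. \<Sum>(t, v)\<in>Cut w. F s t v)"
    unfolding split_def using sum.Sigma[OF fin(1,3), of "\<lambda>c d. F (fst c) (fst d) (snd d)"]
    by (simp add: split_def)
  finally show ?thesis .
qed


section \<open>Structure constants of mMR\<close>

text \<open>Membership of all three words makes the constants vanish off the basis. Shifting
  \<open>b\<close> upwards keeps truncated subtraction out of the condition.\<close>

definition mprod :: "nat list \<Rightarrow> nat list \<Rightarrow> nat list \<Rightarrow> bool" where
  "mprod a b x \<longleftrightarrow> a \<in> mperms_all \<and> b \<in> mperms_all \<and> x \<in> mperms_all \<and>
     red (filter (\<lambda>i. i \<le> card (set a)) x) = a \<and>
     red (filter (\<lambda>i. i > card (set a)) x) = map (\<lambda>i. i + card (set a)) b"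

definition mprod_const :: "nat list \<Rightarrow> nat list \<Rightarrow> nat list \<Rightarrow> int" where
  "mprod_const a b x = of_bool (mprod a b x)"

definition mcoprod_const :: "nat list \<Rightarrow> nat list \<Rightarrow> nat list \<Rightarrow> int" where
  "mcoprod_const p q x = (if x \<in> mperms_all then cut_count p q x else 0)"

lemma mprod_supp:
  assumes "mprod a b x"
  shows "a \<in> mperms_all" "b \<in> mperms_all" "x \<in> mperms_all"
  using assms by (simp_all add: mprod_def)

lemma set_merge:
  assumes "a \<in> mperms_all" "b \<in> mperms_all" "n = card (set a)"
    and "red (filter (\<lambda>i. i \<le> n) x) = a"
    and "red (filter (\<lambda>i. i > n) x) = map (\<lambda>i. i + n) b"
  shows "set x = {1..n + card (set b)}"
proof -
  have "set x = set (red (filter (\<lambda>i. i \<le> n) x)) \<union> set (red (filter (\<lambda>i. i > n) x))"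
    by auto
  also have "\<dots> = set a \<union> (\<lambda>i. i + n) ` set b"
    using assms by simp
  also have "\<dots> = {1..n} \<union> (\<lambda>i. i + n) ` {1..card (set b)}"
    using assms unfolding mperms_all_iff by metis
  also have "\<dots> = {1..n + card (set b)}"
    by (auto simp: image_iff intro!: bexI[of _ "_ - n"])
  finally show ?thesis .
qed

lemma mprod_card: "mprod a b x \<Longrightarrow> card (set x) = card (set a) + card (set b)"
  unfolding mprod_def using set_merge[of a b "card (set a)" x]
  by (metis card_atLeastAtMost diff_Suc_1)

lemma mprodI:
  assumes "a \<in> mperms_all" "b \<in> mperms_all" "distinct_adj x" "n = card (set a)"
    and "red (filter (\<lambda>i. i \<le> n) x) = a"
    and "red (filter (\<lambda>i. i > n) x) = map (\<lambda>i. i + n) b"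
  shows "mprod a b x"
proof -
  have "x \<in> mperms_all"
    using set_merge[OF assms(1,2,4,5,6)] assms(3) by (auto simp: mperms_all_def mperms_def)
  then show ?thesis
    using assms by (simp add: mprod_def)
qed

section \<open>Supports and finiteness of the structure constants\<close>

lemma cut_count_nonzero:
  assumes "cut_count p q x \<noteq> 0"
  obtains a b where "(a, b) \<in> Cut x" "mstd a = p" "mstd b = q"
  using assms unfolding cut_count_def
  by (auto elim!: sum.not_neutral_contains_not_neutral split: if_splits)

lemma mcoprod_const_supp:
  assumes "mcoprod_const p q x \<noteq> 0"
  shows "p \<in> mperms_all" "q \<in> mperms_all" "x \<in> mperms_all" "length x \<le> length p + length q"
proof -
  from assms show x: "x \<in> mperms_all"
    by (auto simp: mcoprod_const_def split: if_splits)
  with assms obtain a b where "(a, b) \<in> Cut x" "mstd a = p" "mstd b = q"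
    by (auto simp: mcoprod_const_def elim: cut_count_nonzero)
  then show "p \<in> mperms_all" "q \<in> mperms_all" "length x \<le> length p + length q"
    using CutD[of a b x] mstd_in length_mstd by auto
qed

text \<open>The letters form an initial interval, so a bound on the length also bounds the
  letters.\<close>

lemma finite_mperms_all_length: "finite {x \<in> mperms_all. length x \<le> n}"
proof (rule finite_subset)
  show "{x \<in> mperms_all. length x \<le> n} \<subseteq> {x. set x \<subseteq> {1..n} \<and> length x \<le> n}"
  proof
    fix x :: "nat list" assume "x \<in> {x \<in> mperms_all. length x \<le> n}"
    then have x: "x \<in> mperms_all" "length x \<le> n" by auto
    then have "set x = {1..card (set x)}" "card (set x) \<le> n"
      using card_length[of x] unfolding mperms_all_iff by (blast, linarith)
    moreover from this(2) have "{1..card (set x)} \<subseteq> {1..n}"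
      by simp
    ultimately have "set x \<subseteq> {1..n}"
      by metis
    with x show "x \<in> {x. set x \<subseteq> {1..n} \<and> length x \<le> n}" by simp
  qed
  show "finite {x. set x \<subseteq> {1..n} \<and> length x \<le> n}"
    by (rule finite_lists_length_le) simp
qed

lemma finite_mcoprod_const: "finite {x. mcoprod_const p q x \<noteq> 0}"
  by (rule finite_subset[OF _ finite_mperms_all_length[of "length p + length q"]])
    (auto dest: mcoprod_const_supp)

lemma mprod_length:
  assumes "mprod a b x"
  shows "length a \<le> length x" "length b \<le> length x"
proof -
  let ?n = "card (set a)"
  have "length (red (filter P x)) \<le> length x" for P
    using remdups_adj_length[of "filter P x"] length_filter_le[of P x] by linarith
  from this[of "\<lambda>i. i \<le> ?n"] this[of "\<lambda>i. i > ?n"]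
  show "length a \<le> length x" "length b \<le> length x"
    using assms unfolding mprod_def by simp_all
qed

text \<open>Reduced restrictions are never longer than the word itself. The other direction fails:
  two nonempty factors admit products of every larger length, with letters alternating between the
  two ranges.\<close>

lemma finite_mprod_const: "finite {(a, b). mprod_const a b x \<noteq> 0}"
  by (rule finite_subset[OF _ finite_cartesian_product[OF
          finite_mperms_all_length[of "length x"] finite_mperms_all_length[of "length x"]]])
    (auto simp: mprod_const_def intro: mprod_supp mprod_length)

lemma mcoprod_const_mstd:
  "distinct_adj x \<Longrightarrow> mcoprod_const p q (mstd x) = cut_count p q x"
  by (simp add: mcoprod_const_def mstd_in cut_count_mstd)

text \<open>Summing over \<open>y\<close> removes the intermediate standardization by
  \<open>sum_fibres\<close> and \<open>mcoprod_const_mstd\<close>. What remains are triples of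
  words, compared by \<open>Cut_assoc\<close>.\<close>

lemma mcoprod_const_assoc:
  "(\<Sum>y. mcoprod_const a b y * mcoprod_const y c x) = (\<Sum>y. mcoprod_const b c y * mcoprod_const a y x)"
proof (cases "x \<in> mperms_all")
  case True
  then have x: "distinct_adj x" by (simp add: mperms_all_iff)
  note fin = finite_Cut[OF x]
  let ?C = "{t \<in> Cut x. mstd (snd t) = c}" and ?C' = "{t \<in> Cut x. mstd (fst t) = a}"
  have left: "mcoprod_const y c x = (\<Sum>t\<in>?C. of_bool (mstd (fst t) = y))" for y
    unfolding mcoprod_const_def cut_count_def sum.inter_filter[OF fin] using True
    by (auto intro!: sum.cong)
  have right: "mcoprod_const a y x = (\<Sum>t\<in>?C'. of_bool (mstd (snd t) = y))" for y
    unfolding mcoprod_const_def cut_count_def sum.inter_filter[OF fin] using True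
    by (auto intro!: sum.cong)
  have "(\<Sum>y. mcoprod_const a b y * mcoprod_const y c x) =
      (\<Sum>y. (\<Sum>t\<in>?C. of_bool (mstd (fst t) = y)) * mcoprod_const a b y)"
    by (simp add: left mult.commute)
  also have "\<dots> = (\<Sum>t\<in>?C. mcoprod_const a b (mstd (fst t)))"
    by (rule sum_fibres) (use fin in simp)
  also have "\<dots> = (\<Sum>(u, v)\<in>Cut x. \<Sum>(s, t)\<in>Cut u. of_bool (mstd s = a \<and> mstd t = b \<and> mstd v = c))"
    unfolding sum.inter_filter[OF fin]
    by (rule sum.cong) (auto simp: mcoprod_const_mstd CutD(1) cut_count_def)
  also have "\<dots> = (\<Sum>(s, w)\<in>Cut x. \<Sum>(t, v)\<in>Cut w. of_bool (mstd s = a \<and> mstd t = b \<and> mstd v = c))"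
    by (rule Cut_assoc[OF x])
  also have "\<dots> = (\<Sum>t\<in>?C'. mcoprod_const b c (mstd (snd t)))"
    unfolding sum.inter_filter[OF fin]
    by (rule sum.cong) (auto simp: mcoprod_const_mstd CutD(2) cut_count_def)
  also have "\<dots> = (\<Sum>y. (\<Sum>t\<in>?C'. of_bool (mstd (snd t) = y)) * mcoprod_const b c y)"
    by (rule sum_fibres[symmetric]) (use fin in simp)
  also have "\<dots> = (\<Sum>y. mcoprod_const b c y * mcoprod_const a y x)"
    by (simp add: right mult.commute)
  finally show ?thesis .
qed (simp add: mcoprod_const_def)

section \<open>Restriction to small and to large letters\<close>

definition low :: "nat \<Rightarrow> nat list \<Rightarrow> nat list" where
  "low n u = red (filter (\<lambda>i. i \<le> n) u)"

text \<open>The subtraction is exact, as only letters above \<open>n\<close> remain. Identities for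
  \<open>high\<close> are proved after adding \<open>n\<close> back, where it is a plain
  restriction.\<close>

definition high :: "nat \<Rightarrow> nat list \<Rightarrow> nat list" where
  "high n u = map (\<lambda>i. i - n) (red (filter (\<lambda>i. i > n) u))"

lemma map_add_high: "map (\<lambda>i. i + n) (high n u) = red (filter (\<lambda>i. i > n) u)"
  by (auto simp: high_def intro!: map_idI)

lemma distinct_adj_low_high: "distinct_adj (low n u)" "distinct_adj (high n u)"
  using distinct_adj_mapD[of "\<lambda>i. i + n" "high n u"] by (simp_all add: low_def map_add_high)

lemma map_add_inject: "map (\<lambda>i. i + n) u = map (\<lambda>i. i + (n :: nat)) v \<longleftrightarrow> u = v"
  by (simp add: inj_map_eq_map)

lemma low_append: "low n (red (u @ v)) = red (low n u @ low n v)"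
  by (simp add: low_def remdups_adj_filter_remdups_adj remdups_adj_append_remdups_adj_left
      remdups_adj_append_remdups_adj_right)

lemma high_append: "high n (red (u @ v)) = red (high n u @ high n v)"
proof -
  have "map (\<lambda>i. i + n) (red (high n u @ high n v)) =
      red (map (\<lambda>i. i + n) (high n u) @ map (\<lambda>i. i + n) (high n v))"
    by (simp add: remdups_adj_map[symmetric])
  also have "\<dots> = map (\<lambda>i. i + n) (high n (red (u @ v)))"
    by (simp add: map_add_high remdups_adj_filter_remdups_adj remdups_adj_append_remdups_adj_left
        remdups_adj_append_remdups_adj_right)
  finally show ?thesis by (simp only: map_add_inject)
qed

lemma set_low: "set (low n u) = {i \<in> set u. i \<le> n}"
  by (auto simp: low_def)

lemma set_high: "(\<lambda>i. i + n) ` set (high n u) = {i \<in> set u. n < i}"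
  using arg_cong[OF map_add_high[of n u], of set] by simp

lemma set_low_high: "set u = set (low n u) \<union> (\<lambda>i. i + n) ` set (high n u)"
  by (auto simp: set_low set_high)

lemma mprod_iff:
  "mprod a b x \<longleftrightarrow> a \<in> mperms_all \<and> b \<in> mperms_all \<and> distinct_adj x \<and>
     low (card (set a)) x = a \<and> high (card (set a)) x = b"
  using mprodI[of a b x "card (set a)"] map_add_high[of "card (set a)" x]
    map_add_inject[of "card (set a)" "high (card (set a)) x" b]
  unfolding low_def mprod_def mperms_all_iff[of x] by auto

lemma map_add_filter_high:
  "map (\<lambda>i. i + n) (red (filter (\<lambda>i. P (i + n)) (high n x))) =
   red (filter (\<lambda>i. n < i \<and> P i) x)"
proof -
  have "map (\<lambda>i. i + n) (red (filter (\<lambda>i. P (i + n)) (high n x))) =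
      red (filter P (map (\<lambda>i. i + n) (high n x)))"
    by (simp add: filter_map o_def remdups_adj_map)
  then show ?thesis
    by (simp add: map_add_high remdups_adj_filter_remdups_adj conj_commute)
qed

lemma low_low: "low n (low (n + m) x) = low n x"
proof -
  have "filter (\<lambda>i. i \<le> n + m \<and> i \<le> n) x = filter (\<lambda>i. i \<le> n) x"
    by (rule filter_cong) auto
  then show ?thesis
    by (simp add: low_def remdups_adj_filter_remdups_adj conj_commute)
qed

lemma high_low: "high n (low (n + m) x) = low m (high n x)"
proof -
  have "map (\<lambda>i. i + n) (high n (low (n + m) x)) = red (filter (\<lambda>i. n < i \<and> i \<le> n + m) x)"
    by (simp add: map_add_high low_def remdups_adj_filter_remdups_adj conj_commute)
  also have "\<dots> = map (\<lambda>i. i + n) (low m (high n x))"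
    using map_add_filter_high[of n "\<lambda>i. i \<le> n + m" x] by (simp add: low_def add.commute[of n])
  finally show ?thesis by (simp only: map_add_inject)
qed

lemma high_high: "high m (high n x) = high (n + m) x"
proof -
  have "map (\<lambda>i. i + n) (map (\<lambda>i. i + m) (high m (high n x))) =
      red (filter (\<lambda>i. n < i \<and> n + m < i) x)"
    using map_add_filter_high[of n "\<lambda>i. n + m < i" x] by (simp only: map_add_high) (simp add: add.commute[of n])
  also have "filter (\<lambda>i. n < i \<and> n + m < i) x = filter (\<lambda>i. n + m < i) x"
    by (rule filter_cong) auto
  also have "red \<dots> = map (\<lambda>i. i + (n + m)) (high (n + m) x)"
    by (simp only: map_add_high)
  also have "\<dots> = map (\<lambda>i. i + n) (map (\<lambda>i. i + m) (high (n + m) x))"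
    by (simp add: algebra_simps)
  finally show ?thesis by (simp only: map_add_inject)
qed

text \<open>Both sides say that the letters of \<open>x\<close> split into three consecutive ranges
  with restrictions \<open>a\<close>, \<open>b\<close>, \<open>c\<close>. The word \<open>y\<close>
  is forced: it is the restriction to the lower two or to the upper two ranges.\<close>

lemma mprod_assoc:
  "(\<exists>y. mprod a b y \<and> mprod y c x) \<longleftrightarrow> (\<exists>y. mprod b c y \<and> mprod a y x)"
proof -
  let ?n = "card (set a)" and ?m = "card (set b)"
  let ?T = "a \<in> mperms_all \<and> b \<in> mperms_all \<and> c \<in> mperms_all \<and> distinct_adj x \<and>
    low ?n x = a \<and> low ?m (high ?n x) = b \<and> high (?n + ?m) x = c"
  have "mprod a b y \<and> mprod y c x \<longleftrightarrow> ?T \<and> y = low (?n + ?m) x" for y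
  proof
    assume y: "mprod a b y \<and> mprod y c x"
    then have "card (set y) = ?n + ?m" by (simp add: mprod_card)
    with y have y_eq: "y = low (?n + ?m) x" and c: "high (?n + ?m) x = c"
      by (simp_all add: mprod_iff)
    have "low ?n y = low ?n x" "high ?n y = low ?m (high ?n x)"
      unfolding y_eq by (rule low_low, rule high_low)
    with y y_eq c show "?T \<and> y = low (?n + ?m) x"
      unfolding mprod_iff by metis
  next
    assume T: "?T \<and> y = low (?n + ?m) x"
    then have "mprod a b y"
      by (simp add: mprod_iff low_low high_low distinct_adj_low_high)
    moreover from this have "mprod y c x"
      using T mprod_card[of a b y] mprod_supp(3)[of a b y] by (simp add: mprod_iff)
    ultimately show "mprod a b y \<and> mprod y c x" ..
  qed
  moreover have "mprod b c y \<and> mprod a y x \<longleftrightarrow> ?T \<and> y = high ?n x" for y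
  proof
    assume "?T \<and> y = high ?n x"
    moreover from this have "mprod b c y"
      by (simp add: mprod_iff high_high distinct_adj_low_high)
    ultimately show "mprod b c y \<and> mprod a y x"
      using mprod_supp(3)[of b c y] by (simp add: mprod_iff)
  qed (auto simp: mprod_iff high_high)
  ultimately show ?thesis by simp
qed

lemma mprod_unique_left: "mprod a b y \<Longrightarrow> mprod y c x \<Longrightarrow>
    y = red (filter (\<lambda>i. i \<le> card (set a) + card (set b)) x)"
  using mprod_card[of a b y] by (simp add: mprod_def)

lemma mprod_unique_right: "mprod a y x \<Longrightarrow> mprod a y' x \<Longrightarrow> y = y'"
  by (simp add: mprod_def inj_map_eq_map)

lemma Sum_any_of_bool_unique:
  assumes "\<And>y y'. P y \<Longrightarrow> P y' \<Longrightarrow> y = y'"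
  shows "(\<Sum>y. of_bool (P y) :: int) = of_bool (\<exists>y. P y)"
proof (cases "\<exists>y. P y")
  case True
  then obtain z where z: "P z" by blast
  have "(\<Sum>y. of_bool (P y) :: int) = (\<Sum>y. if y = z then 1 else 0)"
    using assms z by (intro Sum_any.cong) auto
  then show ?thesis using True by (simp only: Sum_any.delta) simp
qed simp

text \<open>Since \<open>y\<close> is determined by the other words, each sum has at most one
  nonzero term and merely records existence.\<close>

lemma mprod_const_assoc:
  "(\<Sum>y. mprod_const a b y * mprod_const y c x) = (\<Sum>y. mprod_const b c y * mprod_const a y x)"
proof -
  have "(\<Sum>y. mprod_const a b y * mprod_const y c x) = (\<Sum>y. of_bool (mprod a b y \<and> mprod y c x))"
    by (simp add: mprod_const_def of_bool_conj)
  also have "\<dots> = of_bool (\<exists>y. mprod a b y \<and> mprod y c x)"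
    by (rule Sum_any_of_bool_unique) (metis mprod_unique_left)
  also have "\<dots> = of_bool (\<exists>y. mprod b c y \<and> mprod a y x)"
    by (simp only: mprod_assoc)
  also have "\<dots> = (\<Sum>y. of_bool (mprod b c y \<and> mprod a y x))"
    by (rule Sum_any_of_bool_unique[symmetric]) (metis mprod_unique_right)
  finally show ?thesis
    by (simp add: mprod_const_def of_bool_conj)
qed

text \<open>Standardization moves the threshold \<open>n\<close> to \<open>?k\<close>, the number of
  letters of \<open>u\<close> up to \<open>n\<close>. Low letters keep their rank among themselves,
  and high letters have their own rank raised by \<open>?k\<close>.\<close>

lemma mprod_mstd:
  assumes u: "distinct_adj u"
  shows "mprod (mstd (low n u)) (mstd (high n u)) (mstd u)"
proof -
  let ?U = "set u" and ?k = "card (set (low n u))"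
  have k: "rank ?U n = ?k"
    by (simp add: rank_def set_low)
  have less: "?k < rank ?U x \<longleftrightarrow> n < x" if "x \<in> ?U" for x
    using rank_less_iff[of ?U x n] that by (simp add: k)
  have inj: "inj_on (rank ?U) X" if "X \<subseteq> ?U" for X
    using inj_on_rank[of ?U] that by (auto intro: inj_on_subset)
  have "red (filter (\<lambda>i. i \<le> ?k) (mstd u)) = map (rank ?U) (low n u)"
  proof -
    have "filter (\<lambda>i. i \<le> ?k) (mstd u) = map (rank ?U) (filter (\<lambda>i. i \<le> n) u)"
      using less unfolding mstd_eq[OF u] filter_map o_def
      by (intro arg_cong[of _ _ "map _"] filter_cong) (auto simp: not_less[symmetric])
    then show ?thesis by (simp add: remdups_adj_map inj low_def)
  qed
  also have "\<dots> = mstd (low n u)"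
    unfolding mstd_eq[OF distinct_adj_low_high(1)]
  proof (rule map_cong)
    fix x assume "x \<in> set (low n u)"
    then have "{b \<in> ?U. b \<le> x} = {b \<in> set (low n u). b \<le> x}"
      by (auto simp: set_low)
    then show "rank ?U x = rank (set (low n u)) x"
      by (simp add: rank_def)
  qed simp
  finally have 1: "red (filter (\<lambda>i. i \<le> ?k) (mstd u)) = mstd (low n u)" .
  have "red (filter (\<lambda>i. i > ?k) (mstd u)) = map (rank ?U) (map (\<lambda>i. i + n) (high n u))"
  proof -
    have "filter (\<lambda>i. i > ?k) (mstd u) = map (rank ?U) (filter (\<lambda>i. i > n) u)"
      using less unfolding mstd_eq[OF u] filter_map o_def
      by (intro arg_cong[of _ _ "map _"] filter_cong) auto
    then show ?thesis by (simp add: remdups_adj_map inj map_add_high)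
  qed
  also have "\<dots> = map (\<lambda>i. i + ?k) (mstd (high n u))"
    unfolding mstd_eq[OF distinct_adj_low_high(2)] map_map
  proof (rule map_cong)
    fix i assume i: "i \<in> set (high n u)"
    have "{b \<in> ?U. b \<le> i + n} = {b \<in> ?U. b \<le> n} \<union> {b \<in> {b \<in> ?U. n < b}. b \<le> i + n}"
      by auto
    also have "{b \<in> {b \<in> ?U. n < b}. b \<le> i + n} = (\<lambda>j. j + n) ` {j \<in> set (high n u). j \<le> i}"
      unfolding set_high[symmetric] by auto
    finally have "{b \<in> ?U. b \<le> i + n} =
        {b \<in> ?U. b \<le> n} \<union> (\<lambda>j. j + n) ` {j \<in> set (high n u). j \<le> i}" .
    moreover have "(\<lambda>j. j + n) ` {j \<in> set (high n u). j \<le> i} \<subseteq> {b \<in> ?U. n < b}"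
      unfolding set_high[symmetric] by auto
    then have "{b \<in> ?U. b \<le> n} \<inter> (\<lambda>j. j + n) ` {j \<in> set (high n u). j \<le> i} = {}"
      by fastforce
    ultimately have "rank ?U (i + n) = rank ?U n + rank (set (high n u)) i"
      by (simp add: rank_def card_Un_disjoint card_image)
    then show "(rank ?U \<circ> (\<lambda>i. i + n)) i = ((\<lambda>i. i + ?k) \<circ> rank (set (high n u))) i"
      by (simp add: k)
  qed simp
  finally have 2: "red (filter (\<lambda>i. i > ?k) (mstd u)) = map (\<lambda>i. i + ?k) (mstd (high n u))" .
  show ?thesis
    by (rule mprodI[OF _ _ _ _ 1 2])
      (auto simp: mstd_in distinct_adj_low_high card_set_mstd mstd_in[OF u, unfolded mperms_all_iff])
qed

text \<open>The two restrictions determine the set of letters, and over a fixed set of letters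
  \<open>mstd\<close> determines the word.\<close>

lemma merge_unique:
  assumes "distinct_adj u" "distinct_adj v" "mstd u = mstd v" "low n u = low n v" "high n u = high n v"
  shows "u = v"
  using assms(1,2) _ assms(3)
  by (rule mstd_inject) (simp only: set_low_high[of u n] set_low_high[of v n] assms(4,5))

text \<open>The letter set of \<open>u\<close> must be \<open>?U\<close>; its two parts are
  separated by \<open>n\<close> because letters of \<open>t\<close> are positive. The size fits
  \<open>p\<close>, so a word with pattern \<open>p\<close> exists over \<open>?U\<close>, and its
  restrictions are identified by their letter sets and standardizations.\<close>

lemma ex_merge:
  assumes s: "distinct_adj s" "set s \<subseteq> {..n}" and t: "distinct_adj t" "0 \<notin> set t"
    and p: "mprod (mstd s) (mstd t) p"
  obtains u where "distinct_adj u" "mstd u = p" "low n u = s" "high n u = t"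
proof -
  let ?U = "set s \<union> (\<lambda>i. i + n) ` set t"
  have t_pos: "0 < i" if "i \<in> set t" for i
    using that t(2) by (metis neq0_conv)
  have disj: "set s \<inter> (\<lambda>i. i + n) ` set t = {}"
    using s(2) t_pos by fastforce
  have "card ?U = card (set s) + card (set t)"
    using disj by (simp add: card_Un_disjoint card_image)
  also have "\<dots> = card (set p)"
    using mprod_card[OF p] s t by (simp add: card_set_mstd)
  finally obtain u where u: "distinct_adj u" "set u = ?U" "mstd u = p"
    using ex_mstd[of p ?U] mprod_supp(3)[OF p] by auto
  have s_le: "i \<le> n" if "i \<in> set s" for i
    using that s(2) by auto
  have low_set: "set (low n u) = set s"
    using s_le t_pos by (fastforce simp: set_low u)
  have "(\<lambda>i. i + n) ` set (high n u) = (\<lambda>i. i + n) ` set t"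
    unfolding set_high u(2) using s_le t_pos by (fastforce simp: not_less[symmetric])
  then have high_set: "set (high n u) = set t"
    by (simp add: inj_image_eq_iff)
  have p': "mprod (mstd (low n u)) (mstd (high n u)) p"
    using mprod_mstd[OF u(1), of n] u by simp
  have card: "card (set (mstd (low n u))) = card (set (mstd s))"
    using s by (simp add: card_set_mstd distinct_adj_low_high low_set)
  \<comment> \<open>Once the number of low letters is known, \<open>mprod_iff\<close> recovers both
    factors from \<open>p\<close>.\<close>
  have "mstd (low n u) = mstd s" "mstd (high n u) = mstd t"
    using p p' unfolding mprod_iff card by auto
  then have "low n u = s" "high n u = t"
    using s t distinct_adj_low_high low_set high_set by (auto intro!: mstd_inject)
  with u that show ?thesis by blast
qed

lemma cut_count_card:
  assumes "distinct_adj x"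
  shows "cut_count p q x = int (card {(u, v) \<in> Cut x. mstd u = p \<and> mstd v = q})"
proof -
  have "{(u, v) \<in> Cut x. mstd u = p \<and> mstd v = q} = {c \<in> Cut x. mstd (fst c) = p \<and> mstd (snd c) = q}"
    by auto
  then show ?thesis
    using finite_Cut[OF assms] by (simp add: cut_count_def split_def Int_def)
qed

text \<open>Both sides are cardinalities: the left counts cuts of words in the product of
  \<open>a\<close> and \<open>b\<close>, the right counts pairs of a cut of \<open>a\<close> and a
  cut of \<open>b\<close>. Splitting at the largest letter of \<open>a\<close> is a bijection
  between them.\<close>

lemma mprod_mcoprod_compat:
  "(\<Sum>x. mprod_const a b x * mcoprod_const p q x) =
   (\<Sum>((a1, a2), (b1, b2)). mcoprod_const a1 a2 a * mcoprod_const b1 b2 b *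
      mprod_const a1 b1 p * mprod_const a2 b2 q)"
  (is "_ = Sum_any ?F")
proof (cases "a \<in> mperms_all \<and> b \<in> mperms_all")
  case False
  then have *: "?F = (\<lambda>_. 0)"
    "(\<lambda>x. mprod_const a b x * mcoprod_const p q x) = (\<lambda>_. 0)"
    by (auto simp: fun_eq_iff mcoprod_const_def mprod_const_def dest: mprod_supp)
  show ?thesis unfolding * by simp
next
  case True
  then have adj: "distinct_adj a" "distinct_adj b" and pos: "0 \<notin> set b"
    and set_a: "set a = {1..card (set a)}"
    unfolding mperms_all_iff by (simp_all, metis atLeastAtMost_iff not_one_le_zero)
  define n where "n = card (set a)"
  \<comment> \<open>The words \<open>u\<close> and \<open>v\<close> are kept with their original
    letters; \<open>p\<close> and \<open>q\<close> alone would not show where to split.\<close>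
  define L where "L = {(u, v). distinct_adj u \<and> distinct_adj v \<and> mstd u = p \<and> mstd v = q \<and>
    mprod a b (red (u @ v))}"
  define R where "R = {((s, t), (s', t')) \<in> Cut a \<times> Cut b.
    mprod (mstd s) (mstd s') p \<and> mprod (mstd t) (mstd t') q}"
  define X where "X = {x. mprod a b x \<and> mcoprod_const p q x \<noteq> 0}"
  let ?G = "\<lambda>((a1, a2), (b1, b2)). mprod_const a1 b1 p * mprod_const a2 b2 q"
  let ?st = "map_prod (map_prod mstd mstd) (map_prod mstd mstd)"
  let ?C = "\<lambda>x. {(u, v) \<in> Cut x. mstd u = p \<and> mstd v = q}"
  have X_adj: "distinct_adj x" if "x \<in> X" for x
    using that by (simp add: X_def mprod_iff)
  have fin_X: "finite X"
    unfolding X_def by (rule finite_subset[OF _ finite_mcoprod_const[of p q]]) auto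
  have fin_C: "finite (?C x)" if "distinct_adj x" for x
    using finite_Cut[OF that] by (rule rev_finite_subset) auto
  have L_eq: "L = (\<Union>x\<in>X. ?C x)"
  proof (intro equalityI subsetI)
    fix c assume "c \<in> L"
    then obtain u v where c: "c = (u, v)" and uv: "distinct_adj u" "distinct_adj v"
      "mstd u = p" "mstd v = q" "mprod a b (red (u @ v))"
      by (auto simp: L_def)
    let ?x = "red (u @ v)"
    have "(u, v) \<in> ?C ?x" using uv by (auto simp: Cut_def)
    moreover from this have "cut_count p q ?x \<noteq> 0"
      using fin_C[of ?x] by (auto simp: cut_count_card card_gt_0_iff)
    then have "?x \<in> X"
      using uv by (simp add: X_def mcoprod_const_def mprod_supp)
    ultimately show "c \<in> (\<Union>x\<in>X. ?C x)" unfolding c by blast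
  qed (auto simp: L_def X_def Cut_def)
  have "(\<Sum>x. mprod_const a b x * mcoprod_const p q x) = (\<Sum>x\<in>X. mprod_const a b x * mcoprod_const p q x)"
    by (rule Sum_any.expand_superset[OF fin_X]) (auto simp: X_def mprod_const_def)
  also have "\<dots> = (\<Sum>x\<in>X. int (card (?C x)))"
    by (rule sum.cong)
      (auto simp: X_def mprod_const_def mcoprod_const_def cut_count_card mprod_iff split: if_splits)
  also have "\<dots> = int (card L)"
    unfolding L_eq
    by (subst card_UN_disjoint) (use fin_X fin_C X_adj in \<open>auto simp: Cut_def\<close>)
  also have "card L = card R"
  proof (rule bij_betw_same_card, rule bij_betw_imageI)
    \<comment> \<open>The middle swap of compatibility appears here: the four restrictions are
      grouped by letter range instead of by side of the cut.\<close>
    let ?\<phi> = "\<lambda>(u, v). ((low n u, low n v), (high n u, high n v))"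
    show "inj_on ?\<phi> L"
    proof (rule inj_onI, clarify)
      fix u v u' v'
      assume "(u, v) \<in> L" "(u', v') \<in> L" "low n u = low n u'" "low n v = low n v'"
        "high n u = high n u'" "high n v = high n v'"
      then show "u = u' \<and> v = v'"
        using merge_unique[of u u' n] merge_unique[of v v' n] by (simp add: L_def)
    qed
    show "?\<phi> ` L = R"
    proof (intro equalityI subsetI)
      fix r assume "r \<in> ?\<phi> ` L"
      then obtain u v where "r = ?\<phi> (u, v)" "(u, v) \<in> L" by auto
      then show "r \<in> R"
        using mprod_mstd[of u n] mprod_mstd[of v n]
        by (auto simp: L_def R_def Cut_def distinct_adj_low_high mprod_iff[of a b] low_append high_append
            n_def)
    next
      fix r assume "r \<in> R"
      then obtain s t s' t' where r: "r = ((s, t), (s', t'))"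
        and st: "(s, t) \<in> Cut a" "(s', t') \<in> Cut b"
        and m: "mprod (mstd s) (mstd s') p" "mprod (mstd t) (mstd t') q"
        by (auto simp: R_def)
      have sets: "set s \<subseteq> {..n}" "set t \<subseteq> {..n}" "0 \<notin> set s'" "0 \<notin> set t'"
        using CutD(4)[OF st(1)] CutD(4)[OF st(2)] set_a pos unfolding n_def by auto
      \<comment> \<open>Each side of the cut is rebuilt on its own; \<open>low_append\<close> and
        \<open>high_append\<close> then show that the joined word lies in the product of
        \<open>a\<close> and \<open>b\<close>.\<close>
      obtain u where u: "distinct_adj u" "mstd u = p" "low n u = s" "high n u = s'"
        using ex_merge[OF CutD(1)[OF st(1)] sets(1) CutD(1)[OF st(2)] sets(3) m(1)] .
      obtain v where v: "distinct_adj v" "mstd v = q" "low n v = t" "high n v = t'"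
        using ex_merge[OF CutD(2)[OF st(1)] sets(2) CutD(2)[OF st(2)] sets(4) m(2)] .
      have "(u, v) \<in> L"
        using u v st True
        by (auto simp: L_def mprod_iff[of a b] low_append high_append n_def[symmetric] Cut_def)
      then show "r \<in> ?\<phi> ` L"
        using u v by (auto simp: r image_iff intro!: bexI[of _ "(u, v)"])
    qed
  qed
  also have "int (card R) = (\<Sum>c\<in>Cut a \<times> Cut b. ?G (?st c))"
  proof -
    let ?Q = "\<lambda>((s, t), (s', t')). mprod (mstd s) (mstd s') p \<and> mprod (mstd t) (mstd t') q"
    have "R = {c \<in> Cut a \<times> Cut b. ?Q c}"
      by (auto simp: R_def)
    then have "int (card R) = (\<Sum>c\<in>Cut a \<times> Cut b. of_bool (?Q c))"
      using finite_Cut adj by (simp add: Int_def)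
    also have "\<dots> = (\<Sum>c\<in>Cut a \<times> Cut b. ?G (?st c))"
      by (rule sum.cong) (auto simp: mprod_const_def)
    finally show ?thesis .
  qed
  \<comment> \<open>Grouping the pairs of cuts by the standardizations of their four words produces
    the coproduct coefficients.\<close>
  also have "\<dots> = (\<Sum>y. (\<Sum>c\<in>Cut a \<times> Cut b. of_bool (?st c = y)) * ?G y)"
    by (rule sum_fibres[symmetric]) (use finite_Cut adj in simp)
  also have "\<dots> = (\<Sum>y. ?F y)"
  proof (rule Sum_any.cong)
    fix y :: "(nat list \<times> nat list) \<times> (nat list \<times> nat list)"
    obtain a1 a2 b1 b2 where y: "y = ((a1, a2), (b1, b2))" by (metis surj_pair)
    have "(\<Sum>c\<in>Cut a \<times> Cut b. of_bool (?st c = y)) =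
        (\<Sum>c\<in>Cut a. \<Sum>c'\<in>Cut b. of_bool (mstd (fst c) = a1 \<and> mstd (snd c) = a2) *
           of_bool (mstd (fst c') = b1 \<and> mstd (snd c') = b2) :: int)"
      unfolding sum.cartesian_product by (rule sum.cong) (auto simp: y)
    also have "\<dots> = cut_count a1 a2 a * cut_count b1 b2 b"
      by (simp only: cut_count_def sum_product split_def)
    finally show "(\<Sum>c\<in>Cut a \<times> Cut b. of_bool (?st c = y)) * ?G y = ?F y"
      using True by (simp add: y mcoprod_const_def)
  qed
  finally show ?thesis .
qed

section \<open>Units and counits\<close>

lemma Nil_mperms_all: "[] \<in> mperms_all"
  by (simp add: mperms_all_iff)

lemma mprod_Nil:
  "mprod [] a x \<longleftrightarrow> a \<in> mperms_all \<and> x = a" "mprod a [] x \<longleftrightarrow> a \<in> mperms_all \<and> x = a"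
  "mprod a b [] \<longleftrightarrow> a = [] \<and> b = []"
proof -
  have id: "filter ((<) 0) w = w" "filter (\<lambda>i. i \<le> 0) w = []" "red w = w"
    if "w \<in> mperms_all" for w
  proof -
    have "0 < i" if "i \<in> set w" for i
      using that \<open>w \<in> mperms_all\<close> unfolding mperms_all_iff
      by (metis atLeastAtMost_iff not_one_le_zero not_gr_zero)
    then show "filter ((<) 0) w = w" "filter (\<lambda>i. i \<le> 0) w = []" "red w = w"
      using that by (auto simp: filter_id_conv filter_empty_conv remdups_adj_id mperms_all_iff)
  qed
  show "mprod [] a x \<longleftrightarrow> a \<in> mperms_all \<and> x = a"
    using id[of x] id[of a] Nil_mperms_all by (auto simp: mprod_def)
  have le: "filter (\<lambda>i. i \<le> card (set w)) w = w" "filter (\<lambda>i. i > card (set w)) w = []"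
    if "w \<in> mperms_all" for w
  proof -
    have "i \<le> card (set w)" if "i \<in> set w" for i
      using that \<open>w \<in> mperms_all\<close> unfolding mperms_all_iff by (metis atLeastAtMost_iff)
    then show "filter (\<lambda>i. i \<le> card (set w)) w = w" "filter (\<lambda>i. i > card (set w)) w = []"
      by (auto simp: filter_id_conv filter_empty_conv not_less)
  qed
  show "mprod a [] x \<longleftrightarrow> a \<in> mperms_all \<and> x = a"
  proof
    assume m: "mprod a [] x"
    then have "card (set x) = card (set a)"
      using mprod_card[OF m] by simp
    then show "a \<in> mperms_all \<and> x = a"
      using m le[of x] id(3)[of x] by (simp add: mprod_def)
  next
    assume "a \<in> mperms_all \<and> x = a"
    then show "mprod a [] x"
      using le[of a] id(3)[of a] Nil_mperms_all by (simp add: mprod_def)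
  qed
  show "mprod a b [] \<longleftrightarrow> a = [] \<and> b = []"
    using Nil_mperms_all by (auto simp: mprod_def)
qed

lemma mcoprod_const_Nil:
  assumes "a \<in> mperms_all"
  shows "mcoprod_const [] a x = of_bool (x = a)" "mcoprod_const a [] x = of_bool (x = a)"
proof -
  have "cut_count [] a x = of_bool (x = a) \<and> cut_count a [] x = of_bool (x = a)"
    if x: "x \<in> mperms_all"
  proof -
    have adj: "distinct_adj x" using x by (simp add: mperms_all_iff)
    have "{(u, v) \<in> Cut x. mstd u = [] \<and> mstd v = a} = (if x = a then {([], x)} else {})"
      "{(u, v) \<in> Cut x. mstd u = a \<and> mstd v = []} = (if x = a then {(x, [])} else {})"
      using adj mstd_id[OF x] assms
      by (auto simp: Cut_def mstd_eq_Nil_iff remdups_adj_id split: if_splits)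
    then show ?thesis
      by (simp add: cut_count_card[OF adj])
  qed
  then show "mcoprod_const [] a x = of_bool (x = a)" "mcoprod_const a [] x = of_bool (x = a)"
    using assms by (auto simp: mcoprod_const_def)
qed

lemma mcoprod_const_of_Nil: "mcoprod_const a b [] = of_bool (a = [] \<and> b = [])"
proof -
  have "Cut [] = {([], [])}" by (auto simp: Cut_def)
  then show ?thesis
    by (auto simp: mcoprod_const_def Nil_mperms_all cut_count_def)
qed

section \<open>Agreement with the defining product and coproduct of words\<close>

lemma mMR_coprod_eq: "x \<in> mperms_all \<Longrightarrow> mMR_coprod x (p, q) = mcoprod_const p q x"
  using sum_Cut[of x "\<lambda>a b. of_bool (mstd a = p \<and> mstd b = q)"]
  by (simp add: mperms_all_iff mMR_coprod_def mcoprod_const_def cut_count_def basis_elem_def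
      eq_commute[of p] eq_commute[of q])

text \<open>The characterization of \<open>remdups_adj\<close> asks in addition that neighbours be
  equal exactly when their indices are. This follows because \<open>t\<close> advances by at most
  one and neighbours in \<open>u\<close> differ.\<close>

lemma multiword_of_iff:
  assumes u: "distinct_adj u"
  shows "multiword_of v u \<longleftrightarrow> red v = u"
proof
  assume "red v = u"
  then obtain f :: "nat \<Rightarrow> nat" where "mono f" "f ` {0..<length v} = {0..<length u}"
    "\<forall>i<length v. v ! i = u ! f i"
    unfolding remdups_adj_altdef by blast
  then show "multiword_of v u"
    unfolding multiword_of_def
    by (intro exI[of _ f]) (auto simp: lessThan_atLeast0 mono_imp_mono_on)
next
  assume "multiword_of v u"
  then obtain t where mono: "mono_on {..<length v} t" and img: "t ` {..<length v} = {..<length u}"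
    and nth: "\<forall>j<length v. v ! j = u ! t j"
    unfolding multiword_of_def by blast
  show "red v = u"
  proof (cases "v = []")
    case True
    then have "u = []" using img by (cases u) auto
    with True show ?thesis by simp
  next
    case False
    \<comment> \<open>\<open>t\<close> is monotone only up to the end of \<open>v\<close>; clamping
      the argument makes it monotone everywhere.\<close>
    define f where "f i = t (min i (length v - 1))" for i
    have f_t: "f i = t i" if "i < length v" for i
      using that by (auto simp: f_def min_def)
    have "min i (length v - 1) < length v" for i
      using False by (cases v) auto
    then have "mono f"
      unfolding f_def by (intro monoI mono_onD[OF mono]) auto
    moreover have "f ` {0..<length v} = {0..<length u}"
      using img f_t by (auto simp: lessThan_atLeast0 cong: image_cong_simp)
    moreover have "\<forall>i<length v. v ! i = u ! f i"
      using nth f_t by simp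
    moreover have "v ! i = v ! (i + 1) \<longleftrightarrow> f i = f (i + 1)" if i: "i + 1 < length v" for i
    proof (cases "t i = t (i + 1)")
      case True
      then show ?thesis using nth f_t i by simp
    next
      case False
      then have less: "t i < t (i + 1)"
        using mono_onD[OF mono, of i "i + 1"] i by simp
      have "t (i + 1) < length u" using img i by auto
      \<comment> \<open>Surjectivity rules out jumps: a preimage of \<open>t i + 1\<close> lies to
        the right of \<open>i\<close>, so \<open>t (i + 1)\<close> cannot exceed this value.\<close>
      then have "t i + 1 \<in> t ` {..<length v}" using less img by auto
      then obtain j where j: "j < length v" "t j = t i + 1" by auto
      have "i < j"
        using mono_onD[OF mono, of j i] j i by (force simp: not_le[symmetric])
      then have "t (i + 1) = t i + 1"
        using mono_onD[OF mono, of "i + 1" j] j i less by simp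
      moreover have "u ! t i \<noteq> u ! (t i + 1)"
        using distinct_adj_nth[OF u, of "t i"] \<open>t (i + 1) < length u\<close> less by simp
      ultimately show ?thesis using nth f_t i by simp
    qed
    ultimately show ?thesis
      unfolding remdups_adj_altdef by blast
  qed
qed

lemma mMR_prod_eq:
  assumes "a \<in> mperms_all" "b \<in> mperms_all"
  shows "mMR_prod (a, b) x = mprod_const a b x"
proof -
  let ?n = "card (set a)" and ?m = "card (set b)"
  have adj: "distinct_adj a" "distinct_adj (map (\<lambda>i. i + ?n) b)"
    using assms by (simp_all add: mperms_all_iff distinct_adj_map_iff)
  have filters: "filter (\<lambda>i. i \<in> {1..?n}) x = filter (\<lambda>i. i \<le> ?n) x"
    "filter (\<lambda>i. i \<in> {?n + 1..?n + ?m}) x = filter (\<lambda>i. i > ?n) x" if "set x \<subseteq> {1..?n + ?m}"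
    using that by (auto intro!: filter_cong)
  have "set x = {1..?n + ?m}" if "mprod a b x"
    using mprod_card[OF that] mprod_supp(3)[OF that] by (simp add: mperms_all_iff)
  moreover have "distinct_adj x" if "mprod a b x"
    using that by (simp add: mprod_iff)
  moreover have "mprod a b x" if "distinct_adj x" "red (filter (\<lambda>i. i \<le> ?n) x) = a"
    "red (filter (\<lambda>i. i > ?n) x) = map (\<lambda>i. i + ?n) b"
    using assms that by (intro mprodI) simp_all
  ultimately have "x \<in> mMR_prod_words a b \<longleftrightarrow> mprod a b x"
    unfolding mMR_prod_words_def Let_def mem_Collect_eq multiword_of_iff[OF adj(1)]
      multiword_of_iff[OF adj(2)]
    using filters mprod_def[of a b x] by (metis order_refl)
  then show ?thesis
    by (simp add: mMR_prod_def mprod_const_def)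
qed


section \<open>Set compositions\<close>

text \<open>
  A set composition of \<open>X\<close> with \<open>k\<close> blocks is a map \<open>f\<close> from \<open>X\<close> onto \<open>{1..k}\<close>; listing the values
  of \<open>f\<close> along \<open>X\<close> gives a word that turns (R1) into the deletion of a repeated adjacent letter and is
  not affected by (R2).
\<close>

definition blocks :: "nat \<Rightarrow> nat set \<Rightarrow> (nat \<Rightarrow> nat) \<Rightarrow> nat set list" where
  "blocks k X f = map (\<lambda>i. {a \<in> X. f a = i}) [1..<Suc k]"

definition packing :: "nat \<Rightarrow> nat set \<Rightarrow> (nat \<Rightarrow> nat) \<Rightarrow> bool" where
  "packing k X f \<longleftrightarrow> finite X \<and> 0 \<notin> X \<and> f ` X = {1..k}"

definition block_of :: "nat set list \<Rightarrow> nat \<Rightarrow> nat" where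
  "block_of w a = Suc (THE i. i < length w \<and> a \<in> w ! i)"

definition word_of :: "nat set list \<Rightarrow> nat list" where
  "word_of w = map (block_of w) (sorted_list_of_set (\<Union> (set w)))"

lemma length_blocks [simp]: "length (blocks k X f) = k"
  by (simp add: blocks_def)

lemma nth_blocks: "i < k \<Longrightarrow> blocks k X f ! i = {a \<in> X. f a = Suc i}"
  by (simp add: blocks_def del: upt_Suc)

lemma set_blocks: "set (blocks k X f) = (\<lambda>i. {a \<in> X. f a = i}) ` {1..k}"
  by (auto simp: blocks_def)

lemma Union_blocks: "packing k X f \<Longrightarrow> \<Union> (set (blocks k X f)) = X"
  by (auto simp: packing_def set_blocks)

lemma set_composition_blocks:
  assumes "packing k X f"
  shows "set_composition X (blocks k X f)"
proof -
  have "{a \<in> X. f a = i} \<noteq> {}" if "i \<in> {1..k}" for i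
  proof -
    from that have "i \<in> f ` X" using assms by (simp add: packing_def)
    then show ?thesis by auto
  qed
  then have "{} \<notin> set (blocks k X f)"
    unfolding set_blocks by blast
  then show ?thesis
    using assms Union_blocks[OF assms] by (auto simp: set_composition_def packing_def nth_blocks)
qed

lemma block_of_blocks:
  assumes "packing k X f" "a \<in> X"
  shows "block_of (blocks k X f) a = f a"
proof -
  have fa: "1 \<le> f a" "f a \<le> k"
    using assms by (auto simp: packing_def)
  have "(THE i. i < k \<and> a \<in> blocks k X f ! i) = f a - 1"
    using fa assms by (intro the_equality) (auto simp: nth_blocks)
  then show ?thesis using fa by (simp add: block_of_def)
qed

lemma word_of_blocks: "packing k X f \<Longrightarrow> word_of (blocks k X f) = map f (sorted_list_of_set X)"
  by (simp add: word_of_def Union_blocks block_of_blocks packing_def)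

lemma set_composition_cases:
  assumes "set_composition X w"
  obtains k f where "packing k X f" "w = blocks k X f"
proof
  let ?k = "length w"
  have ex: "\<exists>!i. i < ?k \<and> a \<in> w ! i" if "a \<in> X" for a
  proof -
    from that assms obtain A where "A \<in> set w" "a \<in> A"
      by (auto simp: set_composition_def)
    then obtain i where "i < ?k" "a \<in> w ! i"
      by (auto simp: in_set_conv_nth)
    then show ?thesis
      using assms unfolding set_composition_def by blast
  qed
  have block: "block_of w a = Suc i" if "i < ?k" "a \<in> w ! i" "a \<in> X" for a i
    using ex[OF that(3)] that by (auto simp: block_of_def intro!: the1_equality)
  have in_X: "w ! i \<subseteq> X" if "i < ?k" for i
    using assms that by (auto simp: set_composition_def)
  have nonempty: "w ! i \<noteq> {}" if "i < ?k" for i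
    using assms nth_mem[OF that] by (auto simp: set_composition_def)
  have "block_of w ` X = {1..?k}"
  proof (intro equalityI subsetI)
    fix j assume "j \<in> block_of w ` X"
    then obtain a where a: "a \<in> X" "j = block_of w a" by auto
    from ex[OF a(1)] obtain i where "i < ?k" "a \<in> w ! i" by blast
    with a block show "j \<in> {1..?k}" by auto
  next
    fix j assume j: "j \<in> {1..?k}"
    then have "j - 1 < ?k" by auto
    with nonempty in_X obtain a where "a \<in> w ! (j - 1)" "a \<in> X" by blast
    with block[of "j - 1" a] j \<open>j - 1 < ?k\<close> show "j \<in> block_of w ` X" by (auto simp: image_iff)
  qed
  then show "packing ?k X (block_of w)"
    using assms by (simp add: packing_def set_composition_def)
  show "w = blocks ?k X (block_of w)"
  proof (rule nth_equalityI)
    fix i assume i: "i < length w"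
    have "w ! i = {a \<in> X. block_of w a = Suc i}"
    proof (intro equalityI subsetI)
      fix a assume a: "a \<in> {a \<in> X. block_of w a = Suc i}"
      then obtain i' where "i' < ?k" "a \<in> w ! i'" using ex by blast
      with a block[of i' a] show "a \<in> w ! i" by auto
    qed (use i block in_X in auto)
    then show "w ! i = blocks ?k X (block_of w) ! i"
      using i by (simp add: nth_blocks)
  qed simp
qed

lemma blocks_cong:
  "(\<And>a. a \<in> X \<Longrightarrow> f a = g a) \<Longrightarrow> blocks k X f = blocks k X g"
  by (auto simp: blocks_def)

lemma packing_cong:
  "(\<And>a. a \<in> X \<Longrightarrow> f a = g a) \<Longrightarrow> packing k X f = packing k X g"
  by (simp add: packing_def cong: image_cong)

lemma set_word_of: "set_composition X w \<Longrightarrow> set (word_of w) = {1..length w}"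
  by (erule set_composition_cases) (simp add: word_of_blocks, simp add: packing_def)

lemma length_word_of: "set_composition X w \<Longrightarrow> length (word_of w) = card X"
  by (erule set_composition_cases) (simp add: word_of_blocks)

lemma Union_set_composition: "set_composition X w \<Longrightarrow> \<Union> (set w) = X"
  by (simp add: set_composition_def)

lemma word_of_inject:
  assumes "set_composition X w" "set_composition X v" "word_of w = word_of v"
  shows "w = v"
proof -
  obtain k f where f: "packing k X f" "w = blocks k X f"
    using assms(1) by (rule set_composition_cases)
  obtain l g where g: "packing l X g" "v = blocks l X g"
    using assms(2) by (rule set_composition_cases)
  have "map f (sorted_list_of_set X) = map g (sorted_list_of_set X)"
    using assms(3) by (simp add: f g word_of_blocks)
  then have eq: "f a = g a" if "a \<in> X" for a
    using that f(1) by (simp add: packing_def)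
  then have "{1..k} = {1..l}"
    using f(1) g(1) packing_cong[of X f g k] by (simp add: packing_def)
  then have "card {1..k} = card {1..l}" by (rule arg_cong)
  then have "k = l" by simp
  with eq show ?thesis unfolding f g by (auto intro: blocks_cong)
qed

lemma sorted_list_of_set_filter:
  "finite X \<Longrightarrow> sorted_list_of_set {a \<in> X. P a} = filter P (sorted_list_of_set X)"
  by (rule sorted_distinct_set_unique) (auto simp: sorted_wrt_filter)

section \<open>Concatenation and restriction of set compositions\<close>

lemma take_blocks:
  assumes "packing k X f" "i \<le> k"
  shows "take i (blocks k X f) = blocks i {a \<in> X. f a \<le> i} f" "packing i {a \<in> X. f a \<le> i} f"
proof -
  have "take i [1..<Suc k] = [1..<Suc i]"
    using assms(2) take_upt[of 1 i "Suc k"] by simp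
  then show "take i (blocks k X f) = blocks i {a \<in> X. f a \<le> i} f"
    unfolding blocks_def take_map by auto
  have "f ` {a \<in> X. f a \<le> i} = f ` X \<inter> {..i}" by auto
  then show "packing i {a \<in> X. f a \<le> i} f"
    using assms by (auto simp: packing_def)
qed

lemma drop_blocks:
  assumes "packing k X f" "i \<le> k"
  shows "drop i (blocks k X f) = blocks (k - i) {a \<in> X. i < f a} (\<lambda>a. f a - i)"
    "packing (k - i) {a \<in> X. i < f a} (\<lambda>a. f a - i)"
proof -
  show "drop i (blocks k X f) = blocks (k - i) {a \<in> X. i < f a} (\<lambda>a. f a - i)"
    by (rule nth_equalityI) (use assms in \<open>auto simp: nth_blocks\<close>)
  have "(\<lambda>a. f a - i) ` {a \<in> X. i < f a} = (\<lambda>j. j - i) ` (f ` X \<inter> {i<..})" by auto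
  also have "\<dots> = (\<lambda>j. j - i) ` {i<..k}"
    using assms by (auto simp: packing_def intro!: arg_cong[of _ _ "(`) _"])
  also have "\<dots> = {1..k - i}"
    by (auto simp: image_iff intro!: bexI[of _ "_ + i"])
  finally show "packing (k - i) {a \<in> X. i < f a} (\<lambda>a. f a - i)"
    using assms by (auto simp: packing_def)
qed

text \<open>Blocks are the letters of the word, so cutting a composition means splitting its word by
  the size of letters. This is how the product of mMR enters the coproduct of MMR.\<close>

lemma word_of_take:
  assumes "set_composition X w" "i \<le> length w"
  shows "word_of (take i w) = filter (\<lambda>j. j \<le> i) (word_of w)"
    "\<exists>Y. set_composition Y (take i w)"
proof -
  obtain k f where f: "packing k X f" "w = blocks k X f"
    using assms(1) by (rule set_composition_cases)
  have "finite X" using f by (simp add: packing_def)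
  note t = take_blocks[OF f(1), of i]
  show "word_of (take i w) = filter (\<lambda>j. j \<le> i) (word_of w)"
    using assms(2) t \<open>finite X\<close> f
    by (simp add: word_of_blocks sorted_list_of_set_filter filter_map o_def)
  show "\<exists>Y. set_composition Y (take i w)"
    using assms(2) t f set_composition_blocks by auto
qed

lemma word_of_drop:
  assumes "set_composition X w" "i \<le> length w"
  shows "word_of (drop i w) = map (\<lambda>j. j - i) (filter (\<lambda>j. j > i) (word_of w))"
    "\<exists>Y. set_composition Y (drop i w)"
proof -
  obtain k f where f: "packing k X f" "w = blocks k X f"
    using assms(1) by (rule set_composition_cases)
  have "finite X" using f by (simp add: packing_def)
  note t = drop_blocks[OF f(1), of i]
  show "word_of (drop i w) = map (\<lambda>j. j - i) (filter (\<lambda>j. j > i) (word_of w))"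
    using assms(2) t \<open>finite X\<close> f
    by (simp add: word_of_blocks sorted_list_of_set_filter filter_map o_def)
  show "\<exists>Y. set_composition Y (drop i w)"
    using assms(2) t f set_composition_blocks by auto
qed

text \<open>Discarding the emptied blocks renumbers the others by rank. Restriction to a set of
  positions is thus passage to a subword followed by standardization.\<close>

lemma restrict_comp_blocks:
  fixes T :: "nat set"
  assumes f: "packing k X f"
  defines "S \<equiv> f ` (X \<inter> T)"
  shows "restrict_comp (blocks k X f) T = blocks (card S) (X \<inter> T) (\<lambda>a. rank S (f a))"
    and "packing (card S) (X \<inter> T) (\<lambda>a. rank S (f a))"
proof -
  have fin: "finite S" using f by (simp add: S_def packing_def)
  have S_sub: "S \<subseteq> {1..k}" using f by (auto simp: S_def packing_def)
  have S_eq: "sorted_list_of_set S = filter (\<lambda>i. i \<in> S) [1..<Suc k]"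
  proof (rule sorted_distinct_set_unique)
    show "set (sorted_list_of_set S) = set (filter (\<lambda>i. i \<in> S) [1..<Suc k])"
      using fin S_sub by (auto simp del: upt_Suc)
  qed (auto simp: sorted_wrt_filter simp del: upt_Suc)
  have rank_eq: "map (rank S) (sorted_list_of_set S) = [1..<Suc (card S)]"
  proof (rule sorted_distinct_set_unique)
    show "sorted (map (rank S) (sorted_list_of_set S))"
      unfolding sorted_map
      by (rule sorted_wrt_mono_rel[OF _ sorted_sorted_list_of_set]) (auto intro: rank_mono fin)
    show "distinct (map (rank S) (sorted_list_of_set S))"
      using fin inj_on_rank[OF fin] by (simp add: distinct_map)
    show "set (map (rank S) (sorted_list_of_set S)) = set [1..<Suc (card S)]"
      using fin rank_image[OF fin] by (simp del: upt_Suc add: atLeastLessThanSuc_atLeastAtMost)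
  qed (auto simp del: upt_Suc)
  have "restrict_comp (blocks k X f) T =
      map (\<lambda>i. {a \<in> X. f a = i} \<inter> T) (filter (\<lambda>i. {a \<in> X. f a = i} \<inter> T \<noteq> {}) [1..<Suc k])"
    by (simp only: restrict_comp_def blocks_def map_map filter_map o_def)
  also have "(\<lambda>i. {a \<in> X. f a = i} \<inter> T \<noteq> {}) = (\<lambda>i. i \<in> S)"
    by (auto simp: S_def fun_eq_iff)
  also have "map (\<lambda>i. {a \<in> X. f a = i} \<inter> T) (filter (\<lambda>i. i \<in> S) [1..<Suc k]) =
      map (\<lambda>i. {a \<in> X \<inter> T. rank S (f a) = i}) (map (rank S) (sorted_list_of_set S))"
    unfolding S_eq[symmetric] map_map
  proof (rule map_cong[OF refl])
    fix i assume "i \<in> set (sorted_list_of_set S)"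
    then have "i \<in> S" using fin by simp
    then have "rank S (f a) = rank S i \<longleftrightarrow> f a = i" if "a \<in> X \<inter> T" for a
      using inj_on_rank[OF fin] that by (auto simp: S_def dest: inj_onD)
    then show "{a \<in> X. f a = i} \<inter> T = ((\<lambda>i. {a \<in> X \<inter> T. rank S (f a) = i}) \<circ> rank S) i"
      by auto
  qed
  finally show "restrict_comp (blocks k X f) T = blocks (card S) (X \<inter> T) (\<lambda>a. rank S (f a))"
    unfolding rank_eq blocks_def .
  have "(\<lambda>a. rank S (f a)) ` (X \<inter> T) = rank S ` S"
    by (simp add: S_def image_image)
  then show "packing (card S) (X \<inter> T) (\<lambda>a. rank S (f a))"
    using f by (simp add: packing_def rank_image[OF fin])
qed

lemma word_of_restrict_comp:
  assumes "packing k X f"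
  shows "word_of (restrict_comp (blocks k X f) T) =
      map (rank (set (map f (sorted_list_of_set (X \<inter> T))))) (map f (sorted_list_of_set (X \<inter> T)))"
    and "set_composition (X \<inter> T) (restrict_comp (blocks k X f) T)"
proof -
  note r = restrict_comp_blocks[OF assms, of T]
  have "finite X" using assms by (simp add: packing_def)
  then show "word_of (restrict_comp (blocks k X f) T) =
      map (rank (set (map f (sorted_list_of_set (X \<inter> T))))) (map f (sorted_list_of_set (X \<inter> T)))"
    using r by (simp add: word_of_blocks)
  show "set_composition (X \<inter> T) (restrict_comp (blocks k X f) T)"
    unfolding r(1) using r(2) by (rule set_composition_blocks)
qed

lemma word_of_blocks_interval:
  "packing k {1..n} f \<Longrightarrow> word_of (blocks k {1..n} f) = map f [1..<Suc n]"
  using sorted_list_of_set_range[of 1 "Suc n"]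
  by (simp add: word_of_blocks atLeastLessThanSuc_atLeastAtMost del: upt_Suc)

text \<open>As the underlying set is a full interval, neighbours in the word belong to consecutive
  integers; equal neighbours are consecutive integers in one block.\<close>

lemma Mperms_iff:
  "w \<in> Mperms n \<longleftrightarrow> set_composition {1..n} w \<and> distinct_adj (word_of w)"
proof (cases "set_composition {1..n} w")
  case True
  then obtain k f where f: "packing k {1..n} f" "w = blocks k {1..n} f"
    by (rule set_composition_cases)
  have word: "word_of w = map f [1..<Suc n]"
    unfolding f(2) by (rule word_of_blocks_interval[OF f(1)])
  have "(\<forall>A\<in>set w. \<forall>i. \<not> (i \<in> A \<and> i + 1 \<in> A)) \<longleftrightarrow> (\<forall>i. 1 \<le> i \<and> i + 1 \<le> n \<longrightarrow> f i \<noteq> f (i + 1))"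
    using f(1) unfolding f(2) set_blocks packing_def by (auto simp: image_iff) (metis atLeastAtMost_iff imageI Suc_leD)+
  also have "\<dots> \<longleftrightarrow> distinct_adj (word_of w)"
    unfolding word distinct_adj_conv_nth
    by (auto simp del: upt_Suc) (metis Suc_pred Suc_le_eq Suc_less_eq le_add1 plus_1_eq_Suc)
  finally show ?thesis
    using True by (simp add: Mperms_def)
qed (simp add: Mperms_def)

lemma comp_inverse_eq:
  assumes "w \<in> Mperms_all"
  shows "comp_inverse w = word_of w"
  unfolding comp_inverse_def
proof (rule the_equality)
  obtain n where w: "set_composition {1..n} w" "distinct_adj (word_of w)"
    using assms by (auto simp: Mperms_all_def Mperms_iff)
  then obtain k f where f: "packing k {1..n} f" "w = blocks k {1..n} f"
    by (blast elim: set_composition_cases)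
  have word: "word_of w = map f [1..<Suc n]"
    unfolding f(2) by (rule word_of_blocks_interval[OF f(1)])
  have U: "\<Union> (set w) = {1..n}"
    using w by (simp add: Union_set_composition)
  have len: "length (word_of w) = n"
    using length_word_of[OF w(1)] by simp
  have nth: "word_of w ! (j - 1) = f j" if "j \<in> {1..n}" for j
    using that unfolding word by (auto simp del: upt_Suc)
  have "{j \<in> {1..length (word_of w)}. word_of w ! (j - 1) = i} = w ! (i - 1)"
    if i: "i \<in> {1..length w}" for i
    using i nth unfolding len by (auto simp: f(2) nth_blocks simp del: One_nat_def)
  then show "word_of w \<in> mperms (length w) \<and> length (word_of w) = card (\<Union> (set w)) \<and>
      (\<forall>i\<in>{1..length w}. {j \<in> {1..length (word_of w)}. word_of w ! (j - 1) = i} = w ! (i - 1))"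
    using w set_word_of[OF w(1)] len U by (auto simp: mperms_def)
  fix u assume u': "u \<in> mperms (length w) \<and> length u = card (\<Union> (set w)) \<and>
      (\<forall>i\<in>{1..length w}. {j \<in> {1..length u}. u ! (j - 1) = i} = w ! (i - 1))"
  then have u: "set u = {1..k}" "length u = n"
    using U by (auto simp: mperms_def f(2))
  have u_nth: "{j \<in> {1..n}. u ! (j - 1) = i} = w ! (i - 1)" if "i \<in> {1..k}" for i
    using u' u(2) that by (simp add: f(2))
  show "u = word_of w"
  proof (rule nth_equalityI)
    fix j assume j: "j < length u"
    then have uj: "u ! j \<in> {1..k}" using nth_mem[OF j] u(1) by simp
    have "Suc j \<in> {j' \<in> {1..n}. u ! (j' - 1) = u ! j}"
      using j u(2) by simp
    then have "Suc j \<in> w ! (u ! j - 1)"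
      unfolding u_nth[OF uj] .
    moreover have "u ! j - 1 < k" "Suc (u ! j - 1) = u ! j"
      using uj by auto
    ultimately have "f (Suc j) = u ! j"
      by (simp add: f(2) nth_blocks)
    then show "u ! j = word_of w ! j"
      using nth[of "Suc j"] j u(2) by simp
  qed (use u len in simp)
qed

lemma word_of_in_mperms_all: "w \<in> Mperms_all \<Longrightarrow> word_of w \<in> mperms_all"
  by (auto simp: Mperms_all_def Mperms_iff mperms_all_iff set_word_of)

lemma Mperms_all_unique:
  assumes "w \<in> Mperms_all" "v \<in> Mperms_all" "word_of w = word_of v"
  shows "w = v"
proof -
  obtain m n where "set_composition {1..m} w" "set_composition {1..n} v"
    using assms(1,2) by (auto simp: Mperms_all_def Mperms_iff)
  moreover from this have "m = n"
    using length_word_of[of "{1..m}" w] length_word_of[of "{1..n}" v] assms(3) by simp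
  ultimately show ?thesis
    using assms(3) by (blast intro: word_of_inject)
qed

lemma bij_comp_inverse: "bij_betw comp_inverse Mperms_all mperms_all"
proof (rule bij_betw_imageI)
  show "inj_on comp_inverse Mperms_all"
    by (auto simp: inj_on_def comp_inverse_eq intro: Mperms_all_unique)
  show "comp_inverse ` Mperms_all = mperms_all"
  proof (intro equalityI subsetI)
    fix x assume "x \<in> mperms_all"
    then have x: "distinct_adj x" "set x = {1..card (set x)}"
      by (auto simp: mperms_all_iff)
    let ?k = "card (set x)" and ?n = "length x" and ?f = "\<lambda>a. x ! (a - 1)"
    have eq: "map ?f [1..<Suc ?n] = x"
      by (rule nth_equalityI) (auto simp del: upt_Suc)
    from arg_cong[OF eq, of set] have "?f ` {1..?n} = {1..?k}"
      using x(2) by (simp add: atLeastLessThanSuc_atLeastAtMost del: upt_Suc)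
    then have pack: "packing ?k {1..?n} ?f"
      by (simp add: packing_def)
    let ?w = "blocks ?k {1..?n} ?f"
    have word: "word_of ?w = x"
      using word_of_blocks_interval[OF pack] eq by simp
    then have "?w \<in> Mperms_all"
      using x(1) set_composition_blocks[OF pack] by (auto simp: Mperms_all_def Mperms_iff)
    with word show "x \<in> comp_inverse ` Mperms_all"
      by (auto simp: comp_inverse_eq intro!: image_eqI[of _ _ ?w])
  qed (auto simp: comp_inverse_eq word_of_in_mperms_all)
qed


section \<open>Standardization of set compositions\<close>

lemma sorted_list_of_set_split:
  assumes "finite X" "i \<in> X"
  shows "sorted_list_of_set X =
    sorted_list_of_set {a \<in> X. a < i} @ i # sorted_list_of_set {a \<in> X. i < (a :: nat)}"
  by (rule sorted_distinct_set_unique) (use assms in \<open>auto simp: sorted_append intro: less_imp_le\<close>)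

lemma Mstd_step_word:
  assumes "Mstd_step w w'" "set_composition X w"
  shows "\<exists>Y. set_composition Y w' \<and> red (word_of w') = red (word_of w)"
  using assms
proof (induction rule: Mstd_step.induct)
  case (R1 j w i)
  obtain k f where f: "packing k X f" "w = blocks k X f"
    using R1.prems by (rule set_composition_cases)
  let ?Y = "X - {i + 1}"
  have j: "j < k" and i: "i \<in> X" "i + 1 \<in> X" "f i = Suc j" "f (i + 1) = Suc j"
    using R1.hyps by (auto simp: f nth_blocks)
  have fin: "finite X" using f by (simp add: packing_def)
  have "X = insert (i + 1) ?Y"
    using i by auto
  \<comment> \<open>The block of \<open>i + 1\<close> still contains \<open>i\<close>, so no block
    becomes empty.\<close>
  moreover have "f (i + 1) \<in> f ` ?Y"
    by (rule image_eqI[of _ f i]) (use i in auto)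
  ultimately have "f ` ?Y = f ` X"
    by (metis image_insert insert_absorb)
  then have pack: "packing k ?Y f"
    using f(1) by (simp add: packing_def)
  have w': "w[j := w ! j - {i + 1}] = blocks k ?Y f"
    by (rule nth_equalityI) (use j i in \<open>auto simp: f nth_blocks nth_list_update\<close>)
  let ?A = "sorted_list_of_set {a \<in> X. a < i}" and ?B = "sorted_list_of_set {a \<in> X. i + 1 < a}"
  have sets: "{a \<in> ?Y. a < i} = {a \<in> X. a < i}" "{a \<in> ?Y. i < a} = {a \<in> X. i + 1 < a}"
    "{a \<in> {a \<in> X. i < a}. a < i + 1} = {}" "{a \<in> {a \<in> X. i < a}. i + 1 < a} = {a \<in> X. i + 1 < a}"
    by auto
  have Y: "sorted_list_of_set ?Y = ?A @ i # ?B"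
    using sorted_list_of_set_split[of ?Y i] fin i unfolding sets by simp
  have "sorted_list_of_set {a \<in> X. i < a} = (i + 1) # ?B"
    using sorted_list_of_set_split[of "{a \<in> X. i < a}" "i + 1"] fin i unfolding sets by simp
  then have X: "sorted_list_of_set X = ?A @ i # (i + 1) # ?B"
    using sorted_list_of_set_split[OF fin i(1)] by simp
  have "red (word_of w) =
      red (map f ?A @ red (Suc j # Suc j # map f ?B))"
    using i by (simp add: f word_of_blocks X remdups_adj_append_remdups_adj_right del: remdups_adj.simps)
  also have "\<dots> = red (word_of (blocks k ?Y f))"
    unfolding word_of_blocks[OF pack] Y
    using i by (simp add: remdups_adj_append_remdups_adj_right)
  finally show ?case
    unfolding w' using set_composition_blocks[OF pack] by auto
next
  case (R2 i w)
  obtain k f where f: "packing k X f" "w = blocks k X f"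
    using R2.prems by (rule set_composition_cases)
  define g where "g = (\<lambda>a. if a > i then a - 1 else a)"
  have i: "i \<ge> 1" "i \<notin> X"
    using R2.hyps R2.prems by (simp_all add: Union_set_composition)
  have fin: "finite X" and X0: "0 \<notin> X" using f by (simp_all add: packing_def)
  \<comment> \<open>The only collision of \<open>g\<close> is between \<open>i\<close> and
    \<open>i + 1\<close>, and \<open>i\<close> is missing from \<open>X\<close>.\<close>
  have mono: "g a < g b" if "a \<in> X" "b \<in> X" "a < b" for a b
    using that i by (cases "a = i"; cases "b = i") (auto simp: g_def)
  then have inj: "inj_on g X"
    unfolding inj_on_def by (metis less_irrefl nat_neq_iff)
  let ?h = "\<lambda>b. f (the_inv_into X g b)"
  have h: "?h (g a) = f a" if "a \<in> X" for a
    using that inj by (simp add: the_inv_into_f_f)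
  have "0 \<notin> g ` X"
    using i X0 by (auto simp: g_def split: if_splits)
  moreover have "?h ` g ` X = f ` X"
    unfolding image_image using h by (rule image_cong[OF refl])
  ultimately have pack: "packing k (g ` X) ?h"
    using f(1) by (simp add: packing_def)
  have w': "map ((`) g) w = blocks k (g ` X) ?h"
  proof (rule nth_equalityI)
    fix l assume l: "l < length (map ((`) g) w)"
    have "g ` {a \<in> X. f a = Suc l} = {b \<in> g ` X. ?h b = Suc l}"
      using h by auto
    then show "map ((`) g) w ! l = blocks k (g ` X) ?h ! l"
      using l by (simp add: f nth_blocks)
  qed (simp add: f)
  have "sorted_list_of_set (g ` X) = map g (sorted_list_of_set X)"
  proof (rule sorted_distinct_set_unique)
    show "sorted (map g (sorted_list_of_set X))"
      unfolding sorted_map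
      by (rule sorted_wrt_mono_rel[OF _ sorted_sorted_list_of_set])
        (use mono fin in \<open>auto simp: le_less\<close>)
  qed (use fin inj in \<open>auto simp: distinct_map\<close>)
  then have "word_of (blocks k (g ` X) ?h) = word_of w"
    using h fin by (simp add: word_of_blocks pack f)
  then show ?case
    unfolding g_def[symmetric] w' using set_composition_blocks[OF pack] by auto
qed

lemma Mstd_steps_word:
  assumes "Mstd_step\<^sup>*\<^sup>* w w'" "set_composition X w"
  shows "(\<exists>Y. set_composition Y w') \<and> red (word_of w') = red (word_of w)"
  using assms
proof (induction rule: rtranclp_induct)
  case (step y z)
  then obtain Y where "set_composition Y y" by blast
  with step show ?case using Mstd_step_word[of y z Y] by auto
qed auto

text \<open>Termination is measured by the sum of the underlying set, which an application of (R1),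
  or of (R2) below some element, makes smaller.\<close>

lemma Mstd_steps_exist:
  assumes "set_composition X w"
  shows "\<exists>v. Mstd_step\<^sup>*\<^sup>* w v \<and> v \<in> Mperms_all"
  using assms
proof (induction "\<Sum>X" arbitrary: X w rule: less_induct)
  case less
  have fin: "finite X" and X0: "0 \<notin> X" and U: "\<Union> (set w) = X"
    using less.prems by (auto simp: set_composition_def)
  have step: ?case if w': "Mstd_step w w'" "\<Sum>(\<Union> (set w')) < \<Sum>X" for w'
  proof -
    obtain Y where Y: "set_composition Y w'"
      using Mstd_step_word[OF w'(1) less.prems] by blast
    then have "\<Sum>Y < \<Sum>X" using w'(2) by (simp add: Union_set_composition)
    from less.hyps[OF this Y] w'(1) show ?thesis
      by (blast intro: converse_rtranclp_into_rtranclp)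
  qed
  consider (adj) A i where "A \<in> set w" "i \<in> A" "i + 1 \<in> A"
    | (gap) "X \<noteq> {1..card X}" | (std) "X = {1..card X}" "\<forall>A\<in>set w. \<forall>i. \<not> (i \<in> A \<and> i + 1 \<in> A)"
    by blast
  then show ?case
  proof cases
    case adj
    then obtain j where j: "j < length w" "A = w ! j"
      by (auto simp: in_set_conv_nth)
    let ?w = "w[j := w ! j - {i + 1}]"
    have other: "i + 1 \<notin> w ! l" if "l < length w" "l \<noteq> j" for l
      using less.prems j adj that by (auto simp: set_composition_def)
    have sub: "w ! l \<subseteq> X" if "l < length w" for l
      using nth_mem[OF that] U by blast
    have "?w ! l \<subseteq> X - {i + 1}" if l: "l < length w" for l
    proof (cases "l = j")
      case True
      then show ?thesis using sub[OF l] l by auto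
    next
      case False
      then show ?thesis using sub[OF l] other[OF l False] by auto
    qed
    then have "\<Union> (set ?w) \<subseteq> X - {i + 1}"
      by (fastforce simp: in_set_conv_nth)
    then have "\<Sum>(\<Union> (set ?w)) \<le> \<Sum>(X - {i + 1})"
      using fin by (intro sum_mono2) auto
    also have "\<dots> < \<Sum>X"
      using fin adj U by (intro sum_strict_mono2[of X "X - {i + 1}" "i + 1"]) auto
    finally show ?thesis
      using Mstd_step.R1[of j w i] adj j by (intro step) auto
  next
    case gap
    \<comment> \<open>The missing number must have an element above it: (R2) beyond the maximum
      changes nothing and would not decrease the measure.\<close>
    have "\<exists>i a. 1 \<le> i \<and> i \<notin> X \<and> a \<in> X \<and> i < a"
    proof (rule ccontr)
      assume no: "\<not> ?thesis"
      have "X \<noteq> {}" using gap by auto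
      have "X = {1..Max X}"
      proof (intro equalityI subsetI)
        fix x assume "x \<in> X"
        moreover from this have "x \<le> Max X" using fin by simp
        moreover have "x \<noteq> 0" using \<open>x \<in> X\<close> X0 by metis
        ultimately show "x \<in> {1..Max X}" by simp
      next
        fix x assume x: "x \<in> {1..Max X}"
        show "x \<in> X"
        proof (rule ccontr)
          assume "x \<notin> X"
          moreover have "Max X \<in> X" using fin \<open>X \<noteq> {}\<close> by (rule Max_in)
          ultimately have "x < Max X" using x by (cases "x = Max X") auto
          with \<open>x \<notin> X\<close> \<open>Max X \<in> X\<close> x no show False by auto
        qed
      qed
      moreover from arg_cong[OF this, of card] have "card X = Max X" by simp
      ultimately have "X = {1..card X}" by simp
      with gap show False by simp
    qed
    then obtain i a where i: "1 \<le> i" "i \<notin> X" "a \<in> X" "i < a" by blast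
    let ?g = "\<lambda>a. if a > i then a - 1 else a"
    have "\<Union> (set (map ((`) ?g) w)) = ?g ` X"
      unfolding U[symmetric] by auto
    then have "\<Sum>(\<Union> (set (map ((`) ?g) w))) \<le> (\<Sum>b\<in>X. ?g b)"
      using sum_image_le[OF fin, of "\<lambda>x. x" ?g] by (simp add: o_def)
    also have "\<dots> < \<Sum>X"
      using i fin by (intro sum_strict_mono_ex1) (auto intro!: bexI[of _ a])
    finally show ?thesis
      using Mstd_step.R2[of i w] i U by (intro step) auto
  next
    case std
    then have "w \<in> Mperms_all"
      using less.prems by (auto simp: Mperms_all_def Mperms_def intro!: exI[of _ "card X"])
    then show ?thesis by blast
  qed
qed

text \<open>Confluence is replaced by an invariant: steps preserve the reduced word, and an
  M-permutation is determined by its word, which is already reduced.\<close>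

lemma Mstd_in_Mperms_all_and_word:
  assumes "set_composition X w"
  shows "Mstd w \<in> Mperms_all \<and> word_of (Mstd w) = red (word_of w)"
proof -
  have word: "word_of v = red (word_of w)" if "Mstd_step\<^sup>*\<^sup>* w v" "v \<in> Mperms_all" for v
    using Mstd_steps_word[OF that(1) assms] word_of_in_mperms_all[OF that(2)]
    by (simp add: mperms_all_iff remdups_adj_id)
  obtain v where v: "Mstd_step\<^sup>*\<^sup>* w v" "v \<in> Mperms_all"
    using Mstd_steps_exist[OF assms] by blast
  have "Mstd w = v"
    unfolding Mstd_def
    using v word Mperms_all_unique by (intro the_equality) (auto simp: word)
  with v word show ?thesis by simp
qed

lemma Mstd_eq_iff:
  assumes "set_composition X w" "v \<in> Mperms_all"
  shows "Mstd w = v \<longleftrightarrow> red (word_of w) = word_of v"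
  using Mstd_in_Mperms_all_and_word[OF assms(1)] Mperms_all_unique[OF _ assms(2)] by metis


section \<open>Structure constants of MMR\<close>

text \<open>At most one cut of \<open>v\<close> contributes: if the low part has the word of
  \<open>p\<close>, the cut comes after exactly as many blocks as \<open>p\<close> has.\<close>

lemma MMR_coprod_eq:
  assumes v: "v \<in> Mperms_all"
  shows "MMR_coprod v (p, q) = pull_back Mperms_all comp_inverse mprod_const p q v"
proof (cases "p \<in> Mperms_all \<and> q \<in> Mperms_all")
  case False
  obtain n where "set_composition {1..n} v"
    using v by (auto simp: Mperms_all_def Mperms_iff)
  then have "Mstd (take i v) \<in> Mperms_all \<and> Mstd (drop i v) \<in> Mperms_all" if "i \<le> length v" for i
    using word_of_take(2)[of _ v i] word_of_drop(2)[of _ v i] that Mstd_in_Mperms_all_and_word by blast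
  then have "MMR_coprod v (p, q) = 0"
    using False unfolding MMR_coprod_def by (intro sum.neutral) (auto simp: basis_elem_def)
  then show ?thesis
    using False by (auto simp: pull_back_def)
next
  case True
  obtain n where sc: "set_composition {1..n} v" and adj: "distinct_adj (word_of v)"
    using v by (auto simp: Mperms_all_def Mperms_iff)
  let ?x = "word_of v" and ?a = "word_of p" and ?b = "word_of q"
  let ?n = "card (set ?a)"
  have "basis_elem (Mstd (take i v), Mstd (drop i v)) (p, q) = of_bool (low i ?x = ?a \<and> high i ?x = ?b)"
    if i: "i \<in> {0..length v}" for i
  proof -
    have i: "i \<le> length v" using that by simp
    obtain Y Z where YZ: "set_composition Y (take i v)" "set_composition Z (drop i v)"
      using word_of_take(2)[OF sc i] word_of_drop(2)[OF sc i] by blast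
    have "inj_on (\<lambda>j. j - i) (set (filter (\<lambda>j. j > i) ?x))"
      by (auto simp: inj_on_def)
    then have "red (word_of (drop i v)) = high i ?x"
      by (simp add: word_of_drop[OF sc i] high_def remdups_adj_map)
    moreover have "red (word_of (take i v)) = low i ?x"
      by (simp add: word_of_take[OF sc i] low_def)
    ultimately show ?thesis
      using Mstd_eq_iff[OF YZ(1), of p] Mstd_eq_iff[OF YZ(2), of q] True
      by (auto simp: basis_elem_def)
  qed
  then have "MMR_coprod v (p, q) = (\<Sum>i = 0..length v. of_bool (low i ?x = ?a \<and> high i ?x = ?b))"
    unfolding MMR_coprod_def by (rule sum.cong[OF refl])
  also have "\<dots> = (\<Sum>i = 0..length v. if i = ?n then of_bool (mprod ?a ?b ?x) else 0)"
  proof (rule sum.cong[OF refl])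
    fix i assume i: "i \<in> {0..length v}"
    have "i = ?n" if "low i ?x = ?a"
    proof -
      have "set ?a = {1..i}"
        using i arg_cong[OF that, of set] set_word_of[OF sc] by (auto simp: set_low)
      then show ?thesis by simp
    qed
    then show "of_bool (low i ?x = ?a \<and> high i ?x = ?b) = (if i = ?n then of_bool (mprod ?a ?b ?x) else 0)"
      using True adj by (auto simp: mprod_iff word_of_in_mperms_all)
  qed
  also have "\<dots> = mprod_const ?a ?b ?x"
    using mprod_card[of ?a ?b ?x] set_word_of[OF sc] by (auto simp: mprod_const_def)
  finally show ?thesis
    using True v by (simp add: pull_back_def comp_inverse_eq)
qed

text \<open>The two sets in the product are the two kinds of cuts of the word of \<open>v\<close>:
  \<open>?P\<close> cuts after position \<open>?m\<close>, \<open>?Q\<close> shares the letter at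
  that position. They exclude each other by length, so their indicators add.\<close>

lemma MMR_prod_eq:
  assumes p: "p \<in> Mperms_all" and q: "q \<in> Mperms_all"
  shows "MMR_prod (p, q) v = pull_back Mperms_all comp_inverse mcoprod_const p q v"
proof (cases "v \<in> Mperms_all")
  case False
  then have "v \<notin> MMR_prod_comps p q"
    by (auto simp: MMR_prod_comps_def Mperms_all_def Let_def)
  then show ?thesis
    using False by (simp add: MMR_prod_def pull_back_def)
next
  case True
  then obtain N where N: "v \<in> Mperms N" by (auto simp: Mperms_all_def)
  then have sc: "set_composition {1..N} v" and adj: "distinct_adj (word_of v)"
    by (auto simp: Mperms_iff)
  obtain k f where f: "packing k {1..N} f" "v = blocks k {1..N} f"
    using sc by (rule set_composition_cases)
  let ?x = "word_of v" and ?a = "word_of p" and ?b = "word_of q"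
  let ?m = "card (\<Union> (set p))" and ?n = "card (\<Union> (set q))"
  let ?low = "restrict_comp v {1..?m} = p" and ?high = "Mstd (restrict_comp v {?m..N}) = q"
  have Mperms_v: "v \<in> Mperms l \<longleftrightarrow> l = N" for l
    using N sc length_word_of[of "{1..l}" v] length_word_of[OF sc] by (auto simp: Mperms_iff)
  have len_a: "length ?a = ?m" and p_comp: "set_composition {1..?m} p"
    using p length_word_of Union_set_composition by (fastforce simp: Mperms_all_def Mperms_iff)+
  have len_b: "length ?b = ?n"
    using q length_word_of Union_set_composition by (fastforce simp: Mperms_all_def Mperms_iff)
  have len_x: "length ?x = N"
    using length_word_of[OF sc] by simp
  have x: "?x = map f [1..<Suc N]"
    unfolding f(2) by (rule word_of_blocks_interval[OF f(1)])
  note adj_take = distinct_adj_take_drop(1)[OF adj] and adj_drop = distinct_adj_take_drop(2)[OF adj]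
  have low: "?low \<longleftrightarrow> mstd (take ?m ?x) = ?a" if "?m \<le> N"
  proof -
    have int: "{1..N} \<inter> {1..?m} = {1..?m}" using that by auto
    have "sorted_list_of_set {1..?m} = [1..<Suc ?m]"
      using sorted_list_of_set_range[of 1 "Suc ?m"]
      by (simp add: atLeastLessThanSuc_atLeastAtMost del: upt_Suc)
    moreover have "take ?m ?x = map f [1..<Suc ?m]"
      using that take_upt[of 1 ?m "Suc N"] unfolding x take_map by (simp del: upt_Suc)
    ultimately have "word_of (restrict_comp v {1..?m}) = mstd (take ?m ?x)"
      using word_of_restrict_comp(1)[OF f(1), of "{1..?m}"] mstd_eq[OF adj_take[of ?m]]
      unfolding f(2)[symmetric] int by simp
    moreover have "set_composition {1..?m} (restrict_comp v {1..?m})"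
      using word_of_restrict_comp(2)[OF f(1), of "{1..?m}"] unfolding f(2)[symmetric] int .
    ultimately show ?thesis
      using word_of_inject[OF _ p_comp] by auto
  qed
  \<comment> \<open>The word of this restriction is a standardized suffix of a reduced word, hence
    reduced; \<open>Mstd\<close> only renumbers positions here.\<close>
  have high: "Mstd (restrict_comp v {i + 1..N}) = q \<longleftrightarrow> mstd (drop i ?x) = ?b" for i
  proof -
    have int: "{1..N} \<inter> {i + 1..N} = {i + 1..N}" by auto
    have "sorted_list_of_set {i + 1..N} = [i + 1..<Suc N]"
      using sorted_list_of_set_range[of "i + 1" "Suc N"]
      by (simp add: atLeastLessThanSuc_atLeastAtMost del: upt_Suc)
    moreover have "drop i ?x = map f [i + 1..<Suc N]"
      unfolding x drop_map drop_upt by (simp add: add.commute)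
    ultimately have word: "word_of (restrict_comp v {i + 1..N}) = mstd (drop i ?x)"
      using word_of_restrict_comp(1)[OF f(1), of "{i + 1..N}"] mstd_eq[OF adj_drop[of i]]
      unfolding f(2)[symmetric] int by simp
    have "set_composition {i + 1..N} (restrict_comp v {i + 1..N})"
      using word_of_restrict_comp(2)[OF f(1), of "{i + 1..N}"] unfolding f(2)[symmetric] int .
    from Mstd_eq_iff[OF this q] show ?thesis
      using mstd_in[OF adj_drop[of i]] unfolding word
      by (simp add: mperms_all_iff remdups_adj_id)
  qed
  have len_take: "i = ?m" if "i \<le> N" "mstd (take i ?x) = ?a" for i
    using that length_mstd[OF adj_take[of i]] len_a len_x by simp
  have len_drop: "N = i + ?n" if "i \<le> N" "mstd (drop i ?x) = ?b" for i
    using that length_mstd[OF adj_drop[of i]] len_b len_x by simp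
  let ?P = "?m \<le> N \<and> mstd (take ?m ?x) = ?a \<and> mstd (drop ?m ?x) = ?b"
  let ?Q = "1 \<le> ?m \<and> ?m \<le> N \<and> mstd (take ?m ?x) = ?a \<and> mstd (drop (?m - 1) ?x) = ?b"
  have "v \<in> MMR_prod_comps p q \<longleftrightarrow> ?P \<or> ?Q"
  proof -
    have "N = ?m + ?n \<and> ?low \<and> Mstd (restrict_comp v {?m + 1..?m + ?n}) = q \<longleftrightarrow> ?P"
      using low high[of ?m] len_drop[of ?m] by auto
    moreover have "N + 1 = ?m + ?n \<and> ?low \<and> ?high \<longleftrightarrow> ?Q"
    proof (cases "1 \<le> ?m \<and> ?m \<le> N")
      case True
      have "N + 1 = ?m + ?n" if "mstd (drop (?m - 1) ?x) = ?b"
        using len_drop[OF _ that] True by linarith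
      then show ?thesis
        using low high[of "?m - 1"] True by auto
    next
      case False
      have "\<not> (N + 1 = ?m + ?n \<and> ?low \<and> ?high)"
      proof
        assume *: "N + 1 = ?m + ?n \<and> ?low \<and> ?high"
        show False
        \<comment> \<open>For \<open>?m = 0\<close> the restriction to {0..N} is all of
          \<open>v\<close>, as 0 is never a position, and forces N = \<open>?n\<close>. For N <
          \<open>?m\<close> the restriction to {1..\<open>?m\<close>} is all of \<open>v\<close> and
          forces N = \<open>?m\<close>.\<close>
        proof (cases "?m = 0")
          case True
          have "restrict_comp v {0..N} = restrict_comp v {0 + 1..N}"
            using sc unfolding restrict_comp_def set_composition_def
            by (intro arg_cong[of _ _ "filter _"] map_cong refl) (auto simp: Suc_le_eq intro!: gr0I)
          with * True have "Mstd (restrict_comp v {0 + 1..N}) = q" by simp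
          then show False
            using high[of 0] len_drop[of 0] * True by simp
        next
          case nonzero: False
          with False have "N < ?m" by simp
          then have int: "{1..N} \<inter> {1..?m} = {1..N}" by auto
          have "?low" using * by blast
          then have "set_composition {1..N} p"
            using word_of_restrict_comp(2)[OF f(1), of "{1..?m}"] unfolding f(2)[symmetric] int
            by metis
          then have "?m = N" by (simp add: Union_set_composition)
          with \<open>N < ?m\<close> show False by simp
        qed
      qed
      with False show ?thesis by auto
    qed
    ultimately show ?thesis
      unfolding MMR_prod_comps_def Let_def by (auto simp: Mperms_v)
  qed
  moreover have "\<not> (?P \<and> ?Q)"
  proof
    assume PQ: "?P \<and> ?Q"
    then have "N = ?m + ?n" "?m - 1 \<le> N" "1 \<le> ?m"
      using len_drop[of ?m] by simp_all
    moreover from this PQ have "N = ?m - 1 + ?n"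
      using len_drop[of "?m - 1"] by blast
    ultimately show False by linarith
  qed
  ultimately have "MMR_prod (p, q) v = of_bool ?P + of_bool ?Q"
    by (auto simp: MMR_prod_def)
  \<comment> \<open>Standardization preserves length, so among all cuts only the one at
    \<open>?m\<close> can match \<open>?a\<close>; the remaining terms are zero.\<close>
  also have "of_bool ?P = (\<Sum>i = 0..length ?x. if i = ?m then of_bool ?P else 0 :: int)"
    using len_x by simp
  also have "\<dots> = (\<Sum>i = 0..length ?x. basis_elem (mstd (take i ?x), mstd (drop i ?x)) (?a, ?b))"
  proof (rule sum.cong[OF refl])
    fix i assume i: "i \<in> {0..length ?x}"
    show "(if i = ?m then of_bool ?P else 0) = basis_elem (mstd (take i ?x), mstd (drop i ?x)) (?a, ?b)"
    proof (cases "mstd (take i ?x) = ?a")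
      case True
      then have "i = ?m" using len_take[of i] i len_x by simp
      with i len_x show ?thesis by (auto simp: basis_elem_def)
    next
      case False
      then show ?thesis by (auto simp: basis_elem_def)
    qed
  qed
  also have "of_bool ?Q = (\<Sum>i = 1..length ?x. if i = ?m then of_bool ?Q else 0 :: int)"
    using len_x by auto
  also have "\<dots> = (\<Sum>i = 1..length ?x. basis_elem (mstd (take i ?x), mstd (drop (i - 1) ?x)) (?a, ?b))"
  proof (rule sum.cong[OF refl])
    fix i assume i: "i \<in> {1..length ?x}"
    show "(if i = ?m then of_bool ?Q else 0) = basis_elem (mstd (take i ?x), mstd (drop (i - 1) ?x)) (?a, ?b)"
    proof (cases "mstd (take i ?x) = ?a")
      case True
      then have "i = ?m" using len_take[of i] i len_x by simp
      with i len_x show ?thesis by (auto simp: basis_elem_def)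
    next
      case False
      then show ?thesis by (auto simp: basis_elem_def)
    qed
  qed
  finally have "MMR_prod (p, q) v = mcoprod_const ?a ?b ?x"
    using mMR_coprod_eq[OF word_of_in_mperms_all[OF True], of ?a ?b] by (simp add: mMR_coprod_def)
  then show ?thesis
    using True p q by (simp add: pull_back_def comp_inverse_eq)
qed


interpretation mMR: structure_constants mperms_all "[]" mprod_const mcoprod_const
proof
  show "(\<Sum>x. mprod_const a b x * mcoprod_const p q x) =
   (\<Sum>((a1, a2), (b1, b2)). mcoprod_const a1 a2 a * mcoprod_const b1 b2 b *
      mprod_const a1 b1 p * mprod_const a2 b2 q)" for a b p q
    by (rule mprod_mcoprod_compat)
  show "(\<Sum>y. mprod_const a b y * mprod_const y c x) = (\<Sum>y. mprod_const b c y * mprod_const a y x)"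
    for a b c x
    by (rule mprod_const_assoc)
  show "(\<Sum>y. mcoprod_const a b y * mcoprod_const y c x) =
      (\<Sum>y. mcoprod_const b c y * mcoprod_const a y x)" for a b c x
    by (rule mcoprod_const_assoc)
qed (auto simp: Nil_mperms_all mcoprod_const_of_Nil mcoprod_const_Nil mprod_const_def mprod_Nil
    dest: mprod_supp mcoprod_const_supp)

lemma Nil_Mperms_all: "[] \<in> Mperms_all"
  by (auto simp: Mperms_all_def Mperms_def set_composition_def intro!: exI[of _ 0])

interpretation mMR_MMR: dual_bialgebras mperms_all "[]" mprod_const mcoprod_const mMR MMR
  Mperms_all comp_inverse "[]"
proof
  show "bij_betw comp_inverse Mperms_all mperms_all"
    by (rule bij_comp_inverse)
  show "[] \<in> Mperms_all"
    by (rule Nil_Mperms_all)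
  show "comp_inverse [] = []"
    by (simp add: comp_inverse_eq Nil_Mperms_all word_of_def)
  show "finite {(a, b). mprod_const a b x \<noteq> 0}" for x
    by (rule finite_mprod_const)
  show "finite {x. mcoprod_const a b x \<noteq> 0}" for a b
    by (rule finite_mcoprod_const)
  show "mult mMR F = lin_extend (\<lambda>(a, b) x. mprod_const a b x) F"
    if "F \<in> all_combs (mperms_all \<times> mperms_all)" for F
    using that unfolding mMR_def bialg.simps
    by (intro lin_extend_cong[where r = False]) (auto simp: combs_def mMR_prod_eq)
  show "comult mMR f = lin_extend (\<lambda>x (p, q). mcoprod_const p q x) f"
    if "f \<in> all_combs mperms_all" for f
    using that unfolding mMR_def bialg.simps
    by (intro lin_extend_cong[where r = False]) (auto simp: combs_def mMR_coprod_eq)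
  show "mult MMR F = lin_extend (\<lambda>(a, b) x. pull_back Mperms_all comp_inverse mcoprod_const a b x) F"
    if "F \<in> fin_combs (Mperms_all \<times> Mperms_all)" for F
    using that unfolding MMR_def bialg.simps
    by (intro lin_extend_cong[where r = True]) (auto simp: combs_def MMR_prod_eq)
  show "comult MMR f = lin_extend (\<lambda>x (p, q). pull_back Mperms_all comp_inverse mprod_const p q x) f"
    if "f \<in> fin_combs Mperms_all" for f
    using that unfolding MMR_def bialg.simps
    by (intro lin_extend_cong[where r = True]) (auto simp: combs_def MMR_coprod_eq)
qed (simp_all add: mMR_def MMR_def)

text \<open>Existence of an antipode of MMR is a separate clause, since without it the last clause
  could hold vacuously.\<close>

theorem theorem7p12:
  "continuous_dual_bialgebras comp_inverse mMR MMR \<and>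
   (\<exists>T. free_antipode MMR T) \<and>
   (\<forall>T. free_antipode MMR T \<longrightarrow>
      (\<exists>S. continuous_dual_Hopf_algebras comp_inverse mMR S MMR T))"
proof (intro conjI allI impI)
  show "continuous_dual_bialgebras comp_inverse mMR MMR"
    by (rule mMR_MMR.continuous_dual_bialgebras)
  \<comment> \<open>The degree is the number of distinct letters, which under
    \<open>comp_inverse\<close> is the number of blocks; only the empty word has degree 0.\<close>
  show "\<exists>T. free_antipode MMR T"
    by (rule mMR_MMR.antipode_exists[of "\<lambda>x. card (set x)"])
      (auto simp: mprod_const_def mprod_card)
  show "\<exists>S. continuous_dual_Hopf_algebras comp_inverse mMR S MMR T" if "free_antipode MMR T" for T
    using that by (rule mMR_MMR.antipode_transpose)
qed

end
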